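(* Let $u_0=(u_0^1,u_0^2)\in C^\infty(Q^2)$ be divergence-free and periodic. Then there exists a weak solution (in fact, there exist infinitely many weak solutions) $u=u(t,x_1,x_2,x_3)\in C^0([0,\infty);H_w(Q^3))$ of the incompressible three-dimensional Euler equations such that $u(t=0)=(u_0,0)$ and $u$ is not ei-$x_3$ (not essentially independent of $x_3$).
   Context: $Q^N=[0,1]^N$ is the periodic box. The (unforced) Euler equations are $\partial_t u+(u\cdot\nabla)u=-\nabla p$, $\operatorname{div}u=0$. $H(Q^3)$ is the closure in $L^2(Q^3)$ of the $C^\infty$, periodic, divergence-free $\mathbb{R}^3$-valued fields, and $H_w(Q^3)$ is $H(Q^3)$ with the weak $L^2$ topology. $\mathcal{D}(Q^3)$ denotes the $C^\infty$ periodic test fields. Weak solution of the 3D Euler equations with initial velocity $U_0\in H(Q^3)$: a field $u\in C^0([0,\infty);H_w(Q^3))$ such that for every $\phi\in C_c^\infty([0,\infty);\mathcal{D}(Q^3))$ with $\operatorname{div}\phi=0$, $$\int_0^\infty\!\!\int_{Q^3}\{\partial_t\phi\cdot u+[(u\cdot\nabla)\phi]\cdot u\}\,dx\,dt+\int_{Q^3}U_0\cdot\phi(0,x)\,dx=0.$$ A function $f\in L^1(Q^3)$ is ei-$x_3$ (essentially independent of $x_3$) if for almost every $a,b\in(0,1)$, $f(x_1,x_2,a)=f(x_1,x_2,b)$ for almost all $(x_1,x_2)\in Q^2$. A vector field is ei-$x_3$ if each of its components is. A time-dependent field $u$ is ei-$x_3$ if $u(t,\cdot)$ is ei-$x_3$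 for almost every $t$. *)

theory Defs
  imports "HOL-Analysis.Analysis"
begin

section \<open>Smooth periodic fields\<close>

text \<open>
  In \<open>Ck_on k S f\<close> derivatives are taken within \<open>S\<close>.  It is used only for \<open>S = UNIV\<close> and for the
  closed half-space \<open>{0..} \<times> UNIV\<close>, where derivatives within \<open>S\<close> are unique; on the boundary
  of the half-space the time derivative is one-sided.
\<close>

primrec Ck_on :: "nat \<Rightarrow> 'a::euclidean_space set \<Rightarrow> ('a \<Rightarrow> 'b::real_normed_vector) \<Rightarrow> bool" where
  "Ck_on 0 S f \<longleftrightarrow> continuous_on S f"
| "Ck_on (Suc k) S f \<longleftrightarrow>
     f differentiable_on S \<and> (\<forall>b\<in>Basis. Ck_on k S (\<lambda>x. frechet_derivative f (at x within S) b))"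

definition smooth_on :: "'a::euclidean_space set \<Rightarrow> ('a \<Rightarrow> 'b::real_normed_vector) \<Rightarrow> bool" where
  "smooth_on S f \<longleftrightarrow> (\<forall>k. Ck_on k S f)"

definition periodic :: "(real^'n \<Rightarrow> 'b) \<Rightarrow> bool" where
  "periodic f \<longleftrightarrow> (\<forall>x i. f (x + axis i 1) = f x)"

definition partial :: "'n \<Rightarrow> (real^'n \<Rightarrow> 'b::real_normed_vector) \<Rightarrow> real^'n \<Rightarrow> 'b" where
  "partial i f x = frechet_derivative f (at x) (axis i 1)"

definition divergence :: "(real^'n \<Rightarrow> real^'n) \<Rightarrow> real^'n \<Rightarrow> real" where
  "divergence f x = (\<Sum>i\<in>UNIV. partial i f x $ i)"

text \<open>\<open>advect v f x\<close> is \<open>((v \<cdot> \<nabla>) f)(x)\<close> for a vector \<open>v\<close>.\<close>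

definition advect :: "real^'n \<Rightarrow> (real^'n \<Rightarrow> 'b::real_normed_vector) \<Rightarrow> real^'n \<Rightarrow> 'b" where
  "advect v f x = (\<Sum>j\<in>UNIV. (v $ j) *\<^sub>R partial j f x)"

definition smooth_periodic_divfree :: "(real^'n \<Rightarrow> real^'n) \<Rightarrow> bool" where
  "smooth_periodic_divfree f \<longleftrightarrow> smooth_on UNIV f \<and> periodic f \<and> (\<forall>x. divergence f x = 0)"


section \<open>The spaces \<open>L\<^sup>2\<close>, \<open>H\<close> and \<open>H\<^sub>w\<close> on the periodic box\<close>

text \<open>
  Elements of \<open>L\<^sup>2\<close> are represented by functions on all of the space, of which only the values on the
  box matter; two functions represent the same element iff they satisfy \<open>eq_ae\<close>.
\<close>

abbreviation Qbox :: "(real^'n) set" where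
  "Qbox \<equiv> cbox 0 1"

definition eq_ae :: "(real^'n \<Rightarrow> 'b) \<Rightarrow> (real^'n \<Rightarrow> 'b) \<Rightarrow> bool" where
  "eq_ae f g \<longleftrightarrow> (AE x in lebesgue_on Qbox. f x = g x)"

definition L2_fields :: "(real^'n \<Rightarrow> real^'n) set" where
  "L2_fields = {f. f \<in> borel_measurable (lebesgue_on Qbox) \<and>
                   integrable (lebesgue_on Qbox) (\<lambda>x. (norm (f x))\<^sup>2)}"

definition L2_norm :: "(real^'n \<Rightarrow> real^'n) \<Rightarrow> real" where
  "L2_norm f = sqrt (LINT x|lebesgue_on Qbox. (norm (f x))\<^sup>2)"

definition L2_inner :: "(real^'n \<Rightarrow> real^'n) \<Rightarrow> (real^'n \<Rightarrow> real^'n) \<Rightarrow> real" where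
  "L2_inner f g = (LINT x|lebesgue_on Qbox. f x \<bullet> g x)"

definition H_space :: "(real^'n \<Rightarrow> real^'n) set" where
  "H_space = {f \<in> L2_fields.
     \<forall>e>0. \<exists>v. smooth_periodic_divfree v \<and> L2_norm (\<lambda>x. f x - v x) < e}"

text \<open>The weak topology: the coarsest one making all pairings with \<open>L\<^sup>2\<close> fields continuous.\<close>

definition H_weak :: "(real^'n \<Rightarrow> real^'n) topology" where
  "H_weak = topology_generated_by
     {{f \<in> H_space. L2_inner f g \<in> V} |g V. g \<in> L2_fields \<and> open V}"

lemma topspace_H_weak: "topspace (H_weak :: (real^'n \<Rightarrow> real^'n) topology) = H_space"
proof -
  have "(\<lambda>x. 0) \<in> (L2_fields :: (real^'n \<Rightarrow> real^'n) set)"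
    by (simp add: L2_fields_def)
  then show ?thesis
    unfolding H_weak_def topology_generated_by_topspace by blast
qed

lemma continuous_map_H_weak_iff:
  fixes u :: "real \<Rightarrow> real^'n \<Rightarrow> real^'n"
  shows "continuous_map (top_of_set S) H_weak u \<longleftrightarrow>
     (\<forall>t\<in>S. u t \<in> H_space) \<and> (\<forall>g\<in>L2_fields. continuous_on S (\<lambda>t. L2_inner (u t) g))"
    (is "?L \<longleftrightarrow> ?R")
proof
  assume L: ?L
  then have H: "u t \<in> H_space" if "t \<in> S" for t
    using that topspace_H_weak by (fastforce simp: continuous_map_def)
  moreover have "continuous_on S (\<lambda>t. L2_inner (u t) g)" if g: "g \<in> L2_fields" for g
    unfolding continuous_on_open_gen[where T = UNIV, simplified]
  proof (intro allI impI)
    fix V :: "real set" assume "open V"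
    then have "openin H_weak {f \<in> H_space. L2_inner f g \<in> V}"
      unfolding H_weak_def using g by (intro topology_generated_by_Basis) blast
    with L have "openin (top_of_set S) {t \<in> topspace (top_of_set S). u t \<in> {f \<in> H_space. L2_inner f g \<in> V}}"
      unfolding continuous_map_def by blast
    moreover have "{t \<in> topspace (top_of_set S). u t \<in> {f \<in> H_space. L2_inner f g \<in> V}}
                     = S \<inter> (\<lambda>t. L2_inner (u t) g) -` V"
      using H by auto
    ultimately show "openin (top_of_set S) (S \<inter> (\<lambda>t. L2_inner (u t) g) -` V)" by simp
  qed
  ultimately show ?R by blast
next
  assume R: ?R
  show ?L
    unfolding H_weak_def
  proof (rule continuous_on_generated_topo)
    fix U :: "(real^'n \<Rightarrow> real^'n) set"
    assume "U \<in> {{f \<in> H_space. L2_inner f g \<in> V} |g V. g \<in> L2_fields \<and> open V}"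
    then obtain g V where gV: "g \<in> L2_fields" "open V" "U = {f \<in> H_space. L2_inner f g \<in> V}"
      by blast
    have "u -` U \<inter> topspace (top_of_set S) = S \<inter> (\<lambda>t. L2_inner (u t) g) -` V"
      using R gV by auto
    then show "openin (top_of_set S) (u -` U \<inter> topspace (top_of_set S))"
      using R gV by (simp add: continuous_openin_preimage_gen)
  next
    show "u ` topspace (top_of_set S) \<subseteq> 
       \<Union> {{f \<in> H_space. L2_inner f g \<in> V} |g V. g \<in> L2_fields \<and> open V}"
      using R topspace_H_weak[where 'n = 'n]
      unfolding H_weak_def topology_generated_by_topspace by auto
  qed
qed


section \<open>Weak solutions of the three-dimensional Euler equations\<close>

text \<open>
  Solenoidal test fields in \<open>C\<^sub>c\<^sup>\<infinity>([0,\<infinity>); \<D>(Q\<^sup>3))\<close>: jointly smooth up to \<open>t = 0\<close> and with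
  compact support in \<open>[0,\<infinity>)\<close>, so they need not vanish at \<open>t = 0\<close>.
\<close>

definition test_field :: "(real \<Rightarrow> real^3 \<Rightarrow> real^3) \<Rightarrow> bool" where
  "test_field \<phi> \<longleftrightarrow>
     smooth_on ({0..} \<times> UNIV) (\<lambda>(t, x). \<phi> t x) \<and>
     compact (closure {t \<in> {0..}. \<exists>x. \<phi> t x \<noteq> 0}) \<and>
     (\<forall>t\<ge>0. periodic (\<phi> t) \<and> (\<forall>x. divergence (\<phi> t) x = 0))"

text \<open>
  The space-time integral is an iterated one.  Weak continuity of \<open>u\<close> makes both integrands
  integrable (the quadratic term is measurable and locally bounded in time), so the convention that
  the integral of a non-integrable function is 0 plays no role.
\<close>

definition Euler_weak_solution ::
  "(real^3 \<Rightarrow> real^3) \<Rightarrow> (real \<Rightarrow> real^3 \<Rightarrow> real^3) \<Rightarrow> bool" where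
  "Euler_weak_solution U0 u \<longleftrightarrow>
     U0 \<in> H_space \<and>
     continuous_map (top_of_set {0..}) H_weak u \<and>
     (\<forall>\<phi>. test_field \<phi> \<longrightarrow>
        (LINT t|lebesgue_on {0..}. LINT x|lebesgue_on Qbox.
            vector_derivative (\<lambda>s. \<phi> s x) (at t within {0..}) \<bullet> u t x
            + advect (u t x) (\<phi> t) x \<bullet> u t x)
        + (LINT x|lebesgue_on Qbox. U0 x \<bullet> \<phi> 0 x) = 0)"


section \<open>Essential independence of \<open>x\<^sub>3\<close>\<close>

definition ei_x3 :: "(real^3 \<Rightarrow> real) \<Rightarrow> bool" where
  "ei_x3 f \<longleftrightarrow>
     (AE a in lebesgue_on {0<..<1}. AE b in lebesgue_on {0<..<1}.
        AE y in lebesgue_on (Qbox :: (real^2) set).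
          f (vector [y $ 1, y $ 2, a]) = f (vector [y $ 1, y $ 2, b]))"

definition ei_x3_field :: "(real^3 \<Rightarrow> real^3) \<Rightarrow> bool" where
  "ei_x3_field v \<longleftrightarrow> (\<forall>i. ei_x3 (\<lambda>x. v x $ i))"

definition ei_x3_evolution :: "(real \<Rightarrow> real^3 \<Rightarrow> real^3) \<Rightarrow> bool" where
  "ei_x3_evolution u \<longleftrightarrow> (AE t in lebesgue_on {0..}. ei_x3_field (u t))"

text \<open>\<open>planar_lift u0\<close> is \<open>(u0\<^sup>1, u0\<^sup>2, 0)\<close>, extended constantly in \<open>x\<^sub>3\<close>.\<close>

definition planar_lift :: "(real^2 \<Rightarrow> real^2) \<Rightarrow> real^3 \<Rightarrow> real^3" where
  "planar_lift u0 x =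
     (let w = u0 (vector [x $ 1, x $ 2]) in vector [w $ 1, w $ 2, 0])"

end

theory Submission
  imports Defs
begin

text \<open>The solutions are produced by convex integration. A subsolution is a field \<open>v\<close> with a symmetric
  stress \<open>M\<close> that solve \<open>\<partial>\<^sub>t v + div M = -\<nabla>p\<close> weakly while \<open>E = \<rho> I + M - v \<otimes> v\<close> stays positive definite;
  when \<open>E\<close> vanishes, \<open>v\<close> solves the Euler equations. Adding to a subsolution finitely many highly
  oscillating, compactly supported plane waves, each of them an exact solution of the linear
  equation, on small balls given by Vitali covering removes a fixed proportion of the weighted
  integral of \<open>trace E\<close>. The waves oscillate so fast that, at every time, each increment is almost
  orthogonal to all previous terms; hence the iterates converge strongly in \<open>L\<^sup>2\<close> at every time, and the
  limit is a weak solution with the initial value of the first subsolution. Starting from the planar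
  flow perturbed by one explicit wave of amplitude \<open>4\<^sup>-\<^sup>n\<close> depending on \<open>x\<^sub>3\<close>, and keeping the pairing with
  a fixed probe under control, gives solutions that depend on \<open>x\<^sub>3\<close> and are pairwise distinct.\<close>

section \<open>Smooth expressions and periodization\<close>

text \<open>Weak limits lose the quadratic term, so a subsolution carries its own candidate
  \<open>M\<close> for it, and the defect \<open>E\<close> measures the discrepancy. Its stress
  \<open>p \<otimes> m + m \<otimes> p\<close> then cancels the cross terms of
  \<open>(v + p) \<otimes> (v + p)\<close> up to \<open>m - v\<close>, and \<open>E\<close> changes
  by \<open>- p \<otimes> p\<close> plus small errors. The amplitude \<open>w\<close> is chosen with
  \<open>w \<otimes> w\<close> at most half of \<open>E\<close>, which keeps \<open>E\<close>
  positive, and with \<open>w \<bullet> w\<close> at least a sixth of \<open>trace E\<close>, which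
  makes the loss proportional to \<open>trace E\<close>. The energy of the solution is not
  prescribed: boundedness in L2 is secured by letting the spatial mean of \<open>trace M\<close>
  grow by at most a summable amount, at every time. The term \<open>\<rho> I\<close> is a pressure,
  invisible to solenoidal test fields, so a large \<open>\<rho>\<close> turns the initial field,
  held constant in time, into a subsolution; no Euler flow has to be solved first.\<close>

definition flat :: "real poly \<Rightarrow> real \<Rightarrow> real" where
  "flat P s = (if s > 0 then poly P (1 / s) * exp (- (1 / s)) else 0)"

lemma tendsto_poly_times_exp_minus: "((\<lambda>x. poly P x * exp (- x)) \<longlongrightarrow> (0::real)) at_top"
proof -
  have "((\<lambda>x. \<Sum>i\<le>degree P. coeff P i * (x ^ i / exp x)) \<longlongrightarrow> (\<Sum>i\<le>degree P. coeff P i * 0)) at_top"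
    by (intro tendsto_sum tendsto_mult tendsto_const tendsto_power_div_exp_0)
  then show ?thesis
    by (simp add: poly_altdef sum_distrib_right exp_minus divide_inverse mult.assoc)
qed

text \<open>In the variable r = 1/s the derivative is r^2 (P(r) - P'(r)) exp(-r), and
  \<open>[:0, 0, 1:]\<close> is r^2: the functions \<open>flat P\<close> are closed under
  differentiation. At 0 the right difference quotient is r P(r) exp(-r), which tends to 0 as r
  grows.\<close>

lemma flat_has_derivative:
  "(flat P has_real_derivative flat ([:0, 0, 1:] * (P - pderiv P)) s) (at s)"
proof -
  consider "s > 0" | "s < 0" | "s = 0" by linarith
  then show ?thesis
  proof cases
    case 1
    have "((\<lambda>s. poly P (1 / s) * exp (- (1 / s))) has_real_derivative
        flat ([:0, 0, 1:] * (P - pderiv P)) s) (at s)"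
      using 1 by (auto intro!: derivative_eq_intros simp: flat_def field_simps power2_eq_square)
    then show ?thesis
      by (rule has_field_derivative_transform_within_open[where S = "{0<..}"]) (use 1 in \<open>auto simp: flat_def\<close>)
  next
    case 2
    have "((\<lambda>s. 0) has_real_derivative flat ([:0, 0, 1:] * (P - pderiv P)) s) (at s)"
      using 2 by (auto simp: flat_def)
    then show ?thesis
      by (rule has_field_derivative_transform_within_open[where S = "{..<0}"]) (use 2 in \<open>auto simp: flat_def\<close>)
  next
    case 3
    have "((\<lambda>h. poly (pCons 0 P) (1 / h) * exp (- (1 / h))) \<longlongrightarrow> 0) (at_right 0)"
      by (rule filterlim_compose[OF tendsto_poly_times_exp_minus])
        (use filterlim_inverse_at_top_right in \<open>simp add: inverse_eq_divide\<close>)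
    then have "((\<lambda>h. (flat P h - flat P 0) / h) \<longlongrightarrow> 0) (at_right 0)"
      by (rule Lim_transform_eventually)
        (auto simp: flat_def eventually_at_filter intro!: always_eventually)
    moreover have "((\<lambda>h. (flat P h - flat P 0) / h) \<longlongrightarrow> 0) (at_left 0)"
      by (rule tendsto_eventually) (auto simp: flat_def eventually_at_filter)
    ultimately have "((\<lambda>h. (flat P h - flat P 0) / h) \<longlongrightarrow> 0) (at 0)"
      by (simp add: filterlim_split_at_real)
    then show ?thesis
      using 3 by (simp add: DERIV_def flat_def)
  qed
qed

text \<open>The expressions are closed under the formal derivative \<open>dd\<close>, so their values are smooth by coinduction.\<close>

datatype 'a expr = Cst real | Lin 'a | Sqn | Plus "'a expr" "'a expr" | Times "'a expr" "'a expr"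
  | Flat "real poly" "'a expr" | Cosine "'a expr"

primrec eval :: "'a::real_inner expr \<Rightarrow> 'a \<Rightarrow> real" where
  "eval (Cst c) y = c"
| "eval (Lin a) y = a \<bullet> y"
| "eval Sqn y = y \<bullet> y"
| "eval (Plus e f) y = eval e y + eval f y"
| "eval (Times e f) y = eval e y * eval f y"
| "eval (Flat P e) y = flat P (eval e y)"
| "eval (Cosine e) y = cos (eval e y)"

text \<open>The function - sin is written as a cosine shifted by \<open>pi / 2\<close>, so a single
  trigonometric constructor suffices. The polynomial in the \<open>Flat\<close> clause is the one
  from \<open>flat_has_derivative\<close>.\<close>

primrec dd :: "'a::real_inner \<Rightarrow> 'a expr \<Rightarrow> 'a expr" where
  "dd d (Cst c) = Cst 0"
| "dd d (Lin a) = Cst (a \<bullet> d)"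
| "dd d Sqn = Lin (2 *\<^sub>R d)"
| "dd d (Plus e f) = Plus (dd d e) (dd d f)"
| "dd d (Times e f) = Plus (Times (dd d e) f) (Times e (dd d f))"
| "dd d (Flat P e) = Times (Flat ([:0, 0, 1:] * (P - pderiv P)) e) (dd d e)"
| "dd d (Cosine e) = Times (Cosine (Plus e (Cst (pi / 2)))) (dd d e)"

lemma has_derivative_eval:
  fixes e :: "'a::real_inner expr"
  shows "(eval e has_derivative (\<lambda>d. eval (dd d e) y)) (at y)"
proof (induction e)
  case (Flat P e)
  have "(flat P has_derivative (*) (flat ([:0, 0, 1:] * (P - pderiv P)) (eval e y))) (at (eval e y))"
    using flat_has_derivative[of P "eval e y"] by (simp only: has_field_derivative_def)
  from has_derivative_compose[OF Flat this]
  show ?case by (simp del: mult_pCons_left)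
next
  case (Cosine e)
  then show ?case
    by (auto intro!: derivative_eq_intros simp: cos_add)
next
  case Sqn
  show ?case
    by (auto intro!: derivative_eq_intros simp: inner_commute)
qed (auto intro!: derivative_eq_intros simp: mult.commute)

lemma continuous_on_eval [continuous_intros]:
  fixes e :: "'a::real_inner expr"
  assumes "continuous_on S f"
  shows "continuous_on S (\<lambda>x. eval e (f x))"
proof -
  have "continuous_on UNIV (eval e)"
    using has_derivative_eval has_derivative_continuous_on
    by (metis has_derivative_at_withinI)
  then show ?thesis
    using assms by (rule continuous_on_compose2) auto
qed

text \<open>Expressions are syntax, and formal derivatives commute only at the level of values. A
  derivative is determined by the function, so an equation between values may be differentiated
  again; \<open>wave_commutations\<close> chains such steps.\<close>

lemma eval_dd_cong:
  assumes "eval e = eval e'"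
  shows "eval (dd d e) = eval (dd d e')"
proof
  fix y
  show "eval (dd d e) y = eval (dd d e') y"
    using has_derivative_unique[OF has_derivative_eval[of e y]] has_derivative_eval[of e' y] assms
    by (metis)
qed

lemma eval_dd_commute: "eval (dd a (dd b e)) = eval (dd b (dd a e))"
proof -
  have "eval (dd a (dd b e)) y = eval (dd b (dd a e)) y" for y
    by (induction e) (auto simp: algebra_simps inner_commute simp del: mult_pCons_left)
  then show ?thesis by blast
qed

lemma eval_dd_scaleR: "eval (dd (c *\<^sub>R a) e) y = c * eval (dd a e) y"
  using linear_scale[OF has_derivative_linear[OF has_derivative_eval]] by force

lemma eval_dd_zero_outside:
  assumes "closed K" "\<And>y. y \<notin> K \<Longrightarrow> eval e y = 0" "y \<notin> K"
  shows "eval (dd d e) y = 0"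
proof -
  have "((\<lambda>_. 0) has_derivative (\<lambda>d. eval (dd d e) y)) (at y)"
    by (rule has_derivative_transform_within_open[OF has_derivative_eval, where s = "- K"])
      (use assms in \<open>auto simp: open_Compl\<close>)
  from has_derivative_unique[OF this has_derivative_const] show ?thesis
    by metis
qed

lemma eval_bounded:
  fixes e :: "'a::euclidean_space expr"
  assumes "compact K" "\<And>y. y \<notin> K \<Longrightarrow> eval e y = 0"
  obtains B where "B > 0" "\<And>y. \<bar>eval e y\<bar> \<le> B"
proof -
  have "bounded (eval e ` K)"
    by (intro compact_imp_bounded compact_continuous_image assms continuous_on_eval continuous_on_id)
  then obtain B where "B > 0" "\<And>y. y \<in> K \<Longrightarrow> \<bar>eval e y\<bar> \<le> B"
    by (auto simp: bounded_pos)
  then show ?thesis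
    using assms(2) by (intro that[of B]) (auto, metis abs_zero less_eq_real_def)
qed

text \<open>\<open>Ck_on\<close> peels off one derivative at a time, so a set of differentiable
  functions closed under partial derivatives consists of smooth functions, by induction on the
  order. Later smoothness proofs only exhibit such a set.\<close>

lemma smooth_on_coinduct:
  assumes "f \<in> F"
    and "\<And>f x. f \<in> F \<Longrightarrow> f differentiable (at x)"
    and "\<And>f b. f \<in> F \<Longrightarrow> b \<in> Basis \<Longrightarrow> (\<lambda>x. frechet_derivative f (at x) b) \<in> F"
  shows "smooth_on UNIV f"
proof -
  have "Ck_on k UNIV f" if "f \<in> F" for k f
    using that
    by (induction k arbitrary: f)
      (auto simp: assms differentiable_on_def intro!: continuous_at_imp_continuous_on differentiable_imp_continuous_within)
  then show ?thesis
    using assms(1) by (simp add: smooth_on_def)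
qed

lemma smooth_onD:
  assumes "smooth_on UNIV f"
  shows "f differentiable (at x)"
    and "b \<in> Basis \<Longrightarrow> smooth_on UNIV (\<lambda>x. frechet_derivative f (at x) b)"
proof -
  have *: "Ck_on (Suc k) UNIV f" for k
    using assms unfolding smooth_on_def by blast
  show "f differentiable (at x)"
    using *[of 0] by (auto simp: differentiable_on_def)
  show "b \<in> Basis \<Longrightarrow> smooth_on UNIV (\<lambda>x. frechet_derivative f (at x) b)"
    using * by (auto simp: smooth_on_def)
qed

lemma smooth_on_const: "smooth_on UNIV (\<lambda>_. c)"
  by (rule smooth_on_coinduct[where F = "range (\<lambda>c _. c)"]) auto

lemma frechet_derivative_add:
  assumes "f differentiable (at x)" "g differentiable (at x)"
  shows "frechet_derivative (\<lambda>x. f x + g x) (at x) = (\<lambda>d. frechet_derivative f (at x) d + frechet_derivative g (at x) d)"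
  using assms by (intro frechet_derivative_at[symmetric] has_derivative_add) (auto simp: frechet_derivative_works)

lemma smooth_on_add:
  assumes "smooth_on UNIV f" "smooth_on UNIV g"
  shows "smooth_on UNIV (\<lambda>x. f x + g x)"
proof (rule smooth_on_coinduct[where F = "{\<lambda>x. f x + g x |f g. smooth_on UNIV f \<and> smooth_on UNIV g}"])
  fix h :: "'a \<Rightarrow> 'b" and b :: 'a
  assume "h \<in> {\<lambda>x. f x + g x |f g. smooth_on UNIV f \<and> smooth_on UNIV g}" and b: "b \<in> Basis"
  then obtain f g where h: "h = (\<lambda>x. f x + g x)" and *: "smooth_on UNIV f" "smooth_on UNIV g" by blast
  have "frechet_derivative h (at x) b = frechet_derivative f (at x) b + frechet_derivative g (at x) b" for x
    unfolding h by (simp add: frechet_derivative_add smooth_onD(1) *)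
  then show "(\<lambda>x. frechet_derivative h (at x) b) \<in> {\<lambda>x. f x + g x |f g. smooth_on UNIV f \<and> smooth_on UNIV g}"
    using smooth_onD(2)[OF *(1) b] smooth_onD(2)[OF *(2) b] by (auto simp: fun_eq_iff)
qed (use assms smooth_onD(1) in \<open>auto intro!: differentiable_add\<close>)

lemma partial_add:
  assumes "f differentiable (at x)" "g differentiable (at x)"
  shows "partial i (\<lambda>x. f x + g x) x = partial i f x + partial i g x"
  using assms by (simp add: partial_def frechet_derivative_add)

lemma smooth_periodic_divfree_add:
  assumes "smooth_periodic_divfree f" "smooth_periodic_divfree g"
  shows "smooth_periodic_divfree (\<lambda>x. f x + g x)"
  using assms unfolding smooth_periodic_divfree_def divergence_def periodic_def
  by (auto simp: smooth_on_add partial_add smooth_onD(1) sum.distrib)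

section \<open>Periodization of functions supported inside the box\<close>

definition frac_vec :: "real^'n \<Rightarrow> real^'n" where
  "frac_vec x = (\<chi> i. frac (x $ i))"

text \<open>The zero set of \<open>f\<close> contains a neighbourhood of every lattice hyperplane, where \<open>frac_vec\<close> jumps.\<close>

lemma has_derivative_periodization:
  fixes f :: "real^'n \<Rightarrow> 'b::real_normed_vector"
  assumes f: "\<And>x. (f has_derivative f' x) (at x)"
    and \<delta>: "\<delta> > 0" "\<And>x i. f x \<noteq> 0 \<Longrightarrow> \<delta> \<le> x $ i \<and> x $ i \<le> 1 - \<delta>"
    and zero: "\<And>x i. x $ i = 0 \<Longrightarrow> f' x = (\<lambda>_. 0)"
  shows "((\<lambda>x. f (frac_vec x)) has_derivative f' (frac_vec x)) (at x)"
proof (cases "\<exists>i. frac (x $ i) = 0")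
  case True
  then obtain i where i: "frac (x $ i) = 0" by blast
  \<comment> \<open>If \<open>x $ i\<close> is an integer, a point closer than
    \<open>\<delta>\<close> has i-th fractional part below \<open>\<delta>\<close> or above
    \<open>1 - \<delta>\<close>, where \<open>f\<close> vanishes; the bound 1/2 determines the
    integer part on either side.\<close>
  have 0: "f (frac_vec y) = 0" if "y \<in> ball x (min \<delta> (1/2))" for y
  proof -
    have "\<bar>y $ i - x $ i\<bar> < min \<delta> (1/2)"
      using that component_le_norm_cart[of "y - x" i] by (simp add: dist_norm norm_minus_commute)
    moreover have "x $ i = of_int \<lfloor>x $ i\<rfloor>" using i by (simp add: frac_def)
    ultimately have "frac (y $ i) < \<delta> \<or> frac (y $ i) > 1 - \<delta>"
    proof (cases "y $ i \<ge> x $ i")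
      case True
      then have "\<lfloor>y $ i\<rfloor> = \<lfloor>x $ i\<rfloor>"
        using \<open>\<bar>y $ i - x $ i\<bar> < _\<close> \<open>x $ i = _\<close> by (intro floor_unique) linarith+
      then show ?thesis
        using \<open>\<bar>y $ i - x $ i\<bar> < _\<close> \<open>x $ i = _\<close> by (simp add: frac_def) linarith
    next
      case False
      then have "\<lfloor>y $ i\<rfloor> = \<lfloor>x $ i\<rfloor> - 1"
        using \<open>\<bar>y $ i - x $ i\<bar> < _\<close> \<open>x $ i = _\<close> by (intro floor_unique) linarith+
      then show ?thesis
        using \<open>\<bar>y $ i - x $ i\<bar> < _\<close> \<open>x $ i = _\<close> by (simp add: frac_def) linarith
    qed
    then show ?thesis
      using \<delta>(2)[of "frac_vec y" i] by (force simp: frac_vec_def)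
  qed
  have "((\<lambda>x. f (frac_vec x)) has_derivative (\<lambda>_. 0)) (at x)"
    by (rule has_derivative_transform_within_open[OF has_derivative_const[of 0], where s = "ball x (min \<delta> (1/2))"])
      (use 0 \<delta> in auto)
  then show ?thesis
    using zero[of "frac_vec x" i] i by (simp add: frac_vec_def)
next
  case False
  \<comment> \<open>Away from the lattice hyperplanes the integer part is locally constant, so the
    periodization is locally a translate of \<open>f\<close> by the lattice vector
    \<open>z\<close>.\<close>
  define z :: "real^'n" where "z = (\<chi> i. of_int \<lfloor>x $ i\<rfloor>)"
  have "eventually (\<lambda>y. \<lfloor>y $ i\<rfloor> = \<lfloor>x $ i\<rfloor>) (nhds x)" for i
  proof -
    have "x $ i \<notin> \<int>" using False by (simp add: frac_eq_0_iff)
    then have "x \<in> {y :: real^'n. of_int \<lfloor>x $ i\<rfloor> < y $ i \<and> y $ i < of_int \<lfloor>x $ i\<rfloor> + 1}"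
      by (auto simp: less_le) (metis Ints_1 Ints_add Ints_of_int)
    moreover have "open {y :: real^'n. of_int \<lfloor>x $ i\<rfloor> < y $ i \<and> y $ i < of_int \<lfloor>x $ i\<rfloor> + 1}"
      by (intro open_Collect_conj open_Collect_less continuous_intros)
    ultimately show ?thesis
      by (rule eventually_mono[OF eventually_nhds_in_open[rotated]])
        (auto intro!: floor_unique)
  qed
  then have "eventually (\<lambda>y. \<forall>i. \<lfloor>y $ i\<rfloor> = \<lfloor>x $ i\<rfloor>) (nhds x)"
    by (simp add: eventually_all_finite)
  then have ev: "eventually (\<lambda>y. f (frac_vec y) = f (y - z)) (nhds x)"
    by eventually_elim (auto simp: frac_vec_def z_def frac_def intro!: arg_cong[of _ _ f] vec_eq_iff[THEN iffD2])
  have x: "frac_vec x = x - z"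
    by (simp add: frac_vec_def z_def frac_def vec_eq_iff)
  have "((\<lambda>y. f (y - z)) has_derivative f' (x - z)) (at x)"
  proof -
    have "((\<lambda>y. y - z) has_derivative (\<lambda>d. d)) (at x)"
      by (auto intro!: derivative_eq_intros)
    from has_derivative_compose[OF this f] show ?thesis .
  qed
  then show ?thesis
    unfolding x
  proof (rule has_derivative_transform_eventually)
    show "\<forall>\<^sub>F y in at x. f (y - z) = f (frac_vec y)"
      using ev unfolding eventually_nhds_conv_at by (metis (mono_tags, lifting) eventually_mono)
  qed (auto simp: x)
qed

lemma periodic_periodization:
  fixes f :: "real^'n \<Rightarrow> 'b"
  shows "periodic (\<lambda>x. f (frac_vec x))"
proof -
  have "frac (c + (if b then 1 else 0)) = frac (c::real)" for c b
    by (simp add: frac_def)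
  then have "frac_vec (x + axis i 1) = frac_vec x" for x :: "real^'n" and i
    by (simp add: frac_vec_def axis_def vec_eq_iff)
  then show ?thesis
    by (simp add: periodic_def)
qed

lemma frac_vec_on_box:
  assumes "x \<in> cbox 0 1" "\<And>i. x $ i \<noteq> 1"
  shows "frac_vec x = x"
proof -
  have "frac (x $ i) = x $ i" for i
    using assms(1) assms(2)[of i] by (subst frac_eq) (auto simp: mem_box_cart order.strict_iff_order)
  then show ?thesis by (simp add: frac_vec_def vec_eq_iff)
qed

section \<open>Integration over the periodic box\<close>

abbreviation Q3 :: "(real^3) set" where "Q3 \<equiv> cbox 0 1"
abbreviation LQ :: "(real^3) measure" where "LQ \<equiv> lebesgue_on Q3"
abbreviation LT :: "real measure" where "LT \<equiv> lebesgue_on {0..}"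
abbreviation cyl :: "(real \<times> (real^3)) set" where "cyl \<equiv> {0..} \<times> cbox 0 1"
abbreviation ocyl :: "(real \<times> (real^3)) set" where "ocyl \<equiv> {0<..} \<times> box 0 1"

text \<open>The difference quotients \<open>G n\<close> have integral zero because Lebesgue measure
  is translation invariant. They are bounded by \<open>B\<close> through the mean value theorem and
  live in one ball, as the steps have length at most \<open>norm d\<close>; dominated convergence
  passes to the derivative.\<close>

lemma integral_dir_deriv_zero:
  fixes F :: "'a::euclidean_space \<Rightarrow> real"
  assumes der: "\<And>y. (F has_derivative F' y) (at y)"
    and cont: "continuous_on UNIV (\<lambda>y. F' y d)"
    and K: "compact K" "\<And>y. y \<notin> K \<Longrightarrow> F y = 0"
  shows "(LINT y|lborel. F' y d) = 0"
proof -
  have zero: "F' y d = 0" if "y \<notin> K" for y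
  proof -
    have "((\<lambda>_. 0) has_derivative F' y) (at y)"
      by (rule has_derivative_transform_within_open[OF der, where s = "- K"])
        (use that K compact_imp_closed in \<open>auto simp: open_Compl\<close>)
    from has_derivative_unique[OF this has_derivative_const] show ?thesis by simp
  qed
  have "bounded ((\<lambda>y. F' y d) ` K)"
    by (intro compact_imp_bounded compact_continuous_image K continuous_on_subset[OF cont]) auto
  then obtain B where B: "B > 0" "\<And>y. y \<in> K \<Longrightarrow> \<bar>F' y d\<bar> \<le> B"
    by (auto simp: bounded_pos)
  have B': "\<bar>F' y d\<bar> \<le> B" for y
    using B zero[of y] by (cases "y \<in> K") auto
  obtain R where R: "R > 0" "\<And>y. y \<in> K \<Longrightarrow> norm y \<le> R"
    using compact_imp_bounded[OF K(1)] by (auto simp: bounded_pos)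
  have contF: "continuous_on UNIV F"
    using der has_derivative_continuous_on by (metis has_derivative_at_withinI)
  then have [measurable]: "F \<in> borel_measurable borel"
    by (rule borel_measurable_continuous_onI)
  have mF': "(\<lambda>y. F' y d) \<in> borel_measurable borel"
    using cont by (rule borel_measurable_continuous_onI)
  have intF: "integrable lborel F"
  proof -
    have "integrable lborel (\<lambda>x. indicator K x *\<^sub>R F x)"
      by (rule borel_integrable_compact[OF K(1) continuous_on_subset[OF contF]]) auto
    moreover have "(\<lambda>x. indicator K x *\<^sub>R F x) = F"
      using K(2) by (force simp: indicator_def)
    ultimately show ?thesis by simp
  qed
  have shift: "has_bochner_integral lborel (\<lambda>y. F (y + c)) (LINT y|lborel. F y)" for c
  proof -
    have "has_bochner_integral (distr lborel borel ((+) c)) F (LINT y|lborel. F y)"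
      using intF by (simp add: lborel_distr_plus has_bochner_integral_integrable)
    then show ?thesis
      by (subst (asm) has_bochner_integral_iff, subst (asm) integrable_distr_eq; simp?)
        (simp add: has_bochner_integral_iff integral_distr add.commute)
  qed
  define G where "G n y = (F (y + inverse (real (Suc n)) *\<^sub>R d) - F y) * real (Suc n)" for n y
  have "has_bochner_integral lborel (G n) (((LINT y|lborel. F y) - (LINT y|lborel. F y)) * real (Suc n))" for n
    unfolding G_def using shift[of 0]
    by (intro has_bochner_integral_mult_left has_bochner_integral_diff shift) simp
  then have G0: "(LINT y|lborel. G n y) = 0" for n
    by (simp add: has_bochner_integral_iff)
  have Gb: "\<bar>G n y\<bar> \<le> B * indicator (cball 0 (R + norm d)) y" for n y
  proof (cases "norm y \<le> R + norm d")
    case True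
    let ?h = "inverse (real (Suc n))"
    have "\<exists>s\<in>{0<..<?h}. F (y + ?h *\<^sub>R d) - F (y + 0 *\<^sub>R d) = (\<lambda>s'. F' (y + s *\<^sub>R d) (s' *\<^sub>R d)) (?h - 0)"
      by (rule mvt_simple)
        (auto intro!: has_derivative_at_withinI[OF has_derivative_compose[OF _ der]] derivative_eq_intros)
    then obtain s where "F (y + ?h *\<^sub>R d) - F y = F' (y + s *\<^sub>R d) (?h *\<^sub>R d)" by auto
    also have "\<dots> = ?h * F' (y + s *\<^sub>R d) d"
      using linear_scale[OF has_derivative_linear[OF der]] by force
    finally show ?thesis
      using B'[of "y + s *\<^sub>R d"] True by (simp add: G_def field_simps)
  next
    case False
    have "norm y \<le> norm (y + inverse (real (Suc n)) *\<^sub>R d) + norm (inverse (real (Suc n)) *\<^sub>R d)"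
      by (metis add_diff_cancel_right' norm_triangle_ineq4)
    also have "norm (inverse (real (Suc n)) *\<^sub>R d) \<le> norm d"
      by (simp add: mult_left_le_one_le field_simps)
    finally have "y \<notin> K" "y + inverse (real (Suc n)) *\<^sub>R d \<notin> K"
      using False R(2)[of y] R(2)[of "y + inverse (real (Suc n)) *\<^sub>R d"] by (auto, smt (verit) norm_ge_zero)
    then show ?thesis
      using K(2) False by (simp add: G_def)
  qed
  have lim: "(\<lambda>n. G n y) \<longlonglongrightarrow> F' y d" for y
  proof -
    have "((\<lambda>s. F (y + s *\<^sub>R d)) has_derivative (\<lambda>s. F' (y + 0 *\<^sub>R d) (s *\<^sub>R d))) (at 0)"
      by (rule has_derivative_compose[OF _ der]) (auto intro!: derivative_eq_intros)
    then have "((\<lambda>s. F (y + s *\<^sub>R d)) has_real_derivative F' y d) (at 0)"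
      using linear_scale[OF has_derivative_linear[OF der]]
      by (simp add: has_field_derivative_def mult.commute[of _ "F' y d"] mult_commute_abs)
    then have "((\<lambda>h. (F (y + h *\<^sub>R d) - F y) / h) \<longlongrightarrow> F' y d) (at 0)"
      by (simp add: DERIV_def)
    moreover have "filterlim (\<lambda>n. inverse (real (Suc n))) (at 0) sequentially"
      using LIMSEQ_inverse_real_of_nat by (simp add: filterlim_at)
    ultimately have "(\<lambda>n. (F (y + inverse (real (Suc n)) *\<^sub>R d) - F y) / inverse (real (Suc n))) \<longlonglongrightarrow> F' y d"
      by (rule filterlim_compose)
    then show ?thesis by (simp add: G_def field_simps)
  qed
  have "(\<lambda>n. LINT y|lborel. G n y) \<longlonglongrightarrow> (LINT y|lborel. F' y d)"
  proof (rule integral_dominated_convergence[where w = "\<lambda>y. B * indicator (cball 0 (R + norm d)) y"])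
    show "integrable lborel (\<lambda>y. B * indicator (cball 0 (R + norm d)) y)"
      by (intro integrable_mult_right integrable_real_indicator) (auto simp: emeasure_lborel_cball_finite[unfolded infinity_ennreal_def])
    show "G n \<in> borel_measurable lborel" for n unfolding G_def by measurable
    show "(\<lambda>y. F' y d) \<in> borel_measurable lborel" using mF' by simp
  qed (use Gb lim in \<open>auto intro!: AE_I2\<close>)
  then show ?thesis
    using G0 LIMSEQ_unique by (simp add: LIMSEQ_const_iff)
qed

lemma borel_measurable_lebesgue_on:
  "f \<in> borel_measurable borel \<Longrightarrow> f \<in> borel_measurable (lebesgue_on S)"
  by (intro measurable_restrict_space1 measurable_completion) simp

lemma integral_lebesgue_on_eq_lborel:
  fixes f :: "'a::euclidean_space \<Rightarrow> real"
  assumes [measurable]: "f \<in> borel_measurable borel" "S \<in> sets borel"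
  shows "(LINT x|lebesgue_on S. f x) = (LINT x|lborel. indicator S x * f x)"
    and "integrable (lebesgue_on S) f \<longleftrightarrow> integrable lborel (\<lambda>x. indicator S x * f x)"
proof -
  show "(LINT x|lebesgue_on S. f x) = (LINT x|lborel. indicator S x * f x)"
    by (subst integral_restrict_space) (auto simp: integral_completion)
  show "integrable (lebesgue_on S) f \<longleftrightarrow> integrable lborel (\<lambda>x. indicator S x * f x)"
    by (subst integrable_restrict_space) (auto simp: integrable_completion)
qed

lemma integrable_exp_minus_LT: "integrable LT (\<lambda>t. exp (- t) :: real)"
proof -
  have "(\<lambda>t. exp (- t) :: real) absolutely_integrable_on {0..}"
    using integrable_on_exp_minus_to_infinity[of 1 0]
    by (intro nonnegative_absolutely_integrable_1) auto
  then show ?thesis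
    by (simp add: integrable_restrict_space set_integrable_def)
qed

lemma measure_Q3: "emeasure LQ Q3 = 1" "measure LQ Q3 = 1" "finite_measure LQ"
proof -
  have "emeasure lborel (cbox 0 (1::real^3)) = 1"
  proof -
    have "1 \<bullet> b = 1" if "b \<in> Basis" for b :: "real^3"
      using that by (auto simp: Basis_vec_def inner_axis)
    then show ?thesis
      by (simp add: emeasure_lborel_cbox)
  qed
  then show *: "emeasure LQ Q3 = 1"
    by (simp add: emeasure_restrict_space)
  then show "measure LQ Q3 = 1" by (simp add: measure_def)
  show "finite_measure LQ"
    using * by (intro finite_measureI) (simp add: space_restrict_space)
qed

lemma space_LQ: "space LQ = Q3" by (simp add: space_restrict_space)

text \<open>The bound \<open>C * exp (- t)\<close> is integrable over the cylinder because the box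
  has volume 1. This translates between integrals over space-time, where covering and integration by
  parts take place, and the iterated integrals of the weak formulation.\<close>

lemma cyl_bounded_integrable:
  fixes F :: "real \<times> (real^3) \<Rightarrow> real"
  assumes F [measurable]: "F \<in> borel_measurable borel"
    and b: "\<And>y. y \<in> cyl \<Longrightarrow> \<bar>F y\<bar> \<le> C * exp (- fst y)"
  shows "integrable lborel (\<lambda>y. indicator cyl y * F y)"
    and "(LINT y|lborel. indicator cyl y * F y) = (LINT t|LT. LINT x|LQ. F (t, x))"
    and "integrable LT (\<lambda>t. LINT x|LQ. F (t, x))"
proof -
  let ?G = "\<lambda>y. indicator cyl y * F y"
  have [measurable]: "cyl \<in> sets borel" by (intro borel_closed closed_Times) auto
  have [measurable]: "(\<lambda>x. F (t, x)) \<in> borel_measurable borel" for t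
  proof -
    have "(\<lambda>x. F (t, x)) \<in> borel_measurable (borel :: (real^3) measure)"
      by (rule measurable_compose[OF _ F]) (intro borel_measurable_continuous_onI continuous_intros)
    then show ?thesis .
  qed
  have mG: "?G \<in> borel_measurable (lborel \<Otimes>\<^sub>M lborel)" unfolding lborel_prod by measurable
  have ib: "integrable lborel (\<lambda>x. indicator Q3 x :: real)"
    by (intro integrable_real_indicator) (auto simp: emeasure_lborel_cbox_finite[unfolded infinity_ennreal_def])
  have ic: "integrable lborel (\<lambda>x. ?G (t, x))" for t
    by (rule Bochner_Integration.integrable_bound[OF integrable_mult_right[OF ib, of "C * exp (- t)"]])
      (use b[of "(t, _)"] in \<open>auto simp: indicator_def abs_mult intro!: AE_I2 order_trans[OF b[of "(t, _)"]]\<close>)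
  have mN: "(\<lambda>t. LINT x|lborel. norm (?G (t, x))) \<in> borel_measurable lborel"
    using mG by (intro lborel.borel_measurable_lebesgue_integral) simp
  have ie: "integrable lborel (\<lambda>t. indicator {0..} t * exp (- t) :: real)"
    using integrable_exp_minus_LT by (subst (asm) integral_lebesgue_on_eq_lborel) auto
  have vol: "(LINT x|lborel. indicator Q3 x :: real) = 1"
    using integral_lebesgue_on_eq_lborel(1)[of "\<lambda>_. 1" Q3] measure_Q3(2) by (simp add: space_LQ)
  have "(LINT x|lborel. norm (?G (t, x))) \<le> \<bar>C\<bar> * (indicator {0..} t * exp (- t))" for t
  proof -
    have "(LINT x|lborel. norm (?G (t, x))) \<le> (LINT x|lborel. \<bar>C\<bar> * (indicator {0..} t * exp (- t)) * indicator Q3 x)"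
      using ic ib by (intro integral_mono integrable_norm integrable_mult_right)
        (auto simp: indicator_def intro!: order_trans[OF b[of "(t, _)"]] mult_right_mono)
    then show ?thesis using vol by simp
  qed
  then have "integrable lborel (\<lambda>t. LINT x|lborel. norm (?G (t, x)))"
    using ie mN by (intro Bochner_Integration.integrable_bound[OF integrable_mult_right[OF ie, of "\<bar>C\<bar>"]])
      (auto intro!: AE_I2 simp: abs_mult)
  then have *: "integrable (lborel \<Otimes>\<^sub>M lborel) ?G"
    using mG ic by (intro lborel_pair.Fubini_integrable) auto
  then show "integrable lborel ?G" by (simp add: lborel_prod)
  have eq: "(LINT x|lborel. ?G (t, x)) = indicator {0..} t * (LINT x|LQ. F (t, x))" for t
    by (subst integral_lebesgue_on_eq_lborel) (auto simp: indicator_def)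
  have mI: "(\<lambda>t. LINT x|LQ. F (t, x)) \<in> borel_measurable borel"
  proof -
    have [measurable]: "(UNIV \<times> Q3 :: (real \<times> (real^3)) set) \<in> sets borel"
      by (intro borel_closed closed_Times) auto
    have "(\<lambda>y. indicator (UNIV \<times> Q3) y * F y) \<in> borel_measurable (lborel \<Otimes>\<^sub>M lborel)"
      unfolding lborel_prod by measurable
    then have "(\<lambda>t. LINT x|lborel. indicator (UNIV \<times> Q3) (t, x) * F (t, x)) \<in> borel_measurable lborel"
      by (intro lborel.borel_measurable_lebesgue_integral) (simp add: split_beta')
    then have "(\<lambda>t. LINT x|lborel. indicator Q3 x * F (t, x)) \<in> borel_measurable lborel"
      by (simp add: indicator_times)
    then show ?thesis by (subst integral_lebesgue_on_eq_lborel) auto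
  qed
  show "(LINT y|lborel. ?G y) = (LINT t|LT. LINT x|LQ. F (t, x))"
    using lborel_pair.integral_fst'[OF *] unfolding eq lborel_prod
    using integral_lebesgue_on_eq_lborel(1)[OF mI, of "{0..}"] by simp
  show "integrable LT (\<lambda>t. LINT x|LQ. F (t, x))"
    using lborel_pair.integrable_fst'[OF *] unfolding eq
    by (subst integral_lebesgue_on_eq_lborel(2)[OF mI]) auto
qed

lemma continuous_on_integral_LQ:
  fixes F :: "'a::topological_space \<times> (real^3) \<Rightarrow> real"
  assumes "continuous_on (T \<times> Q3) F"
  shows "continuous_on T (\<lambda>t. LINT x|LQ. F (t, x))"
proof -
  have "continuous_on T (\<lambda>t. integral Q3 (\<lambda>x. F (t, x)))"
    using assms by (intro integral_continuous_on_param) simp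
  moreover have "(LINT x|LQ. F (t, x)) = integral Q3 (\<lambda>x. F (t, x))" if "t \<in> T" for t
    using that by (intro lebesgue_integral_eq_integral continuous_imp_integrable)
      (auto intro!: continuous_on_compose2[OF assms] continuous_intros)
  ultimately show ?thesis by simp
qed

lemma integrable_LQ_continuous:
  "continuous_on Q3 f \<Longrightarrow> integrable LQ (f :: _ \<Rightarrow> real)"
  by (rule continuous_imp_integrable)

lemma integrable_LT_compact:
  fixes f :: "real \<Rightarrow> real"
  assumes "continuous_on {0..} f" "\<And>t. t > T \<Longrightarrow> f t = 0"
  shows "integrable LT f"
proof -
  have "f absolutely_integrable_on {0..T}"
    by (intro absolutely_integrable_continuous_real continuous_on_subset[OF assms(1)]) auto
  then have "integrable lebesgue (\<lambda>x. indicator {0..T} x *\<^sub>R f x)"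
    by (simp add: set_integrable_def)
  moreover have "(\<lambda>x. indicator {0..T} x *\<^sub>R f x) = (\<lambda>x. indicator {0..} x *\<^sub>R f x)"
    using assms(2) by (force simp: indicator_def)
  ultimately show ?thesis
    by (simp add: integrable_restrict_space)
qed

lemma uniformly_continuous_compact_support:
  fixes f :: "'a::heine_borel \<Rightarrow> 'b::real_normed_vector"
  assumes "continuous_on UNIV f" "\<And>y. y \<notin> cball a r \<Longrightarrow> f y = 0"
  shows "uniformly_continuous_on UNIV f"
  unfolding uniformly_continuous_on_def
proof (intro allI impI)
  fix e :: real assume "e > 0"
  have "uniformly_continuous_on (cball a (r + 1)) f"
    by (intro compact_uniformly_continuous continuous_on_subset[OF assms(1)]) auto
  then obtain d where d: "d > 0"
    "\<And>x y. x \<in> cball a (r + 1) \<Longrightarrow> y \<in> cball a (r + 1) \<Longrightarrow> dist y x < d \<Longrightarrow> dist (f y) (f x) < e"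
    using \<open>e > 0\<close> unfolding uniformly_continuous_on_def by metis
  have "dist (f y) (f x) < e" if "dist y x < min d 1" for x y
  proof (cases "x \<in> cball a r \<or> y \<in> cball a r")
    case True
    then have "x \<in> cball a (r + 1)" "y \<in> cball a (r + 1)"
      using that dist_triangle[of a x y] dist_triangle[of a y x] by (auto simp: dist_commute)
    then show ?thesis using d that by auto
  next
    case False
    then show ?thesis using assms(2) \<open>e > 0\<close> by simp
  qed
  then show "\<exists>d>0. \<forall>x\<in>UNIV. \<forall>x'\<in>UNIV. dist x' x < d \<longrightarrow> dist (f x') (f x) < e"
    using d(1) by (intro exI[of _ "min d 1"]) auto
qed

section \<open>Test fields and the weak formulation\<close>

abbreviation (input) hcyl :: "(real \<times> (real^3)) set" where "hcyl \<equiv> {0..} \<times> UNIV"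

text \<open>Only first derivatives of a test field enter the weak formulation. The predicate ties
  its two derivative operators to one Frechet derivative on the closed half-space.\<close>

definition test_derivative ::
  "(real \<Rightarrow> real^3 \<Rightarrow> real^3) \<Rightarrow> (real \<times> (real^3) \<Rightarrow> real \<times> (real^3) \<Rightarrow> real^3) \<Rightarrow> real \<Rightarrow> bool" where
  "test_derivative \<phi> \<Phi>' T \<longleftrightarrow>
    (\<forall>y\<in>{0..} \<times> UNIV. ((\<lambda>(t, x). \<phi> t x) has_derivative \<Phi>' y) (at y within {0..} \<times> UNIV)) \<and>
    (\<forall>d. continuous_on ({0..} \<times> UNIV) (\<lambda>y. \<Phi>' y d)) \<and>
    (\<forall>t x. 0 \<le> t \<longrightarrow> vector_derivative (\<lambda>s. \<phi> s x) (at t within {0..}) = \<Phi>' (t, x) (1, 0)) \<and>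
    (\<forall>t x j. 0 \<le> t \<longrightarrow> partial j (\<phi> t) x = \<Phi>' (t, x) (0, axis j 1)) \<and>
    T \<ge> 0 \<and> (\<forall>t x. T < t \<longrightarrow> \<phi> t x = 0) \<and> (\<forall>t x d. T < t \<longrightarrow> \<Phi>' (t, x) d = 0)"

lemma test_derivativeD:
  assumes "test_derivative \<phi> \<Phi>' T"
  shows "\<And>y. y \<in> hcyl \<Longrightarrow> ((\<lambda>(t, x). \<phi> t x) has_derivative \<Phi>' y) (at y within hcyl)"
    "\<And>d. continuous_on hcyl (\<lambda>y. \<Phi>' y d)"
    "\<And>t x. 0 \<le> t \<Longrightarrow> vector_derivative (\<lambda>s. \<phi> s x) (at t within {0..}) = \<Phi>' (t, x) (1, 0)"
    "\<And>t x j. 0 \<le> t \<Longrightarrow> partial j (\<phi> t) x = \<Phi>' (t, x) (0, axis j 1)"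
    "T \<ge> 0" "\<And>t x. T < t \<Longrightarrow> \<phi> t x = 0" "\<And>t x d. T < t \<Longrightarrow> \<Phi>' (t, x) d = 0"
  using assms unfolding test_derivative_def by blast+

lemma slice_has_vector_derivative:
  assumes "((\<lambda>(t, x). \<phi> t x) has_derivative D) (at (t, x) within {0..} \<times> UNIV)" "0 \<le> (t :: real)"
  shows "((\<lambda>s. \<phi> s x) has_vector_derivative D (1, 0)) (at t within {0..})"
proof -
  have 1: "((\<lambda>s. (s, x)) has_derivative (\<lambda>s. (s, 0))) (at t within {0..})"
    by (auto intro!: derivative_eq_intros)
  have 2: "((\<lambda>(t, x). \<phi> t x) has_derivative D) (at (t, x) within (\<lambda>s. (s, x)) ` {0..})"
    by (rule has_derivative_subset[OF assms(1)]) auto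
  have "((\<lambda>s. \<phi> s x) has_derivative (\<lambda>s. D (s, 0))) (at t within {0..})"
    using has_derivative_in_compose[OF 1 2] by simp
  moreover have "(\<lambda>s. D (s, 0)) = (\<lambda>s. s *\<^sub>R D (1, 0))"
  proof
    fix s
    have "D (s *\<^sub>R (1, 0)) = s *\<^sub>R D (1, 0)"
      by (rule linear_scale[OF has_derivative_linear[OF assms(1)]])
    then show "D (s, 0) = s *\<^sub>R D (1, 0)" by simp
  qed
  ultimately show ?thesis by (simp add: has_vector_derivative_def)
qed

lemma test_field_derivative:
  assumes "test_field \<phi>"
  obtains \<Phi>' T where "test_derivative \<phi> \<Phi>' T"
proof -
  let ?\<Phi> = "\<lambda>(t, x). \<phi> t x"
  define \<Phi>' where "\<Phi>' y = frechet_derivative ?\<Phi> (at y within hcyl)" for y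
  have "Ck_on (Suc 0) hcyl ?\<Phi>"
    using assms unfolding test_field_def smooth_on_def by blast
  then have 1: "?\<Phi> differentiable_on hcyl"
    and 2: "\<And>b. b \<in> Basis \<Longrightarrow> continuous_on hcyl (\<lambda>y. \<Phi>' y b)"
    by (auto simp: \<Phi>'_def)
  have der: "(?\<Phi> has_derivative \<Phi>' y) (at y within hcyl)" if "y \<in> hcyl" for y
    using 1 that by (auto simp: \<Phi>'_def differentiable_on_def frechet_derivative_works)
  have cont: "continuous_on hcyl (\<lambda>y. \<Phi>' y d)" for d
  proof -
    have "\<Phi>' y d = (\<Sum>b\<in>Basis. (d \<bullet> b) *\<^sub>R \<Phi>' y b)" if "y \<in> hcyl" for y
    proof -
      have "linear (\<Phi>' y)" using der[OF that] by (rule has_derivative_linear)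
      then have "\<Phi>' y (\<Sum>b\<in>Basis. (d \<bullet> b) *\<^sub>R b) = (\<Sum>b\<in>Basis. (d \<bullet> b) *\<^sub>R \<Phi>' y b)"
        by (simp add: linear_sum linear_scale)
      then show ?thesis by (simp add: euclidean_representation)
    qed
    moreover have "continuous_on hcyl (\<lambda>y. \<Sum>b\<in>Basis. (d \<bullet> b) *\<^sub>R \<Phi>' y b)"
      by (intro continuous_on_sum continuous_on_scaleR continuous_on_const 2)
    ultimately show ?thesis by (subst continuous_on_cong[OF refl])
  qed
  have vd: "vector_derivative (\<lambda>s. \<phi> s x) (at t within {0..}) = \<Phi>' (t, x) (1, 0)" if "0 \<le> t" for t x
  proof -
    have "((\<lambda>s. \<phi> s x) has_vector_derivative \<Phi>' (t, x) (1, 0)) (at t within {0..})"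
      by (rule slice_has_vector_derivative[OF der]) (use that in auto)
    \<comment> \<open>A derivative within a set is unique only at limit points of the set; the
      endpoint \<open>t = 0\<close> of the half-line is the case of interest.\<close>
    moreover have "at t within {0..} \<noteq> bot"
    proof -
      have "{0..} \<noteq> {a}" for a :: real
      proof
        assume *: "{0..} = {a}"
        have "(0 :: real) \<in> {0..}" "(1 :: real) \<in> {0..}" by auto
        then show False unfolding * by simp
      qed
      then have "t islimpt {0..}"
        using that by (intro connected_imp_perfect) auto
      then show ?thesis by (simp add: trivial_limit_within)
    qed
    ultimately show ?thesis
      by (simp add: vector_derivative_within)
  qed
  have pd: "partial j (\<phi> t) x = \<Phi>' (t, x) (0, axis j 1)" if "0 \<le> t" for t x j
  proof -
    have 1: "((\<lambda>z. (t, z)) has_derivative (\<lambda>z. (0, z))) (at x)"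
      by (auto intro!: derivative_eq_intros)
    have 2: "(?\<Phi> has_derivative \<Phi>' (t, x)) (at (t, x) within range (\<lambda>z. (t, z)))"
      by (rule has_derivative_subset[OF der]) (use that in auto)
    have "((\<lambda>z. \<phi> t z) has_derivative (\<lambda>z. \<Phi>' (t, x) (0, z))) (at x)"
      using has_derivative_in_compose[OF 1 2] by simp
    then show ?thesis
      by (simp add: partial_def frechet_derivative_at[symmetric])
  qed
  have "bounded {t \<in> {0..}. \<exists>x. \<phi> t x \<noteq> 0}"
    using assms unfolding test_field_def by (intro bounded_subset[OF compact_imp_bounded closure_subset]) auto
  then obtain T0 where T0: "\<And>t. t \<in> {t \<in> {0..}. \<exists>x. \<phi> t x \<noteq> 0} \<Longrightarrow> \<bar>t\<bar> \<le> T0"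
    by (auto simp: bounded_iff)
  define T where "T = max T0 0"
  have z: "\<phi> t x = 0" if "T < t" for t x
    using T0[of t] that by (auto simp: T_def)
  have "\<Phi>' (t, x) d = 0" if "T < t" for t x d
  proof -
    have "(t, x) \<in> interior hcyl"
      using that by (auto simp: interior_Times T_def)
    then have "at (t, x) within hcyl = at (t, x)" by (rule at_within_interior)
    then have "(?\<Phi> has_derivative \<Phi>' (t, x)) (at (t, x))"
      using der[of "(t, x)"] that by (simp add: T_def)
    moreover have "(?\<Phi> has_derivative (\<lambda>_. 0)) (at (t, x))"
      by (rule has_derivative_transform_within_open[OF has_derivative_const[of 0], where s = "{T<..} \<times> UNIV"])
        (use that z in \<open>auto intro: open_Times\<close>)
    ultimately have "\<Phi>' (t, x) = (\<lambda>_. 0)" by (rule has_derivative_unique)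
    then show ?thesis by simp
  qed
  moreover have "T \<ge> 0" by (simp add: T_def)
  ultimately show thesis
    using that[of \<Phi>' T] der cont vd pd z unfolding test_derivative_def by blast
qed

definition space_time_int :: "(real \<times> (real^3) \<Rightarrow> real) \<Rightarrow> real" where
  "space_time_int F = (LINT t|LT. LINT x|LQ. F (t, x))"

text \<open>Continuity gives integrability in space, vanishing at late times gives integrability in
  time; on this class the iterated integral is linear.\<close>

definition time_supp :: "(real \<times> (real^3) \<Rightarrow> real) \<Rightarrow> bool" where
  "time_supp F \<longleftrightarrow> continuous_on cyl F \<and> (\<exists>T. \<forall>t>T. \<forall>x\<in>Q3. F (t, x) = 0)"

lemma time_supp_integrable:
  assumes "time_supp F"
  shows "t \<ge> 0 \<Longrightarrow> integrable LQ (\<lambda>x. F (t, x))" and "integrable LT (\<lambda>t. LINT x|LQ. F (t, x))"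
proof -
  have c: "continuous_on cyl F" using assms by (simp add: time_supp_def)
  obtain T where T: "\<And>t x. T < t \<Longrightarrow> x \<in> Q3 \<Longrightarrow> F (t, x) = 0" using assms by (auto simp: time_supp_def)
  show "integrable LQ (\<lambda>x. F (t, x))" if "t \<ge> 0"
    using that by (intro integrable_LQ_continuous continuous_on_compose2[OF c] continuous_intros) auto
  have "(LINT x|LQ. F (t, x)) = 0" if "T < t" for t
    using T[OF that] by (subst Bochner_Integration.integral_cong[OF refl, where g = "\<lambda>_. 0"]) (auto simp: space_LQ)
  then show "integrable LT (\<lambda>t. LINT x|LQ. F (t, x))"
    by (intro integrable_LT_compact[of _ T] continuous_on_integral_LQ c)
qed

lemma time_supp_add:
  assumes "time_supp F" "time_supp G"
  shows "time_supp (\<lambda>y. F y + G y)" "space_time_int (\<lambda>y. F y + G y) = space_time_int F + space_time_int G"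
proof -
  obtain T T' where "\<forall>t>T. \<forall>x\<in>Q3. F (t, x) = 0" "\<forall>t>T'. \<forall>x\<in>Q3. G (t, x) = 0"
    using assms unfolding time_supp_def by blast
  then show "time_supp (\<lambda>y. F y + G y)"
    using assms by (auto simp: time_supp_def intro!: continuous_on_add exI[of _ "max T T'"])
  show "space_time_int (\<lambda>y. F y + G y) = space_time_int F + space_time_int G"
  proof -
    have "space_time_int (\<lambda>y. F y + G y) = (LINT t|LT. (LINT x|LQ. F (t, x)) + (LINT x|LQ. G (t, x)))"
      unfolding space_time_int_def
      by (intro Bochner_Integration.integral_cong refl Bochner_Integration.integral_add time_supp_integrable assms)
        (auto simp: space_restrict_space)
    then show ?thesis
      using time_supp_integrable(2)[OF assms(1)] time_supp_integrable(2)[OF assms(2)]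
      by (simp add: space_time_int_def)
  qed
qed

lemma time_supp_cmult:
  assumes "time_supp F"
  shows "time_supp (\<lambda>y. c * F y)" "space_time_int (\<lambda>y. c * F y) = c * space_time_int F"
  using assms by (auto simp: time_supp_def space_time_int_def intro!: continuous_intros)

lemma space_time_int_cong:
  "(\<And>y. y \<in> cyl \<Longrightarrow> F y = G y) \<Longrightarrow> space_time_int F = space_time_int G"
  unfolding space_time_int_def
  by (intro Bochner_Integration.integral_cong refl) (auto simp: space_restrict_space)

text \<open>The integrand of the weak form of
  \<open>\<partial>\<^sub>t p + div P = - \<nabla>q\<close>; the pressure \<open>q\<close> drops out
  because test fields are divergence-free. For \<open>P = outer p p\<close> it is the Euler
  integrand.\<close>

definition tpair ::
  "(real \<Rightarrow> real^3 \<Rightarrow> real^3) \<Rightarrow> (real \<times> (real^3) \<Rightarrow> real^3) \<Rightarrow> (real \<times> (real^3) \<Rightarrow> real^3^3) \<Rightarrow> real \<times> (real^3) \<Rightarrow> real" where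
  "tpair \<phi> p P y = vector_derivative (\<lambda>s. \<phi> s (snd y)) (at (fst y) within {0..}) \<bullet> p y
     + (\<Sum>j\<in>UNIV. \<Sum>i\<in>UNIV. partial j (\<phi> (fst y)) (snd y) $ i * P y $ i $ j)"

lemma time_supp_tpair:
  assumes "test_field \<phi>" "continuous_on cyl p" "continuous_on cyl P"
  shows "time_supp (tpair \<phi> p P)"
proof -
  obtain \<Phi>' T where "test_derivative \<phi> \<Phi>' T"
    using test_field_derivative[OF assms(1)] .
  note \<Phi> = test_derivativeD[OF this]
  have eq: "tpair \<phi> p P y = \<Phi>' y (1, 0) \<bullet> p y + (\<Sum>j\<in>UNIV. \<Sum>i\<in>UNIV. \<Phi>' y (0, axis j 1) $ i * P y $ i $ j)"
    if "fst y \<ge> 0" for y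
    using that by (cases y) (simp add: tpair_def \<Phi>)
  have "continuous_on cyl (\<lambda>y. \<Phi>' y (1, 0) \<bullet> p y + (\<Sum>j\<in>UNIV. \<Sum>i\<in>UNIV. \<Phi>' y (0, axis j 1) $ i * P y $ i $ j))"
    by (intro continuous_intros assms continuous_on_subset[OF \<Phi>(2)]) auto
  then have "continuous_on cyl (tpair \<phi> p P)"
    by (rule continuous_on_eq) (auto simp: eq)
  then show ?thesis
    unfolding time_supp_def using \<Phi>(5,7) eq by (intro conjI exI[of _ T]) auto
qed

definition wk ::
  "(real \<Rightarrow> real^3 \<Rightarrow> real^3) \<Rightarrow> (real \<times> (real^3) \<Rightarrow> real^3) \<Rightarrow> (real \<times> (real^3) \<Rightarrow> real^3^3) \<Rightarrow> real" where
  "wk \<phi> p P = space_time_int (tpair \<phi> p P)"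

lemma wk_add:
  assumes "test_field \<phi>" "continuous_on cyl p" "continuous_on cyl P" "continuous_on cyl p'" "continuous_on cyl P'"
  shows "wk \<phi> (\<lambda>y. p y + p' y) (\<lambda>y. P y + P' y) = wk \<phi> p P + wk \<phi> p' P'"
  unfolding wk_def
  using time_supp_add(2)[OF time_supp_tpair[OF assms(1,2,3)] time_supp_tpair[OF assms(1,4,5)]]
  by (simp add: tpair_def [abs_def] inner_add_right sum.distrib distrib_left add_ac)

text \<open>\<open>G d\<close> is the derivative in direction \<open>d\<close> of the product of
  \<open>f\<close> with \<open>a \<bullet> \<phi>\<close>, and the compact support of
  \<open>f\<close> inside the open cylinder makes its integral vanish.\<close>

lemma space_time_integration_by_parts:
  fixes a :: "real^3" and \<phi> :: "real \<Rightarrow> real^3 \<Rightarrow> real^3"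
  assumes \<phi>: "\<And>y. y \<in> hcyl \<Longrightarrow> ((\<lambda>(t, x). \<phi> t x) has_derivative \<Phi>' y) (at y within hcyl)"
    "\<And>d. continuous_on hcyl (\<lambda>y. \<Phi>' y d)"
    and K: "compact K" "K \<subseteq> ocyl" "\<And>y. y \<notin> K \<Longrightarrow> eval f y = 0"
  defines "G \<equiv> \<lambda>d y. eval f y * (a \<bullet> \<Phi>' y d) + (a \<bullet> \<phi> (fst y) (snd y)) * eval (dd d f) y"
  shows "space_time_int (G d) = 0" "time_supp (G d)"
proof -
  have clK: "closed K" using K(1) by (rule compact_imp_closed)
  have K': "eval (dd d f) y = 0" if "y \<notin> K" for y d
    using eval_dd_zero_outside[OF clK K(3)] that by blast
  \<comment> \<open>A test field is controlled only for nonnegative times. As \<open>K\<close> lies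
    in positive times, cutting off at time 0 gives a function that is differentiable on the whole
    space and unchanged on the cylinder.\<close>
  define F where "F = (\<lambda>y. if fst y > 0 then eval f y * (a \<bullet> \<phi> (fst y) (snd y)) else 0)"
  define F' where "F' = (\<lambda>y d. if fst y > 0 then G d y else 0)"
  have contPhi: "continuous_on hcyl (\<lambda>y. \<phi> (fst y) (snd y))"
    using has_derivative_continuous_on[OF \<phi>(1)] by (simp add: case_prod_unfold)
  have contG: "continuous_on hcyl (G d)" for d
    unfolding G_def by (intro continuous_intros \<phi>(2) contPhi)
  have opos: "open {y :: real \<times> (real^3). fst y > 0}"
    by (intro open_Collect_less continuous_intros)
  have F0: "F y = 0" if "y \<notin> K" for y using K(3)[OF that] by (simp add: F_def)
  have Kpos: "y \<in> K \<Longrightarrow> fst y > 0" for y using K(2) by auto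
  have der: "(F has_derivative F' y) (at y)" for y
  proof (cases "fst y > 0")
    case True
    then have "y \<in> interior hcyl" by (cases y) (auto simp: interior_Times)
    then have d: "((\<lambda>(t, x). \<phi> t x) has_derivative \<Phi>' y) (at y)"
      using \<phi>(1)[of y] at_within_interior[of y hcyl] True by (cases y) auto
    have "((\<lambda>y. eval f y * (a \<bullet> \<phi> (fst y) (snd y))) has_derivative F' y) (at y)"
      using True d
      by (auto intro!: derivative_eq_intros has_derivative_eval simp: F'_def G_def case_prod_unfold fun_eq_iff)
    then show ?thesis
      by (rule has_derivative_transform_within_open[OF _ opos]) (use True in \<open>auto simp: F_def\<close>)
  next
    case False
    then have "y \<notin> K" using Kpos by blast
    then have "(F has_derivative (\<lambda>_. 0)) (at y)"
      by (intro has_derivative_transform_within_open[OF has_derivative_const[of 0], where s = "- K"])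
        (use clK F0 in \<open>auto simp: open_Compl\<close>)
    then show ?thesis using False by (simp add: F'_def)
  qed
  have F'0: "F' y d = 0" if "y \<notin> K" for y d
    using that K(3) K' by (simp add: F'_def G_def)
  have cF': "continuous_on UNIV (\<lambda>y. F' y d)" for d
  proof -
    have "continuous_on ({y. fst y > 0} \<union> - K) (\<lambda>y. F' y d)"
    proof (rule continuous_on_open_Un[OF opos])
      show "continuous_on {y. 0 < fst y} (\<lambda>y. F' y d)"
        by (rule continuous_on_eq[OF continuous_on_subset[OF contG[of d]]]) (auto simp: F'_def)
      show "continuous_on (- K) (\<lambda>y. F' y d)"
        by (rule continuous_on_eq[OF continuous_on_const[of _ 0]]) (use F'0 in auto)
    qed (use clK in auto)
    moreover have "{y. fst y > 0} \<union> - K = UNIV" using Kpos by blast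
    ultimately show ?thesis by simp
  qed
  have eq: "F' y d = G d y" if "y \<in> cyl" for y
  proof (cases "fst y > 0")
    case False
    then have "y \<notin> K" using Kpos by blast
    then show ?thesis using False by (simp add: F'_def G_def K(3) K')
  qed (simp add: F'_def)
  \<comment> \<open>Multiplying by \<open>exp t\<close> on the compact \<open>K\<close> produces a
    bound of the form \<open>C * exp (- t)\<close>, as \<open>cyl_bounded_integrable\<close>
    demands.\<close>
  have "bounded ((\<lambda>y. F' y d * exp (fst y)) ` K)"
    by (intro compact_imp_bounded compact_continuous_image K continuous_intros continuous_on_subset[OF cF']) auto
  then obtain C where C: "\<And>y. y \<in> K \<Longrightarrow> \<bar>F' y d * exp (fst y)\<bar> \<le> C"
    by (auto simp: bounded_iff)
  have bd: "\<bar>F' y d\<bar> \<le> \<bar>C\<bar> * exp (- fst y)" for y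
    using C[of y] F'0[of y d] by (cases "y \<in> K") (auto simp: abs_mult exp_minus field_simps)
  have "0 = (LINT y|lborel. F' y d)"
    using integral_dir_deriv_zero[OF der cF' K(1) F0] by simp
  also have "\<dots> = (LINT y|lborel. indicator cyl y * F' y d)"
  proof (intro Bochner_Integration.integral_cong refl)
    fix y
    have "K \<subseteq> cyl" using K(2) box_subset_cbox[of "0 :: real^3" 1] by fastforce
    then show "F' y d = indicator cyl y * F' y d"
      using F'0[of y d] by (auto simp: indicator_def)
  qed
  also have "\<dots> = space_time_int (\<lambda>y. F' y d)"
    unfolding space_time_int_def
    by (rule cyl_bounded_integrable[OF _ bd]) (intro borel_measurable_continuous_onI cF')
  also have "\<dots> = space_time_int (G d)"
    by (rule space_time_int_cong) (rule eq)
  finally show "space_time_int (G d) = 0" by simp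
  obtain R where R: "\<And>y. y \<in> K \<Longrightarrow> norm y \<le> R"
    using compact_imp_bounded[OF K(1)] by (auto simp: bounded_iff)
  have "(t, x) \<notin> K" if "t > R" for t x
  proof
    assume "(t, x) \<in> K"
    from R[OF this] norm_fst_le[of t x] that show False by simp
  qed
  then show "time_supp (G d)"
    unfolding time_supp_def
    by (intro conjI exI[of _ R] continuous_on_subset[OF contG]) (auto simp: G_def K(3) K')
qed

section \<open>Plane waves\<close>

definition outer :: "real^3 \<Rightarrow> real^3 \<Rightarrow> real^3^3" where
  "outer a b = (\<chi> i j. a $ i * b $ j)"

lemma outer_nth [simp]: "outer a b $ i $ j = a $ i * b $ j"
  by (simp add: outer_def)

lemma continuous_on_outer [continuous_intros]:
  assumes "continuous_on S f" "continuous_on S g"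
  shows "continuous_on S (\<lambda>x. outer (f x) (g x))"
  unfolding outer_def by (intro continuous_intros assms)

text \<open>For \<open>V = w \<partial>\<^sub>\<xi>\<psi> - \<xi> \<partial>\<^sub>w\<psi>\<close>, which is divergence-free, \<open>pw\<close> is \<open>\<partial>\<^sub>\<xi>V\<close> and \<open>qw\<close> is \<open>(\<partial>\<^sub>t + m \<cdot> \<nabla>)V\<close>.\<close>

definition pw :: "(real \<times> (real^3)) expr \<Rightarrow> real^3 \<Rightarrow> real^3 \<Rightarrow> real \<times> (real^3) \<Rightarrow> real^3" where
  "pw \<psi> w \<xi> y = eval (dd (0, \<xi>) (dd (0, \<xi>) \<psi>)) y *\<^sub>R w - eval (dd (0, \<xi>) (dd (0, w) \<psi>)) y *\<^sub>R \<xi>"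

definition qw :: "(real \<times> (real^3)) expr \<Rightarrow> real^3 \<Rightarrow> real^3 \<Rightarrow> real^3 \<Rightarrow> real \<times> (real^3) \<Rightarrow> real^3" where
  "qw \<psi> w \<xi> m y = eval (dd (1, m) (dd (0, \<xi>) \<psi>)) y *\<^sub>R w - eval (dd (1, m) (dd (0, w) \<psi>)) y *\<^sub>R \<xi>"

text \<open>Write D for the derivative along (1, m). The divergences of the four terms are (m .
  \<nabla>) p, 0, - \<partial>_\<xi> D V and 0, the zeros because V is divergence-free. Hence
  \<partial>_t p + div P = D \<partial>_\<xi> V - \<partial>_\<xi> D V = 0: an exact solution with
  zero pressure, whatever \<open>\<psi>\<close> is.\<close>

definition Pw :: "(real \<times> (real^3)) expr \<Rightarrow> real^3 \<Rightarrow> real^3 \<Rightarrow> real^3 \<Rightarrow> real \<times> (real^3) \<Rightarrow> real^3^3" where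
  "Pw \<psi> w \<xi> m y = outer (pw \<psi> w \<xi> y) m + outer m (pw \<psi> w \<xi> y)
     - outer (qw \<psi> w \<xi> m y) \<xi> - outer \<xi> (qw \<psi> w \<xi> m y)"

lemma continuous_wave:
  "continuous_on S (pw \<psi> w \<xi>)" "continuous_on S (qw \<psi> w \<xi> m)" "continuous_on S (Pw \<psi> w \<xi> m)"
  unfolding pw_def [abs_def] qw_def [abs_def] Pw_def [abs_def]
  by (intro continuous_intros)+

lemma wave_commutations:
  fixes \<psi> :: "'a::real_inner expr"
  shows "eval (dd D (dd s (dd s \<psi>))) = eval (dd s (dd D (dd s \<psi>)))"
    "eval (dd D (dd s (dd w \<psi>))) = eval (dd s (dd D (dd w \<psi>)))"
    "eval (dd w (dd s (dd s \<psi>))) = eval (dd s (dd s (dd w \<psi>)))"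
    "eval (dd w (dd D (dd s \<psi>))) = eval (dd s (dd D (dd w \<psi>)))"
proof -
  show "eval (dd w (dd s (dd s \<psi>))) = eval (dd s (dd s (dd w \<psi>)))"
    by (metis eval_dd_commute eval_dd_cong)
  show "eval (dd w (dd D (dd s \<psi>))) = eval (dd s (dd D (dd w \<psi>)))"
    by (metis eval_dd_commute eval_dd_cong)
qed (rule eval_dd_commute)+

lemma wave_weak:
  assumes "test_field \<phi>" and K: "compact K" "K \<subseteq> ocyl" "\<And>y. y \<notin> K \<Longrightarrow> eval \<psi> y = 0"
  shows "wk \<phi> (pw \<psi> w \<xi>) (Pw \<psi> w \<xi> m) = 0"
proof -
  obtain \<Phi>' T where "test_derivative \<phi> \<Phi>' T"
    using test_field_derivative[OF assms(1)] .
  note \<Phi> = test_derivativeD[OF this]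
  define G where "G f a d y = eval f y * (a \<bullet> \<Phi>' y d) + (a \<bullet> \<phi> (fst y) (snd y)) * eval (dd d f) y" for f a d y
  have z2: "eval (dd a (dd b \<psi>)) y = 0" if "y \<notin> K" for a b y
    using eval_dd_zero_outside[OF compact_imp_closed[OF K(1)] eval_dd_zero_outside[OF compact_imp_closed[OF K(1)] K(3)]] that
    by blast
  have G: "space_time_int (G (dd a (dd b \<psi>)) c d) = 0" "time_supp (G (dd a (dd b \<psi>)) c d)" for a b c d
    unfolding G_def [abs_def]
    by (rule space_time_integration_by_parts(1)[OF \<Phi>(1,2) K(1,2) z2], assumption, assumption)
      (rule space_time_integration_by_parts(2)[OF \<Phi>(1,2) K(1,2) z2])
  let ?s = "(0 :: real, \<xi>)" and ?w = "(0 :: real, w)" and ?D = "(1 :: real, m)"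
  let ?A = "dd ?s (dd ?s \<psi>)" and ?B = "dd ?s (dd ?w \<psi>)" and ?\<alpha> = "dd ?D (dd ?s \<psi>)" and ?\<beta> = "dd ?D (dd ?w \<psi>)"
  \<comment> \<open>Each \<open>G\<close> integrates to zero. Their terms without a derivative on
    the test field cancel in four pairs by \<open>wave_commutations\<close>, and what remains is the
    integrand \<open>tpair\<close>.\<close>
  define X where "X y = (G ?A w ?D y + (- 1) * G ?B \<xi> ?D y) + (G ?A m ?w y + (- 1) * G ?B m ?s y)
      + ((- 1) * G ?\<alpha> w ?s y + G ?\<beta> \<xi> ?s y) + ((- 1) * G ?\<alpha> \<xi> ?w y + G ?\<beta> \<xi> ?s y)" for y
  have "tpair \<phi> (pw \<psi> w \<xi>) (Pw \<psi> w \<xi> m) y = X y" if yc: "y \<in> cyl" for y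
  proof -
    obtain t x where y: "y = (t, x)" and t: "t \<ge> 0" using yc by (cases y) auto
    have lin: "linear (\<Phi>' y)" by (rule has_derivative_linear[OF \<Phi>(1)]) (use yc in auto)
    have cp: "(\<Sum>j\<in>UNIV. \<Sum>i\<in>UNIV. \<Phi>' y (0, axis j 1) $ i * (a $ i * b $ j)) = a \<bullet> \<Phi>' y (0, b)" for a b
    proof -
      have "(0 :: real, b) = (\<Sum>j\<in>UNIV. b $ j *\<^sub>R (0, axis j 1))"
        by (simp add: prod_eq_iff fst_sum snd_sum basis_expansion scalar_mult_eq_scaleR[symmetric])
      then have "\<Phi>' y (0, b) = (\<Sum>j\<in>UNIV. b $ j *\<^sub>R \<Phi>' y (0, axis j 1))"
        using lin by (simp add: linear_sum linear_scale del: scaleR_Pair)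
      then show ?thesis
        by (simp add: inner_vec_def sum_distrib_left mult_ac) (rule sum.swap)
    qed
    have spl: "\<Phi>' y (1, m) = \<Phi>' y (1, 0) + \<Phi>' y (0, m)"
      using linear_add[OF lin, of "(1, 0)" "(0, m)"] by simp
    have sub: "\<Phi>' y (0, a *\<^sub>R u - b *\<^sub>R v) = a *\<^sub>R \<Phi>' y (0, u) - b *\<^sub>R \<Phi>' y (0, v)" for a b u v
      using linear_diff[OF lin, of "(0, a *\<^sub>R u)" "(0, b *\<^sub>R v)"] linear_scale[OF lin, of a "(0, u)"]
        linear_scale[OF lin, of b "(0, v)"] by simp
    have "tpair \<phi> (pw \<psi> w \<xi>) (Pw \<psi> w \<xi> m) y = \<Phi>' y (1, 0) \<bullet> pw \<psi> w \<xi> y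
      + (\<Sum>j\<in>UNIV. \<Sum>i\<in>UNIV. \<Phi>' y (0, axis j 1) $ i * Pw \<psi> w \<xi> m y $ i $ j)"
      using t by (simp add: tpair_def y \<Phi>)
    also have "\<dots> = \<Phi>' y (1, 0) \<bullet> pw \<psi> w \<xi> y + (pw \<psi> w \<xi> y \<bullet> \<Phi>' y (0, m) + m \<bullet> \<Phi>' y (0, pw \<psi> w \<xi> y)
       - qw \<psi> w \<xi> m y \<bullet> \<Phi>' y (0, \<xi>) - \<xi> \<bullet> \<Phi>' y (0, qw \<psi> w \<xi> m y))"
      unfolding cp[symmetric] by (simp add: Pw_def sum.distrib sum_subtractf algebra_simps)
    also have "\<dots> = X y"
      by (simp add: X_def G_def pw_def qw_def wave_commutations(1)[of ?D ?s \<psi>] wave_commutations(2)[of ?D ?s ?w \<psi>]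
          wave_commutations(3)[of ?w ?s \<psi>] wave_commutations(4)[of ?w ?D ?s \<psi>] spl sub inner_add_right inner_diff_right inner_diff_left inner_commute algebra_simps)
    finally show ?thesis .
  qed
  then have "wk \<phi> (pw \<psi> w \<xi>) (Pw \<psi> w \<xi> m) = space_time_int X"
    unfolding wk_def by (rule space_time_int_cong)
  also have "\<dots> = 0"
    unfolding X_def by (simp only: time_supp_add time_supp_cmult G)
  finally show ?thesis .
qed

text \<open>\<open>H_space\<close> is defined through smooth periodic solenoidal fields on all of
  space, so the wave has to be extended from the box at each time. Its support keeps a distance
  \<open>\<delta>\<close> from the faces, which makes the periodization smooth.\<close>

lemma wave_divfree:
  assumes K: "compact K" "K \<subseteq> ocyl" "\<And>y. y \<notin> K \<Longrightarrow> eval \<psi> y = 0"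
  shows "\<exists>f. smooth_periodic_divfree f \<and> (\<forall>x\<in>Q3. f x = pw \<psi> w \<xi> (t, x))"
proof -
  have clK: "closed K" using K(1) by (rule compact_imp_closed)
  have box: "0 < snd y $ i \<and> snd y $ i < 1" if "y \<in> K" for y i
    using that K(2) by (auto simp: mem_box_cart)
  obtain \<delta> where \<delta>: "\<delta> > 0" "\<And>y i. y \<in> K \<Longrightarrow> \<delta> \<le> snd y $ i \<and> snd y $ i \<le> 1 - \<delta>"
  proof -
    have "open ocyl" by (intro open_Times) auto
    then obtain e where e: "e > 0" "(\<Union>y\<in>K. ball y e) \<subseteq> ocyl"
      using compact_subset_open_imp_ball_epsilon_subset[OF K(1) _ K(2)] by blast
    have "e / 2 \<le> snd y $ i \<and> snd y $ i \<le> 1 - e / 2" if "y \<in> K" for y i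
    proof -
      have "(fst y, snd y + c *\<^sub>R axis i 1) \<in> ocyl" if "\<bar>c\<bar> < e" for c
      proof -
        have "dist y (fst y, snd y + c *\<^sub>R axis i 1) = \<bar>c\<bar>"
          by (cases y) (simp add: dist_Pair_Pair dist_norm)
        then have "(fst y, snd y + c *\<^sub>R axis i 1) \<in> ball y e" using that by (simp only: mem_ball)
        then show ?thesis using e(2) \<open>y \<in> K\<close> by blast
      qed
      from this[of "e / 2"] this[of "- e / 2"] show ?thesis
        using e(1) by (auto simp: mem_box_cart dest!: spec[of _ i])
    qed
    then show thesis using e(1) that[of "e / 2"] by simp
  qed
  \<comment> \<open>Expressions vanishing off \<open>K\<close> are closed under \<open>dd\<close>;
    they index the family to which \<open>smooth_on_coinduct\<close> is applied.\<close>
  define Z where "Z = {e. \<forall>y. y \<notin> K \<longrightarrow> eval e y = 0}"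
  have Zdd: "dd d e \<in> Z" if "e \<in> Z" for d e
    using eval_dd_zero_outside[OF clK, of e] that unfolding Z_def by blast
  have Z: "\<psi> \<in> Z" using K(3) by (simp add: Z_def)
  define h where "h e1 e2 x = eval e1 (t, frac_vec x) *\<^sub>R w - eval e2 (t, frac_vec x) *\<^sub>R \<xi>" for e1 e2 :: "(real \<times> (real^3)) expr" and x :: "real^3"
  have der1: "((\<lambda>x. eval e (t, frac_vec x)) has_derivative (\<lambda>d. eval (dd (0, d) e) (t, frac_vec x))) (at x)"
    if "e \<in> Z" for e x
  proof (rule has_derivative_periodization[OF _ \<delta>(1), where f = "\<lambda>x. eval e (t, x)"])
    show "((\<lambda>x. eval e (t, x)) has_derivative (\<lambda>d. eval (dd (0, d) e) (t, x))) (at x)" for x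
    proof -
      have "((\<lambda>z. (t, z)) has_derivative (\<lambda>z. (0, z))) (at x)"
        by (auto intro!: derivative_eq_intros)
      from has_derivative_compose[OF this has_derivative_eval] show ?thesis .
    qed
    show "\<delta> \<le> x $ i \<and> x $ i \<le> 1 - \<delta>" if "eval e (t, x) \<noteq> 0" for x i
      using \<delta>(2)[of "(t, x)" i] that \<open>e \<in> Z\<close> by (force simp: Z_def)
    show "(\<lambda>d. eval (dd (0, d) e) (t, x)) = (\<lambda>_. 0)" if "x $ i = 0" for x i
      using box[of "(t, x)" i] that Zdd[OF \<open>e \<in> Z\<close>] by (force simp: Z_def)
  qed
  have der: "(h e1 e2 has_derivative (\<lambda>d. h (dd (0, d) e1) (dd (0, d) e2) x)) (at x)"
    if "e1 \<in> Z" "e2 \<in> Z" for e1 e2 x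
    unfolding h_def by (intro derivative_intros der1 that)
  note fd = frechet_derivative_at[OF der, symmetric]
  let ?e1 = "dd (0, \<xi>) (dd (0, \<xi>) \<psi>)" and ?e2 = "dd (0, \<xi>) (dd (0, w) \<psi>)"
  have "smooth_on UNIV (h ?e1 ?e2)"
  proof (rule smooth_on_coinduct[where F = "{h e1 e2 |e1 e2. e1 \<in> Z \<and> e2 \<in> Z}"])
    show "h ?e1 ?e2 \<in> {h e1 e2 |e1 e2. e1 \<in> Z \<and> e2 \<in> Z}"
      using Zdd Z by blast
    show "f differentiable at x" if "f \<in> {h e1 e2 |e1 e2. e1 \<in> Z \<and> e2 \<in> Z}" for f x
      using that der by (auto simp: differentiable_def)
    show "(\<lambda>x. frechet_derivative f (at x) b) \<in> {h e1 e2 |e1 e2. e1 \<in> Z \<and> e2 \<in> Z}"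
      if fh: "f \<in> {h e1 e2 |e1 e2. e1 \<in> Z \<and> e2 \<in> Z}" for f b
    proof -
      obtain e1 e2 where "f = h e1 e2" "e1 \<in> Z" "e2 \<in> Z" using fh by blast
      then have "(\<lambda>x. frechet_derivative f (at x) b) = h (dd (0, b) e1) (dd (0, b) e2)"
        by (auto simp: fd)
      then show ?thesis using Zdd \<open>e1 \<in> Z\<close> \<open>e2 \<in> Z\<close> by blast
    qed
  qed
  moreover have "periodic (h ?e1 ?e2)"
    unfolding h_def [abs_def]
    by (rule periodic_periodization[where f = "\<lambda>x. eval ?e1 (t, x) *\<^sub>R w - eval ?e2 (t, x) *\<^sub>R \<xi>"])
  moreover have "divergence (h ?e1 ?e2) x = 0" for x
  proof -
    have s: "(\<Sum>i\<in>UNIV. eval (dd (0, axis i 1) e) z * a $ i) = eval (dd (0, a) e) z"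
      for e :: "(real \<times> (real^3)) expr" and z a
    proof -
      have "(0 :: real, a) = (\<Sum>i\<in>UNIV. a $ i *\<^sub>R (0, axis i 1))"
        by (simp add: prod_eq_iff fst_sum snd_sum basis_expansion scalar_mult_eq_scaleR[symmetric])
      then show ?thesis
        using linear_sum[OF has_derivative_linear[OF has_derivative_eval[of e z]], of "\<lambda>i. a $ i *\<^sub>R (0, axis i 1)" UNIV]
        by (simp add: eval_dd_scaleR mult.commute del: scaleR_Pair)
    qed
    have "divergence (h ?e1 ?e2) x = (\<Sum>i\<in>UNIV. h (dd (0, axis i 1) ?e1) (dd (0, axis i 1) ?e2) x $ i)"
      unfolding divergence_def partial_def using Zdd Z by (simp add: fd)
    also have "\<dots> = eval (dd (0, w) ?e1) (t, frac_vec x) - eval (dd (0, \<xi>) ?e2) (t, frac_vec x)"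
      by (simp add: h_def sum_subtractf s)
    also have "\<dots> = 0" by (simp add: wave_commutations(3))
    finally show ?thesis .
  qed
  moreover have "h ?e1 ?e2 x = pw \<psi> w \<xi> (t, x)" if "x \<in> Q3" for x
  \<comment> \<open>On a face \<open>x $ i = 1\<close> the map \<open>frac_vec\<close> jumps to 0 in
    that coordinate, but the point and its image both lie outside \<open>K\<close>, where wave and
    extension vanish.\<close>
  proof (cases "\<exists>i. x $ i = 1")
    case True
    then obtain i where i: "x $ i = 1" by blast
    have "(t, x) \<notin> K" "(t, frac_vec x) \<notin> K"
      using box[of "(t, x)" i] box[of "(t, frac_vec x)" i] i by (auto simp: frac_vec_def)
    then show ?thesis
      using Zdd[OF Zdd[OF Z]] by (simp add: h_def pw_def Z_def)
  next
    case False
    then show ?thesis using frac_vec_on_box[OF that] by (simp add: h_def pw_def)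
  qed
  ultimately show ?thesis
    unfolding smooth_periodic_divfree_def by blast
qed

text \<open>The wave is a derivative along \<open>\<xi>\<close> of functions compactly supported in
  the box. Mean zero at every single time later makes pairings with slowly varying fields small and
  removes the large term from the mean of the trace of the stress.\<close>

lemma wave_mean_zero:
  assumes K: "compact K" "K \<subseteq> ocyl" "\<And>y. y \<notin> K \<Longrightarrow> eval \<psi> y = 0"
  shows "(LINT x|LQ. pw \<psi> w \<xi> (t, x) \<bullet> c) = 0"
proof -
  have clK: "closed K" using K(1) by (rule compact_imp_closed)
  have *: "(LINT x|LQ. eval (dd (0, \<xi>) e) (t, x)) = 0 \<and> integrable LQ (\<lambda>x. eval (dd (0, \<xi>) e) (t, x))"
    if e: "\<And>y. y \<notin> K \<Longrightarrow> eval e y = 0" for e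
  proof
    let ?f = "\<lambda>x. eval (dd (0, \<xi>) e) (t, x)"
    have c: "continuous_on UNIV ?f" by (intro continuous_intros)
    have comp: "compact (snd ` K)" by (intro compact_continuous_image K continuous_intros)
    have "0 = (LINT x|lborel. ?f x)"
    proof (rule integral_dir_deriv_zero[OF _ _ comp, symmetric])
      show "((\<lambda>x. eval e (t, x)) has_derivative (\<lambda>d. eval (dd (0, d) e) (t, x))) (at x)" for x
      proof -
        have "((\<lambda>z. (t, z)) has_derivative (\<lambda>z. (0, z))) (at x)"
          by (auto intro!: derivative_eq_intros)
        from has_derivative_compose[OF this has_derivative_eval] show ?thesis .
      qed
      show "eval e (t, y) = 0" if "y \<notin> snd ` K" for y
        using e[of "(t, y)"] that by force
    qed (rule c)
    also have "\<dots> = (LINT x|lborel. indicator Q3 x * ?f x)"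
    proof (intro Bochner_Integration.integral_cong refl)
      fix x show "?f x = indicator Q3 x * ?f x"
        using eval_dd_zero_outside[OF clK e, of "(t, x)"] K(2) box_subset_cbox[of "0 :: real^3" 1]
        by (auto simp: indicator_def)
    qed
    also have "\<dots> = (LINT x|LQ. ?f x)"
      by (rule integral_lebesgue_on_eq_lborel(1)[symmetric]) (auto intro!: borel_measurable_continuous_onI c)
    finally show "(LINT x|LQ. ?f x) = 0" by simp
    show "integrable LQ ?f"
      by (intro integrable_LQ_continuous continuous_on_subset[OF c]) auto
  qed
  have z: "eval (dd d \<psi>) y = 0" if "y \<notin> K" for d y
    using eval_dd_zero_outside[OF clK K(3)] that by blast
  show ?thesis
    using *[of "dd (0, \<xi>) \<psi>", OF z] *[of "dd (0, w) \<psi>", OF z]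
    by (simp add: pw_def inner_diff_left)
qed

section \<open>Quadratic forms and traces of 3 by 3 matrices\<close>

definition qf :: "real^3^3 \<Rightarrow> real^3 \<Rightarrow> real" where
  "qf A z = z \<bullet> (A *v z)"

lemma qf_algebra:
  "qf (A + B) z = qf A z + qf B z" "qf (A - B) z = qf A z - qf B z" "qf (c *\<^sub>R A) z = c * qf A z"
  "qf (mat 1) z = z \<bullet> z" "qf (outer a b) z = (z \<bullet> a) * (b \<bullet> z)"
proof -
  have "outer a b *v z = (b \<bullet> z) *\<^sub>R a"
    by (simp add: vec_eq_iff matrix_vector_mult_def inner_vec_def sum_distrib_left mult_ac)
  then show "qf (outer a b) z = (z \<bullet> a) * (b \<bullet> z)" by (simp add: qf_def)
qed (simp_all add: qf_def matrix_vector_mult_add_rdistrib matrix_vector_mult_diff_rdistrib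
      scaleR_matrix_vector_assoc[symmetric] inner_add_right inner_diff_right)

lemma trace_algebra:
  fixes A B :: "real^3^3"
  shows "trace (A + B) = trace A + trace B" "trace (A - B) = trace A - trace B"
    "trace (c *\<^sub>R A) = c * trace A" "trace (mat 1 :: real^3^3) = 3" "trace (outer a b) = a \<bullet> b"
  by (simp_all add: trace_def sum.distrib sum_subtractf sum_distrib_left mat_def inner_vec_def)

lemma qf_axis: "qf A (axis i 1) = A $ i $ i"
  by (simp add: qf_def inner_axis' matrix_vector_mul_component inner_axis)

lemma qf_bound: "\<bar>qf A z\<bar> \<le> 3 * norm A * (z \<bullet> z)"
proof -
  have "qf A z = (\<Sum>i\<in>UNIV. z $ i * (A $ i \<bullet> z))"
    by (simp add: qf_def inner_vec_def[of z] matrix_vector_mul_component)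
  also have "\<bar>\<dots>\<bar> \<le> (\<Sum>i\<in>(UNIV :: 3 set). norm A * (z \<bullet> z))"
  proof (rule order_trans[OF sum_abs], rule sum_mono)
    fix i :: 3
    have "\<bar>A $ i \<bullet> z\<bar> \<le> norm A * norm z"
      by (rule order_trans[OF Cauchy_Schwarz_ineq2]) (intro mult_right_mono Finite_Cartesian_Product.norm_nth_le norm_ge_zero)
    then have "\<bar>z $ i\<bar> * \<bar>A $ i \<bullet> z\<bar> \<le> norm z * (norm A * norm z)"
      by (intro mult_mono component_le_norm_cart) auto
    then show "\<bar>z $ i * (A $ i \<bullet> z)\<bar> \<le> norm A * (z \<bullet> z)"
      by (simp add: abs_mult dot_square_norm power2_eq_square mult_ac)
  qed
  finally show ?thesis by simp
qed

lemma qf_lower_bound: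
  assumes "\<And>z. z \<noteq> 0 \<Longrightarrow> qf A z > 0"
  obtains l where "l > 0" "\<And>z. l * (z \<bullet> z) \<le> qf A z"
proof -
  have "compact (sphere (0 :: real^3) 1)" "sphere (0 :: real^3) 1 \<noteq> {}" by auto
  moreover have "continuous_on (sphere (0 :: real^3) 1) (qf A)"
    unfolding qf_def [abs_def] by (intro continuous_intros matrix_vector_mult_linear_continuous_on)
  ultimately obtain x where x: "x \<in> sphere 0 1" "\<And>z. z \<in> sphere 0 1 \<Longrightarrow> qf A x \<le> qf A z"
    using continuous_attains_inf by metis
  have "qf A x * (z \<bullet> z) \<le> qf A z" for z
  proof (cases "z = 0")
    case False
    have "qf A x \<le> qf A ((1 / norm z) *\<^sub>R z)"
      using False by (intro x) auto
    also have "\<dots> = qf A z / (z \<bullet> z)"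
      by (simp add: qf_def matrix_vector_mult_scaleR dot_square_norm power2_eq_square)
    finally show ?thesis
      using False by (simp add: pos_le_divide_eq)
  qed (simp add: qf_def)
  moreover have "qf A x > 0" using assms[of x] x(1) by (cases "x = 0") auto
  ultimately show thesis using that[of "qf A x"] by blast
qed

text \<open>\<open>w\<close> is a multiple of the column of \<open>A\<close> through its largest diagonal entry; the first claim is
  the Cauchy--Schwarz inequality for the form \<open>A\<close>.\<close>

lemma rank_one_below:
  assumes sym: "\<And>i j. A $ i $ j = A $ j $ i" and pos: "\<And>z. z \<noteq> 0 \<Longrightarrow> qf A z > 0"
  obtains w where "\<And>z. (z \<bullet> w)\<^sup>2 \<le> qf A z / 2" "trace A \<le> 6 * (w \<bullet> w)" "2 * (w \<bullet> w) \<le> trace A"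
proof -
  have "Max (range (\<lambda>j. A $ j $ j)) \<in> range (\<lambda>j. A $ j $ j)"
    by (intro Max_in) auto
  then obtain i where "Max (range (\<lambda>j. A $ j $ j)) = A $ i $ i" by blast
  moreover have "A $ j $ j \<le> Max (range (\<lambda>j. A $ j $ j))" for j
    by (intro Max_ge) auto
  ultimately have i: "A $ j $ j \<le> A $ i $ i" for j by metis
  define a where "a = A $ i $ i"
  define u where "u = A *v axis i 1"
  have "axis i (1::real) \<noteq> 0" by (simp add: axis_eq_0_iff)
  then have a: "a > 0" using pos[of "axis i 1"] by (simp add: qf_axis a_def)
  have uz: "axis i 1 \<bullet> (A *v z) = u \<bullet> z" for z
  proof -
    have "transpose A = A" using sym by (simp add: transpose_def vec_eq_iff)
    then show ?thesis
      unfolding u_def using dot_lmul_matrix[of "axis i 1" A z] transpose_matrix_vector[of A "axis i 1"] by simp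
  qed
  have ui: "u $ i = a"
    using uz[of "axis i 1"] by (simp add: inner_axis' inner_axis a_def u_def matrix_vector_mul_component)
  have CS: "(z \<bullet> u)\<^sup>2 \<le> qf A z * a" for z
  proof -
    \<comment> \<open>This choice minimises the form along the line through \<open>z\<close> in
      direction \<open>axis i 1\<close>; nonnegativity at the minimum is the inequality.\<close>
    let ?s = "(z \<bullet> u) / a"
    have "0 \<le> qf A (z - ?s *\<^sub>R axis i 1)"
      using less_imp_le[OF pos[of "z - ?s *\<^sub>R axis i 1"]] by (cases "z - ?s *\<^sub>R axis i 1 = 0") (auto simp: qf_def)
    also have "\<dots> = qf A z - 2 * ?s * (z \<bullet> u) + ?s\<^sup>2 * a"
      using uz[of z] ui
      by (simp add: qf_def matrix_vector_mult_diff_distrib matrix_vector_mult_scaleR inner_diff_left inner_diff_right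
          u_def[symmetric] inner_commute inner_axis power2_eq_square algebra_simps)
    also have "\<dots> = qf A z - (z \<bullet> u)\<^sup>2 / a"
      using a by (simp add: power2_eq_square field_simps)
    finally show ?thesis using a by (simp add: field_simps)
  qed
  \<comment> \<open>The factor 2 under the root makes \<open>outer w w\<close> at most
    \<open>A / 2\<close>, so the other half of \<open>A\<close> can absorb errors. Since
    \<open>trace A \<le> 3 * a\<close> and \<open>a / 2 \<le> w \<bullet> w\<close>, the constant 6
    results.\<close>
  define w where "w = (1 / sqrt (2 * a)) *\<^sub>R u"
  have w: "(z \<bullet> w)\<^sup>2 = (z \<bullet> u)\<^sup>2 / (2 * a)" for z
    using a by (simp add: w_def power_mult_distrib power_divide)
  have 1: "(z \<bullet> w)\<^sup>2 \<le> qf A z / 2" for z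
    using CS[of z] a by (simp add: w field_simps)
  have tr: "trace A = (\<Sum>j\<in>UNIV. A $ j $ j)" by (simp add: trace_def)
  have "w \<bullet> w = (u \<bullet> u) / (2 * a)"
    using a by (simp add: w_def power2_eq_square[symmetric] field_simps)
  moreover have "a\<^sup>2 \<le> u \<bullet> u"
    using component_le_norm_cart[of u i] ui a by (simp add: dot_square_norm abs_le_square_iff)
  ultimately have "a * a \<le> a * (2 * (w \<bullet> w))"
    using a by (simp add: power2_eq_square field_simps)
  then have "a / 2 \<le> w \<bullet> w" using a by simp
  moreover have "trace A \<le> 3 * a"
  proof -
    have "trace A \<le> (\<Sum>j\<in>(UNIV :: 3 set). a)" unfolding tr a_def by (intro sum_mono i)
    then show ?thesis by simp
  qed
  ultimately have 2: "trace A \<le> 6 * (w \<bullet> w)" by simp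
  have "w \<bullet> w = (\<Sum>j\<in>UNIV. (axis j 1 \<bullet> w)\<^sup>2)"
    by (simp add: inner_vec_def[of w] inner_axis' power2_eq_square)
  also have "\<dots> \<le> (\<Sum>j\<in>UNIV. A $ j $ j / 2)"
    using 1 by (intro sum_mono) (metis qf_axis)
  finally have 3: "2 * (w \<bullet> w) \<le> trace A"
    by (simp add: tr sum_divide_distrib[symmetric])
  show thesis using 1 2 3 by (rule that)
qed

text \<open>Adding such a pair to a subsolution preserves every clause of \<open>subsol\<close>
  except the positivity of the defect. Vanishing for nonpositive times protects the initial
  value.\<close>

definition inc :: "(real \<times> (real^3) \<Rightarrow> real^3) \<Rightarrow> (real \<times> (real^3) \<Rightarrow> real^3^3) \<Rightarrow> bool" where
  "inc p P \<longleftrightarrow> continuous_on UNIV p \<and> continuous_on UNIV P \<and> uniformly_continuous_on UNIV p \<and>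
     (\<exists>B. \<forall>y. norm (p y) \<le> B \<and> norm (P y) \<le> B) \<and> (\<forall>y i j. P y $ i $ j = P y $ j $ i) \<and>
     (\<forall>y. fst y \<le> 0 \<longrightarrow> p y = 0) \<and>
     (\<forall>t. \<exists>f. smooth_periodic_divfree f \<and> (\<forall>x\<in>Q3. f x = p (t, x))) \<and>
     (\<forall>\<phi>. test_field \<phi> \<longrightarrow> wk \<phi> p P = 0)"

lemma wave_zero:
  assumes "closed K" "\<And>y. y \<notin> K \<Longrightarrow> eval \<psi> y = 0" "y \<notin> K"
  shows "pw \<psi> w \<xi> y = 0" "qw \<psi> w \<xi> m y = 0" "Pw \<psi> w \<xi> m y = 0"
proof -
  have "eval (dd a (dd b \<psi>)) y = 0" for a b
    using eval_dd_zero_outside[OF assms(1) eval_dd_zero_outside[OF assms(1,2)] assms(3)] .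
  then show "pw \<psi> w \<xi> y = 0" "qw \<psi> w \<xi> m y = 0" "Pw \<psi> w \<xi> m y = 0"
    by (auto simp: pw_def qw_def Pw_def outer_def vec_eq_iff)
qed

lemma wave_inc:
  assumes K: "cball y0 r \<subseteq> ocyl" "\<And>y. y \<notin> cball y0 r \<Longrightarrow> eval \<psi> y = 0"
  shows "inc (pw \<psi> w \<xi>) (Pw \<psi> w \<xi> m)"
proof -
  have z: "pw \<psi> w \<xi> y = 0" "Pw \<psi> w \<xi> m y = 0" if "y \<notin> cball y0 r" for y
    using wave_zero[of "cball y0 r" \<psi> y] K(2) that by auto
  have "\<exists>B. \<forall>y. norm (f y) \<le> B"
    if "continuous_on UNIV f" "\<And>y. y \<notin> cball y0 r \<Longrightarrow> f y = 0" for f :: "real \<times> (real^3) \<Rightarrow> 'a::real_normed_vector"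
  proof -
    have "bounded (f ` cball y0 r)"
      by (intro compact_imp_bounded compact_continuous_image continuous_on_subset[OF that(1)]) auto
    then obtain B where B: "\<forall>y\<in>cball y0 r. norm (f y) \<le> B" unfolding bounded_iff by blast
    have "norm (f y) \<le> max B 0" for y
      using that(2)[of y] B by (cases "y \<in> cball y0 r") (auto simp: max.coboundedI1)
    then show ?thesis by blast
  qed
  note b = this
  obtain B1 where B1: "\<And>y. norm (pw \<psi> w \<xi> y) \<le> B1"
    using b[OF continuous_wave(1) z(1)] by blast
  obtain B2 where B2: "\<And>y. norm (Pw \<psi> w \<xi> m y) \<le> B2"
    using b[OF continuous_wave(3) z(2)] by blast
  have "norm (pw \<psi> w \<xi> y) \<le> max B1 B2 \<and> norm (Pw \<psi> w \<xi> m y) \<le> max B1 B2" for y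
    using B1[of y] B2[of y] by auto
  moreover have "Pw \<psi> w \<xi> m y $ i $ j = Pw \<psi> w \<xi> m y $ j $ i" for y i j
    by (simp add: Pw_def)
  moreover have "pw \<psi> w \<xi> y = 0" if "fst y \<le> 0" for y
    using z(1)[of y] K(1) that by fastforce
  moreover have "uniformly_continuous_on UNIV (pw \<psi> w \<xi>)"
    using uniformly_continuous_compact_support[OF continuous_wave(1), of y0 r] z(1) by blast
  moreover have "\<exists>f. smooth_periodic_divfree f \<and> (\<forall>x\<in>Q3. f x = pw \<psi> w \<xi> (t, x))" for t
    using wave_divfree[OF compact_cball K(1), of \<psi>] K(2) by blast
  moreover have "wk \<phi> (pw \<psi> w \<xi>) (Pw \<psi> w \<xi> m) = 0" if "test_field \<phi>" for \<phi>
    using wave_weak[OF that compact_cball K(1), of \<psi>] K(2) by blast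
  ultimately show ?thesis
    unfolding inc_def by (intro conjI continuous_wave exI[of _ "max B1 B2"]) blast+
qed

section \<open>Localized high-frequency waves\<close>

lemma eval_dd2_modulated:
  "eval (dd a (dd b (Times (Cst k) (Times X (Cosine (Plus (Lin v) (Cst \<kappa>))))))) y =
    k * (eval (dd a (dd b X)) y * cos (v \<bullet> y + \<kappa>) - eval (dd b X) y * sin (v \<bullet> y + \<kappa>) * (v \<bullet> a)
      - eval (dd a X) y * sin (v \<bullet> y + \<kappa>) * (v \<bullet> b) - eval X y * cos (v \<bullet> y + \<kappa>) * (v \<bullet> a) * (v \<bullet> b))"
proof -
  have c: "cos (x + \<kappa> + pi / 2) = - sin (x + \<kappa>)" for x
    by (simp only: cos_add[of "x + \<kappa>"] cos_pi_half sin_pi_half mult_zero_right mult_1_right diff_0)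
  moreover have "cos (x + (\<kappa> + pi / 2)) = - sin (x + \<kappa>)" for x
    using c[of x] by (simp add: add.assoc)
  moreover have "cos (x + \<kappa> + pi / 2 + pi / 2) = - cos (x + \<kappa>)" for x
    using cos_periodic_pi[of "x + \<kappa>"] by (simp add: add.assoc)
  ultimately show ?thesis by simp
qed

text \<open>The standard bump exp(1 - 1/g) with g = 1 - |y - y0|^2 / r^2. The square is multiplied
  out to fit the expression language, and \<open>[:exp 1:]\<close> normalises the value at the
  centre to 1.\<close>

definition cutoff :: "'a::real_inner \<Rightarrow> real \<Rightarrow> 'a expr" where
  "cutoff y0 r = Flat [:exp 1:] (Plus (Cst (1 - (y0 \<bullet> y0) / r\<^sup>2))
     (Plus (Lin ((2 / r\<^sup>2) *\<^sub>R y0)) (Times (Cst (- 1 / r\<^sup>2)) Sqn)))"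

lemma eval_cutoff: "eval (cutoff y0 r) y = flat [:exp 1:] (1 - (dist y0 y)\<^sup>2 / r\<^sup>2)"
  by (simp add: cutoff_def dist_norm power2_norm_eq_inner inner_diff_left inner_diff_right inner_commute
      diff_divide_distrib add_divide_distrib algebra_simps)

lemma cutoff_bounds:
  assumes "r > 0"
  shows "0 \<le> eval (cutoff y0 r) y" "eval (cutoff y0 r) y \<le> 1"
    and "y \<notin> ball y0 r \<Longrightarrow> eval (cutoff y0 r) y = 0"
    and "y \<in> cball y0 (r / 2) \<Longrightarrow> 1 / 2 \<le> eval (cutoff y0 r) y"
proof -
  let ?g = "1 - (dist y0 y)\<^sup>2 / r\<^sup>2"
  have fl: "flat [:exp 1:] s = exp (1 - 1 / s)" if "s > 0" for s
    using that by (simp add: flat_def mult_exp_exp)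
  show "0 \<le> eval (cutoff y0 r) y" by (simp add: eval_cutoff flat_def)
  show "eval (cutoff y0 r) y \<le> 1"
  proof (cases "?g > 0")
    case True
    then have "1 \<le> 1 / ?g" by (simp add: pos_le_divide_eq)
    then show ?thesis using fl[OF True] by (simp add: eval_cutoff)
  qed (simp add: eval_cutoff flat_def)
  show "eval (cutoff y0 r) y = 0" if "y \<notin> ball y0 r"
  proof -
    have "r\<^sup>2 \<le> (dist y0 y)\<^sup>2" using that assms by (intro power_mono) auto
    then have "?g \<le> 0" using assms by simp
    then show ?thesis by (simp add: eval_cutoff flat_def)
  qed
  show "1 / 2 \<le> eval (cutoff y0 r) y" if "y \<in> cball y0 (r / 2)"
  proof -
    have "(dist y0 y)\<^sup>2 \<le> (r / 2)\<^sup>2" using that by (intro power_mono) auto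
    then have g: "?g \<ge> 3 / 4" using assms by (simp add: power2_eq_square field_simps)
    then have "1 / ?g \<le> 1 / (3 / 4)" by (intro divide_left_mono) auto
    then have "1 + (1 - 1 / ?g) \<ge> 1 / 2" by simp
    then have "exp (1 - 1 / ?g) \<ge> 1 / 2" using exp_ge_add_one_self[of "1 - 1 / ?g"] by linarith
    moreover have "?g > 0" using g by linarith
    ultimately show ?thesis unfolding eval_cutoff using fl by metis
  qed
qed

text \<open>The potential is \<open>1 / N\<^sup>2\<close> times a cutoff times a cosine of frequency
  \<open>N\<close> in direction \<open>\<xi>\<close>. Two derivatives along \<open>\<xi>\<close>
  produce \<open>N\<^sup>2\<close> and leave a profile \<open>s\<close> of order one. The cosine is
  constant along \<open>w\<close> and \<open>(1, m)\<close>, so derivatives there fall on the cutoff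
  and all other terms are O(1/N).\<close>

lemma wave_exists:
  fixes y0 :: "real \<times> (real^3)"
  assumes r: "r > 0" and \<xi>: "norm \<xi> = 1" "\<xi> \<bullet> w = 0" and \<epsilon>: "\<epsilon> > 0"
  shows "\<exists>\<psi> s. (\<forall>y. y \<notin> cball y0 (r / 2) \<longrightarrow> eval \<psi> y = 0) \<and>
    (\<forall>y. \<bar>s y\<bar> \<le> 1) \<and> continuous_on UNIV s \<and> (\<forall>y. y \<notin> ball y0 r \<longrightarrow> s y = 0) \<and>
    (\<forall>y. norm (pw \<psi> w \<xi> y - s y *\<^sub>R w) \<le> \<epsilon>) \<and> (\<forall>y. norm (qw \<psi> w \<xi> m y) \<le> \<epsilon>) \<and>
    measure lborel (ball y0 r) / 2048 \<le> (LINT y|lborel. (s y)\<^sup>2)"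
proof -
  let ?s = "(0 :: real, \<xi>)" and ?w = "(0 :: real, w)" and ?D = "(1 :: real, m)"
  define X where "X = cutoff y0 (r / 2)"
  have r2: "r / 2 > 0" using r by simp
  note Xb = cutoff_bounds[OF r2, where ?y0.0 = y0, folded X_def]
  have X0: "eval X y = 0" if "y \<notin> cball y0 (r / 2)" for y
    using that Xb(3)[of y] by auto
  have z1: "eval (dd a X) y = 0" if "y \<notin> cball y0 (r / 2)" for a y
    using eval_dd_zero_outside[OF closed_cball _ that] X0 by blast
  have z2: "eval (dd a (dd b X)) y = 0" if "y \<notin> cball y0 (r / 2)" for a b y
    using eval_dd_zero_outside[OF closed_cball _ that] z1 by blast
  have b: "\<exists>B>0. \<forall>y. \<bar>eval (dd a X) y\<bar> \<le> B \<and> \<bar>eval (dd a (dd b X)) y\<bar> \<le> B" for a b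
  proof -
    obtain B1 where "B1 > 0" "\<And>y. \<bar>eval (dd a X) y\<bar> \<le> B1"
      using eval_bounded[OF compact_cball, of y0 "r / 2" "dd a X"] z1 by blast
    moreover obtain B2 where "B2 > 0" "\<And>y. \<bar>eval (dd a (dd b X)) y\<bar> \<le> B2"
      using eval_bounded[OF compact_cball, of y0 "r / 2" "dd a (dd b X)"] z2 by blast
    ultimately show ?thesis by (intro exI[of _ "max B1 B2"]) (auto simp: le_max_iff_disj)
  qed
  obtain B1 where B1: "B1 > 0" "\<forall>y. \<bar>eval (dd ?s X) y\<bar> \<le> B1 \<and> \<bar>eval (dd ?s (dd ?s X)) y\<bar> \<le> B1"
    using b by blast
  obtain B2 where B2: "B2 > 0" "\<forall>y. \<bar>eval (dd ?w X) y\<bar> \<le> B2 \<and> \<bar>eval (dd ?w (dd ?s X)) y\<bar> \<le> B2"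
    using b by blast
  obtain B3 where B3: "B3 > 0" "\<forall>y. \<bar>eval (dd ?D X) y\<bar> \<le> B3 \<and> \<bar>eval (dd ?D (dd ?s X)) y\<bar> \<le> B3"
    using b by blast
  obtain B4 where B4: "B4 > 0" "\<forall>y. \<bar>eval (dd ?D X) y\<bar> \<le> B4 \<and> \<bar>eval (dd ?D (dd ?w X)) y\<bar> \<le> B4"
    using b by blast
  note B2' = B2(2)[unfolded eval_dd_commute[of ?w ?s X]]
  define C where "C = B1 + B2 + B3 + B4"
  have C: "C > 0" "\<And>y. \<bar>eval (dd ?s X) y\<bar> \<le> C" "\<And>y. \<bar>eval (dd ?s (dd ?s X)) y\<bar> \<le> C"
    "\<And>y. \<bar>eval (dd ?w X) y\<bar> \<le> C" "\<And>y. \<bar>eval (dd ?s (dd ?w X)) y\<bar> \<le> C"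
    "\<And>y. \<bar>eval (dd ?D X) y\<bar> \<le> C" "\<And>y. \<bar>eval (dd ?D (dd ?s X)) y\<bar> \<le> C"
    "\<And>y. \<bar>eval (dd ?D (dd ?w X)) y\<bar> \<le> C"
  proof -
    have "B1 \<le> C" "B2 \<le> C" "B3 \<le> C" "B4 \<le> C" "C > 0"
      using B1(1) B2(1) B3(1) B4(1) by (auto simp: C_def)
    then show "C > 0" "\<And>y. \<bar>eval (dd ?s X) y\<bar> \<le> C" "\<And>y. \<bar>eval (dd ?s (dd ?s X)) y\<bar> \<le> C"
      "\<And>y. \<bar>eval (dd ?w X) y\<bar> \<le> C" "\<And>y. \<bar>eval (dd ?s (dd ?w X)) y\<bar> \<le> C"
      "\<And>y. \<bar>eval (dd ?D X) y\<bar> \<le> C" "\<And>y. \<bar>eval (dd ?D (dd ?s X)) y\<bar> \<le> C"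
      "\<And>y. \<bar>eval (dd ?D (dd ?w X)) y\<bar> \<le> C"
      using B1(2) B2' B3(2) B4(2) order_trans by blast+
  qed
  \<comment> \<open>Large enough that the errors \<open>3 * C / N\<close> along \<open>w\<close> and
    \<open>2 * C / N\<close> along \<open>\<xi>\<close> add up to at most \<open>\<epsilon>\<close>;
    the summand 1 ensures \<open>N \<ge> 1\<close>.\<close>
  define N where "N = 1 + C * (3 * norm w + 2) / \<epsilon>"
  have N: "N \<ge> 1" "C * (3 * norm w + 2) / N \<le> \<epsilon>"
  proof -
    show "N \<ge> 1" unfolding N_def using C(1) \<epsilon> by simp
    then show "C * (3 * norm w + 2) / N \<le> \<epsilon>"
    proof -
      have "\<epsilon> * N = \<epsilon> + C * (3 * norm w + 2)"
        using \<epsilon> unfolding N_def by (subst distrib_left) simp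
      then show ?thesis using \<open>N \<ge> 1\<close> \<epsilon> by (simp add: pos_divide_le_eq)
    qed
  qed
  \<comment> \<open>The time component \<open>- (m \<bullet> \<xi>)\<close> makes the phase constant
    along \<open>(1, m)\<close>: the wave travels with velocity \<open>m\<close>. Constancy along
    \<open>w\<close> comes from \<open>\<xi> \<bullet> w = 0\<close>.\<close>
  define v where "v = N *\<^sub>R (- (m \<bullet> \<xi>), \<xi>)"
  have v: "v \<bullet> ?s = N" "v \<bullet> ?w = 0" "v \<bullet> ?D = 0"
    using \<xi> by (auto simp: v_def inner_commute dot_square_norm)
  define \<psi> where "\<psi> \<kappa> = Times (Cst (1 / N\<^sup>2)) (Times X (Cosine (Plus (Lin v) (Cst \<kappa>))))" for \<kappa>
  define S where "S \<kappa> y = - (eval X y * cos (v \<bullet> y + \<kappa>))" for \<kappa> y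
  note ev = eval_dd2_modulated[of _ _ "1 / N\<^sup>2" X v, folded \<psi>_def]
  have small: "\<bar>1 / N\<^sup>2 * (x - N * y)\<bar> \<le> (\<bar>x\<bar> + \<bar>y\<bar>) / N" for x y
  proof -
    have "\<bar>x - N * y\<bar> \<le> N * (\<bar>x\<bar> + \<bar>y\<bar>)"
      using N(1) mult_right_mono[of 1 N "\<bar>x\<bar>"] abs_triangle_ineq4[of x "N * y"] by (simp add: abs_mult algebra_simps)
    then show ?thesis using N(1) by (simp add: abs_mult power2_eq_square field_simps)
  qed
  have tr: "\<bar>a * cos x\<bar> \<le> \<bar>a\<bar>" "\<bar>a * sin x\<bar> \<le> \<bar>a\<bar>" for a x :: real
    by (simp_all add: abs_mult mult_left_le)
  have A: "\<bar>eval (dd ?s (dd ?s (\<psi> \<kappa>))) y - S \<kappa> y\<bar> \<le> 3 * C / N" for \<kappa> y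
  proof -
    have "eval (dd ?s (dd ?s (\<psi> \<kappa>))) y - S \<kappa> y
        = 1 / N\<^sup>2 * (eval (dd ?s (dd ?s X)) y * cos (v \<bullet> y + \<kappa>) - N * (2 * (eval (dd ?s X) y * sin (v \<bullet> y + \<kappa>))))"
      using N(1) unfolding ev v S_def by (simp add: field_simps power2_eq_square)
    also have "\<bar>\<dots>\<bar> \<le> 3 * C / N"
      by (rule order_trans[OF small], rule divide_right_mono)
        (use N(1) C(2,3)[of y] tr(1)[of "eval (dd ?s (dd ?s X)) y" "v \<bullet> y + \<kappa>"] tr(2)[of "eval (dd ?s X) y" "v \<bullet> y + \<kappa>"]
          in \<open>simp_all add: abs_mult[of 2]\<close>)
    finally show ?thesis .
  qed
  have Bb: "\<bar>eval (dd ?s (dd ?w (\<psi> \<kappa>))) y\<bar> \<le> 2 * C / N" for \<kappa> y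
  proof -
    have "eval (dd ?s (dd ?w (\<psi> \<kappa>))) y
        = 1 / N\<^sup>2 * (eval (dd ?s (dd ?w X)) y * cos (v \<bullet> y + \<kappa>) - N * (eval (dd ?w X) y * sin (v \<bullet> y + \<kappa>)))"
      unfolding ev v by simp
    also have "\<bar>\<dots>\<bar> \<le> 2 * C / N"
      by (rule order_trans[OF small], rule divide_right_mono)
        (use N(1) C(4,5)[of y] tr(1)[of "eval (dd ?s (dd ?w X)) y" "v \<bullet> y + \<kappa>"] tr(2)[of "eval (dd ?w X) y" "v \<bullet> y + \<kappa>"]
          in simp_all)
    finally show ?thesis .
  qed
  have \<alpha>b: "\<bar>eval (dd ?D (dd ?s (\<psi> \<kappa>))) y\<bar> \<le> 2 * C / N" for \<kappa> y
  proof -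
    have "eval (dd ?D (dd ?s (\<psi> \<kappa>))) y
        = 1 / N\<^sup>2 * (eval (dd ?D (dd ?s X)) y * cos (v \<bullet> y + \<kappa>) - N * (eval (dd ?D X) y * sin (v \<bullet> y + \<kappa>)))"
      unfolding ev v by simp
    also have "\<bar>\<dots>\<bar> \<le> 2 * C / N"
      by (rule order_trans[OF small], rule divide_right_mono)
        (use N(1) C(6,7)[of y] tr(1)[of "eval (dd ?D (dd ?s X)) y" "v \<bullet> y + \<kappa>"] tr(2)[of "eval (dd ?D X) y" "v \<bullet> y + \<kappa>"]
          in simp_all)
    finally show ?thesis .
  qed
  have \<beta>b: "\<bar>eval (dd ?D (dd ?w (\<psi> \<kappa>))) y\<bar> \<le> 2 * C / N" for \<kappa> y
  proof -
    have "eval (dd ?D (dd ?w (\<psi> \<kappa>))) y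
        = 1 / N\<^sup>2 * (eval (dd ?D (dd ?w X)) y * cos (v \<bullet> y + \<kappa>) - N * 0)"
      unfolding ev v by simp
    also have "\<bar>\<dots>\<bar> \<le> 2 * C / N"
      by (rule order_trans[OF small], rule divide_right_mono)
        (use N(1) C(1) C(8)[of y] tr(1)[of "eval (dd ?D (dd ?w X)) y" "v \<bullet> y + \<kappa>"] in simp_all)
    finally show ?thesis .
  qed
  have comb: "norm (a *\<^sub>R w - b *\<^sub>R \<xi>) \<le> \<epsilon>" if "\<bar>a\<bar> \<le> 3 * C / N" "\<bar>b\<bar> \<le> 2 * C / N" for a b
  proof -
    have "norm (a *\<^sub>R w - b *\<^sub>R \<xi>) \<le> \<bar>a\<bar> * norm w + \<bar>b\<bar>"
      using norm_triangle_ineq4[of "a *\<^sub>R w" "b *\<^sub>R \<xi>"] \<xi>(1) by simp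
    also have "\<dots> \<le> 3 * C / N * norm w + 2 * C / N"
      using that by (intro add_mono mult_right_mono) auto
    also have "\<dots> = C * (3 * norm w + 2) / N" by (simp add: algebra_simps add_divide_distrib)
    finally show ?thesis using N(2) by simp
  qed
  have p: "norm (pw (\<psi> \<kappa>) w \<xi> y - S \<kappa> y *\<^sub>R w) \<le> \<epsilon>" for \<kappa> y
    using comb[OF A Bb] by (simp add: pw_def algebra_simps)
  have q: "norm (qw (\<psi> \<kappa>) w \<xi> m y) \<le> \<epsilon>" for \<kappa> y
  proof -
    have "\<bar>eval (dd ?D (dd ?s (\<psi> \<kappa>))) y\<bar> \<le> 3 * C / N"
      by (rule order_trans[OF \<alpha>b]) (use C(1) N(1) in \<open>simp add: divide_right_mono\<close>)
    then show ?thesis unfolding qw_def by (intro comb \<beta>b)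
  qed
  have S1: "\<bar>S \<kappa> y\<bar> \<le> 1" for \<kappa> y
    using Xb(1,2)[of y] tr(1)[of "eval X y" "v \<bullet> y + \<kappa>"] by (simp add: S_def)
  have Sc: "continuous_on UNIV (S \<kappa>)" for \<kappa>
    unfolding S_def by (intro continuous_intros)
  have S0: "S \<kappa> y = 0" if "y \<notin> ball y0 r" for \<kappa> y
  proof -
    have "y \<notin> cball y0 (r / 2)" using that r by auto
    then show ?thesis using X0 by (simp add: S_def)
  qed
  have int: "integrable lborel (\<lambda>y. (S \<kappa> y)\<^sup>2)" for \<kappa>
  proof -
    have "integrable lborel (\<lambda>x. indicator (cball y0 r) x *\<^sub>R (S \<kappa> x)\<^sup>2)"
      by (rule borel_integrable_compact) (auto intro!: continuous_intros continuous_on_subset[OF Sc])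
    moreover have "(\<lambda>x. indicator (cball y0 r) x *\<^sub>R (S \<kappa> x)\<^sup>2) = (\<lambda>y. (S \<kappa> y)\<^sup>2)"
      using S0[of _ \<kappa>] by (auto simp: indicator_def fun_eq_iff)
    ultimately show ?thesis by simp
  qed
  \<comment> \<open>For the phases 0 and pi/2 the squared profiles sum to the squared cutoff, so one
    of the two carries at least half of its integral. This takes the place of averaging over the
    fast oscillation.\<close>
  have sq: "(S 0 y)\<^sup>2 + (S (pi / 2) y)\<^sup>2 = (eval X y)\<^sup>2" for y
  proof -
    have "cos (v \<bullet> y + pi / 2) = - sin (v \<bullet> y)" by (simp add: cos_add)
    then show ?thesis
      unfolding S_def by (simp add: power_mult_distrib distrib_left[symmetric])
  qed
  \<comment> \<open>Space-time has dimension 4, so a quarter of the radius gives 1/256 of the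
    volume. There the squared cutoff is at least 1/4, and taking the better phase halves once more:
    1/2048.\<close>
  have mb: "measure lborel (cball y0 (r / 4)) = measure lborel (ball y0 r) / 256"
  proof -
    have "measure lborel (cball y0 (r / 4)) = measure lborel (ball y0 (r / 4))"
      using content_cball_conv_ball[of y0 "r / 4"] .
    then show ?thesis
      using r content_ball_conv_unit_ball[of "r / 4" y0] content_ball_conv_unit_ball[of r y0]
      by (simp add: power_divide)
  qed
  have "measure lborel (ball y0 r) / 1024 = (LINT y|lborel. indicator (cball y0 (r / 4)) y * (1 / 4))"
    by (simp add: mb)
  also have "\<dots> \<le> (LINT y|lborel. (S 0 y)\<^sup>2 + (S (pi / 2) y)\<^sup>2)"
  proof (rule integral_mono)
    show "integrable lborel (\<lambda>y. indicator (cball y0 (r / 4)) y * (1 / 4) :: real)"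
      by (intro integrable_mult_left integrable_real_indicator)
        (auto simp: emeasure_lborel_cball_finite[unfolded infinity_ennreal_def])
    show "indicator (cball y0 (r / 4)) y * (1 / 4) \<le> (S 0 y)\<^sup>2 + (S (pi / 2) y)\<^sup>2" for y
    proof (cases "y \<in> cball y0 (r / 4)")
      case True
      then have "1 / 2 \<le> eval X y" using Xb(4)[of y] by simp
      then have "(1 / 2)\<^sup>2 \<le> (eval X y)\<^sup>2" by (intro power_mono) auto
      then show ?thesis using True unfolding sq by (simp add: power_divide)
    qed simp
  qed (intro Bochner_Integration.integrable_add int)
  also have "\<dots> = (LINT y|lborel. (S 0 y)\<^sup>2) + (LINT y|lborel. (S (pi / 2) y)\<^sup>2)"
    by (intro Bochner_Integration.integral_add int)
  finally have "measure lborel (ball y0 r) / 2048 \<le> (LINT y|lborel. (S 0 y)\<^sup>2)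
      \<or> measure lborel (ball y0 r) / 2048 \<le> (LINT y|lborel. (S (pi / 2) y)\<^sup>2)"
    by linarith
  then obtain \<kappa> where "measure lborel (ball y0 r) / 2048 \<le> (LINT y|lborel. (S \<kappa> y)\<^sup>2)"
    by blast
  moreover have "\<forall>y. y \<notin> cball y0 (r / 2) \<longrightarrow> eval (\<psi> \<kappa>) y = 0"
    using X0 by (simp add: \<psi>_def)
  ultimately show ?thesis
    using S1 Sc S0 p q by blast
qed

section \<open>Subsolutions\<close>

definition Emat :: "real \<Rightarrow> (real \<times> (real^3) \<Rightarrow> real^3) \<Rightarrow> (real \<times> (real^3) \<Rightarrow> real^3^3) \<Rightarrow> real \<times> (real^3) \<Rightarrow> real^3^3" where
  "Emat \<rho> v M y = \<rho> *\<^sub>R mat 1 + M y - outer (v y) (v y)"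

definition edens :: "real \<Rightarrow> (real \<times> (real^3) \<Rightarrow> real^3) \<Rightarrow> (real \<times> (real^3) \<Rightarrow> real^3^3) \<Rightarrow> real \<times> (real^3) \<Rightarrow> real" where
  "edens \<rho> v M y = trace (Emat \<rho> v M y)"

lemma edens_eq: "edens \<rho> v M y = 3 * \<rho> + trace (M y) - v y \<bullet> v y"
  by (simp add: edens_def Emat_def trace_algebra)

text \<open>Uniform continuity and boundedness are demanded over the unbounded time axis because a
  single oscillation scale must serve all times at once.\<close>

definition subsol :: "real \<Rightarrow> (real^3 \<Rightarrow> real^3) \<Rightarrow> (real \<times> (real^3) \<Rightarrow> real^3) \<Rightarrow> (real \<times> (real^3) \<Rightarrow> real^3^3) \<Rightarrow> bool" where
  "subsol \<rho> U v M \<longleftrightarrow> continuous_on UNIV v \<and> continuous_on UNIV M \<and> uniformly_continuous_on cyl v \<and>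
     (\<exists>B. \<forall>y\<in>cyl. norm (v y) \<le> B \<and> norm (M y) \<le> B) \<and> (\<forall>y i j. M y $ i $ j = M y $ j $ i) \<and>
     (\<forall>y\<in>cyl. \<forall>z. z \<noteq> 0 \<longrightarrow> qf (Emat \<rho> v M y) z > 0) \<and> (\<forall>x\<in>Q3. v (0, x) = U x) \<and>
     (\<forall>t. \<exists>f. smooth_periodic_divfree f \<and> (\<forall>x\<in>Q3. f x = v (t, x))) \<and>
     (\<forall>\<phi>. test_field \<phi> \<longrightarrow> wk \<phi> v M + (LINT x|LQ. U x \<bullet> \<phi> 0 x) = 0)"

lemma subsolD:
  assumes "subsol \<rho> U v M"
  shows "continuous_on UNIV v" "continuous_on UNIV M" "uniformly_continuous_on cyl v"
    "\<exists>B. \<forall>y\<in>cyl. norm (v y) \<le> B \<and> norm (M y) \<le> B" "M y $ i $ j = M y $ j $ i"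
    "y \<in> cyl \<Longrightarrow> z \<noteq> 0 \<Longrightarrow> qf (Emat \<rho> v M y) z > 0" "x \<in> Q3 \<Longrightarrow> v (0, x) = U x"
    "\<exists>f. smooth_periodic_divfree f \<and> (\<forall>x\<in>Q3. f x = v (t, x))"
    "test_field \<phi> \<Longrightarrow> wk \<phi> v M + (LINT x|LQ. U x \<bullet> \<phi> 0 x) = 0"
  using assms unfolding subsol_def by blast+

lemma uniformly_continuous_on_mono:
  fixes f :: "'a::metric_space \<Rightarrow> 'b::metric_space"
  assumes "uniformly_continuous_on T f" "S \<subseteq> T"
  shows "uniformly_continuous_on S f"
  unfolding uniformly_continuous_on_def
proof (intro allI impI)
  fix e :: real assume "e > 0"
  then obtain d where "d > 0" "\<And>x x'. x \<in> T \<Longrightarrow> x' \<in> T \<Longrightarrow> dist x' x < d \<Longrightarrow> dist (f x') (f x) < e"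
    using assms(1) by (auto simp: uniformly_continuous_on_def)
  then show "\<exists>d>0. \<forall>x\<in>S. \<forall>x'\<in>S. dist x' x < d \<longrightarrow> dist (f x') (f x) < e"
    using assms(2) by (intro exI[of _ d]) auto
qed

lemma incD:
  assumes "inc p P"
  shows "continuous_on UNIV p" "continuous_on UNIV P" "uniformly_continuous_on UNIV p"
    "\<exists>B. \<forall>y. norm (p y) \<le> B \<and> norm (P y) \<le> B" "P y $ i $ j = P y $ j $ i"
    "fst y \<le> 0 \<Longrightarrow> p y = 0"
    "\<exists>f. smooth_periodic_divfree f \<and> (\<forall>x\<in>Q3. f x = p (t, x))"
    "test_field \<phi> \<Longrightarrow> wk \<phi> p P = 0"
  using assms unfolding inc_def by blast+

lemma inc_add:
  assumes "inc p P" "inc p' P'"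
  shows "inc (\<lambda>y. p y + p' y) (\<lambda>y. P y + P' y)"
proof -
  note 1 = incD[OF assms(1)] and 2 = incD[OF assms(2)]
  obtain B B' where B: "\<forall>y. norm (p y) \<le> B \<and> norm (P y) \<le> B" "\<forall>y. norm (p' y) \<le> B' \<and> norm (P' y) \<le> B'"
    using 1(4) 2(4) by blast
  have "norm (p y + p' y) \<le> B + B' \<and> norm (P y + P' y) \<le> B + B'" for y
    using B by (intro conjI norm_triangle_le add_mono) blast+
  moreover have "\<exists>f. smooth_periodic_divfree f \<and> (\<forall>x\<in>Q3. f x = p (t, x) + p' (t, x))" for t
    using 1(7)[of t] 2(7)[of t] smooth_periodic_divfree_add by metis
  moreover have "wk \<phi> (\<lambda>y. p y + p' y) (\<lambda>y. P y + P' y) = 0" if "test_field \<phi>" for \<phi>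
    using 1(8)[OF that] 2(8)[OF that] 1(1,2) 2(1,2)
    by (subst wk_add[OF that]) (auto intro: continuous_on_subset)
  moreover have "(P y + P' y) $ i $ j = (P y + P' y) $ j $ i" for y i j
    using 1(5)[of y i j] 2(5)[of y i j] by simp
  ultimately show ?thesis
    unfolding inc_def using 1(6) 2(6)
    by (intro conjI continuous_on_add uniformly_continuous_on_add 1(1-3) 2(1-3)) (blast | simp)+
qed

lemma tpair_zero: "tpair \<phi> (\<lambda>y. 0) (\<lambda>y. 0) = (\<lambda>y. 0)"
  by (simp add: tpair_def fun_eq_iff)

lemma inc_sum:
  assumes "finite F" "\<And>c. c \<in> F \<Longrightarrow> inc (p c) (P c)"
  shows "inc (\<lambda>y. \<Sum>c\<in>F. p c y) (\<lambda>y. \<Sum>c\<in>F. P c y)"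
  using assms
proof (induction F)
  case empty
  have "smooth_periodic_divfree (\<lambda>x. 0 :: real^3)"
    by (simp add: smooth_periodic_divfree_def smooth_on_const periodic_def divergence_def partial_def)
  then show ?case
    by (auto simp: inc_def wk_def tpair_zero space_time_int_def uniformly_continuous_on_const)
next
  case (insert c F)
  then show ?case using inc_add[of "p c" "P c"] by simp
qed

lemma subsol_add_inc:
  assumes "subsol \<rho> U v M" "inc p P"
    and "\<And>y z. y \<in> cyl \<Longrightarrow> z \<noteq> 0 \<Longrightarrow> qf (Emat \<rho> (\<lambda>y. v y + p y) (\<lambda>y. M y + P y) y) z > 0"
  shows "subsol \<rho> U (\<lambda>y. v y + p y) (\<lambda>y. M y + P y)"
proof -
  note 1 = subsolD[OF assms(1)] and 2 = incD[OF assms(2)]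
  obtain B B' where B: "\<forall>y\<in>cyl. norm (v y) \<le> B \<and> norm (M y) \<le> B" "\<forall>y. norm (p y) \<le> B' \<and> norm (P y) \<le> B'"
    using 1(4) 2(4) by blast
  have "norm (v y + p y) \<le> B + B' \<and> norm (M y + P y) \<le> B + B'" if "y \<in> cyl" for y
    using B that by (intro conjI norm_triangle_le add_mono) blast+
  moreover have "\<exists>f. smooth_periodic_divfree f \<and> (\<forall>x\<in>Q3. f x = v (t, x) + p (t, x))" for t
    using 1(8)[of t] 2(7)[of t] smooth_periodic_divfree_add by metis
  moreover have "wk \<phi> (\<lambda>y. v y + p y) (\<lambda>y. M y + P y) + (LINT x|LQ. U x \<bullet> \<phi> 0 x) = 0" if "test_field \<phi>" for \<phi>
    using 1(9)[OF that] 2(8)[OF that] 1(1,2) 2(1,2)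
    by (subst wk_add[OF that]) (auto intro: continuous_on_subset)
  moreover have "(M y + P y) $ i $ j = (M y + P y) $ j $ i" for y i j
    using 1(5)[of y i j] 2(5)[of y i j] by simp
  moreover have "uniformly_continuous_on cyl (\<lambda>y. v y + p y)"
  proof (intro uniformly_continuous_on_add 1(3))
    show "uniformly_continuous_on cyl p"
      by (rule uniformly_continuous_on_mono[OF 2(3)]) simp
  qed
  moreover have "\<forall>x\<in>Q3. v (0, x) + p (0, x) = U x"
    using 1(7) 2(6)[of "(0, _)"] by simp
  ultimately show ?thesis
    unfolding subsol_def using assms(3)
    by (intro conjI continuous_on_add 1(1,2) 2(1,2)) blast+
qed

lemma continuous_edens:
  assumes "continuous_on S v" "continuous_on S M"
  shows "continuous_on S (Emat \<rho> v M)" "continuous_on S (edens \<rho> v M)"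
proof -
  show "continuous_on S (Emat \<rho> v M)"
    unfolding Emat_def [abs_def] by (intro continuous_intros assms)
  then show "continuous_on S (edens \<rho> v M)"
    unfolding edens_def [abs_def] trace_def by (intro continuous_intros)
qed

text \<open>The part \<open>outer p m + outer m p\<close> of the stress cancels the cross terms of
  \<open>outer (v + p) (v + p)\<close> up to the difference \<open>m - v\<close>, which is small
  where \<open>v\<close> is close to its frozen value. What remains is the loss
  \<open>- outer p p\<close> and a contribution of the small field \<open>q\<close>.\<close>

lemma qf_edens_wave:
  fixes m \<xi> :: "real^3"
  assumes "P y = outer (p y) m + outer m (p y) - outer (q y) \<xi> - outer \<xi> (q y)"
  shows "qf (Emat \<rho> (\<lambda>y. v y + p y) (\<lambda>y. M y + P y) y) z
      = qf (Emat \<rho> v M y) z + 2 * (z \<bullet> p y) * (z \<bullet> (m - v y)) - 2 * (z \<bullet> q y) * (z \<bullet> \<xi>) - (z \<bullet> p y)\<^sup>2"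
    and "edens \<rho> (\<lambda>y. v y + p y) (\<lambda>y. M y + P y) y
      = edens \<rho> v M y - (p y \<bullet> p y - 2 * ((m - v y) \<bullet> p y) + 2 * (\<xi> \<bullet> q y))"
  unfolding Emat_def edens_eq assms
  by (simp_all add: qf_algebra trace_algebra inner_commute inner_diff_left inner_diff_right
      inner_add_left inner_add_right power2_eq_square algebra_simps)

text \<open>In the last claim one half of \<open>a0\<close> pays for
  \<open>(z \<bullet> w)\<^sup>2\<close>. The other half is at least \<open>l / 2\<close> times
  \<open>z \<bullet> z\<close> and exceeds the four error terms, which add up to
  \<open>\<epsilon> * (6 + 4 * norm w)\<close> times \<open>z \<bullet> z\<close>.\<close>

lemma wave_pointwise:
  fixes p q w m v \<xi> z :: "real^3"
  assumes w: "norm (p - s *\<^sub>R w) \<le> \<epsilon>" "\<bar>s\<bar> \<le> 1" and q: "norm q \<le> \<epsilon>" and mv: "norm (m - v) \<le> \<epsilon>"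
    and \<xi>: "norm \<xi> = 1" and \<epsilon>: "0 < \<epsilon>" "\<epsilon> \<le> 1"
  shows "norm p \<le> norm w + \<epsilon>"
    and "s\<^sup>2 * (w \<bullet> w) / 2 - \<epsilon> * (2 * norm w + 5) \<le> p \<bullet> p - 2 * ((m - v) \<bullet> p) + 2 * (\<xi> \<bullet> q)"
    and "\<lbrakk>(z \<bullet> w)\<^sup>2 \<le> a0 / 2; l * (z \<bullet> z) \<le> a0; \<bar>a - a0\<bar> \<le> \<epsilon> * (z \<bullet> z); \<epsilon> * (6 + 4 * norm w) < l / 2; z \<noteq> 0\<rbrakk>
      \<Longrightarrow> 0 < a + 2 * (z \<bullet> p) * (z \<bullet> (m - v)) - 2 * (z \<bullet> q) * (z \<bullet> \<xi>) - (z \<bullet> p)\<^sup>2"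
proof -
  let ?W = "norm w" and ?n = "norm z"
  have sw: "norm (s *\<^sub>R w) \<le> ?W" using w(2) by (simp add: mult_left_le_one_le)
  have "norm p \<le> norm (s *\<^sub>R w) + norm (p - s *\<^sub>R w)"
    by (metis add.commute diff_add_cancel norm_triangle_ineq)
  then show np: "norm p \<le> ?W + \<epsilon>" using sw w(1) by linarith
  have ee: "\<epsilon>\<^sup>2 \<le> \<epsilon>" using \<epsilon> by (simp add: power2_eq_square mult_left_le)
  show "s\<^sup>2 * (w \<bullet> w) / 2 - \<epsilon> * (2 * ?W + 5) \<le> p \<bullet> p - 2 * ((m - v) \<bullet> p) + 2 * (\<xi> \<bullet> q)"
  proof -
    \<comment> \<open>This square rearranges to |s w|^2 / 2 - |p - s w|^2 \<le> |p|^2, trading the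
      cross term for a factor 1/2.\<close>
    have "0 \<le> (2 *\<^sub>R p - s *\<^sub>R w) \<bullet> (2 *\<^sub>R p - s *\<^sub>R w)" by simp
    then have "s\<^sup>2 * (w \<bullet> w) / 2 - (p - s *\<^sub>R w) \<bullet> (p - s *\<^sub>R w) \<le> p \<bullet> p"
      by (simp add: inner_diff_left inner_diff_right inner_commute power2_eq_square algebra_simps)
    moreover have "(p - s *\<^sub>R w) \<bullet> (p - s *\<^sub>R w) \<le> \<epsilon>\<^sup>2"
      using w(1) by (simp add: dot_square_norm power_mono)
    moreover have "(m - v) \<bullet> p \<le> \<epsilon> * (?W + 1)"
    proof -
      have "(m - v) \<bullet> p \<le> norm (m - v) * norm p" by (rule norm_cauchy_schwarz)
      also have "\<dots> \<le> \<epsilon> * (?W + 1)" using np mv \<epsilon> by (intro mult_mono) auto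
      finally show ?thesis .
    qed
    moreover have "- \<epsilon> \<le> \<xi> \<bullet> q"
      using Cauchy_Schwarz_ineq2[of \<xi> q] \<xi> q by simp
    ultimately have "s\<^sup>2 * (w \<bullet> w) / 2 - \<epsilon> - 2 * (\<epsilon> * (?W + 1)) - 2 * \<epsilon> \<le> p \<bullet> p - 2 * ((m - v) \<bullet> p) + 2 * (\<xi> \<bullet> q)"
      using ee by linarith
    then show ?thesis using \<epsilon> by (simp add: algebra_simps)
  qed
  assume A: "(z \<bullet> w)\<^sup>2 \<le> a0 / 2" "l * (z \<bullet> z) \<le> a0" "\<bar>a - a0\<bar> \<le> \<epsilon> * (z \<bullet> z)" "\<epsilon> * (6 + 4 * ?W) < l / 2" "z \<noteq> 0"
  have zz: "z \<bullet> z = ?n\<^sup>2" by (rule dot_square_norm)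
  have zw: "\<bar>z \<bullet> w\<bar> \<le> ?n * ?W" by (rule Cauchy_Schwarz_ineq2)
  have zp: "\<bar>z \<bullet> p\<bar> \<le> \<bar>z \<bullet> w\<bar> + \<epsilon> * ?n"
  proof -
    have "z \<bullet> p = s * (z \<bullet> w) + z \<bullet> (p - s *\<^sub>R w)" by (simp add: inner_diff_right)
    moreover have "\<bar>s * (z \<bullet> w)\<bar> \<le> \<bar>z \<bullet> w\<bar>" using w(2) by (simp add: abs_mult mult_left_le_one_le)
    moreover have "\<bar>z \<bullet> (p - s *\<^sub>R w)\<bar> \<le> \<epsilon> * ?n"
      using Cauchy_Schwarz_ineq2[of z "p - s *\<^sub>R w"] mult_left_mono[OF w(1), of ?n] by (simp add: mult.commute)
    ultimately show ?thesis by linarith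
  qed
  have "(z \<bullet> p)\<^sup>2 \<le> (\<bar>z \<bullet> w\<bar> + \<epsilon> * ?n)\<^sup>2"
    using zp \<epsilon> by (simp add: abs_le_square_iff[symmetric])
  also have "\<dots> = (z \<bullet> w)\<^sup>2 + 2 * \<epsilon> * ?n * \<bar>z \<bullet> w\<bar> + \<epsilon>\<^sup>2 * ?n\<^sup>2"
    by (simp add: power2_eq_square algebra_simps)
  also have "\<dots> \<le> (z \<bullet> w)\<^sup>2 + 2 * \<epsilon> * ?n * (?n * ?W) + \<epsilon> * ?n\<^sup>2"
    using zw ee \<epsilon> by (intro add_mono mult_left_mono mult_right_mono) auto
  finally have 1: "(z \<bullet> p)\<^sup>2 \<le> a0 / 2 + \<epsilon> * (2 * ?W + 1) * ?n\<^sup>2"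
    using A(1) by (simp add: power2_eq_square algebra_simps)
  have 2: "\<bar>2 * (z \<bullet> p) * (z \<bullet> (m - v))\<bar> \<le> \<epsilon> * (2 * ?W + 2) * ?n\<^sup>2"
  proof -
    have "\<bar>z \<bullet> p\<bar> * \<bar>z \<bullet> (m - v)\<bar> \<le> (?n * (?W + 1)) * (?n * \<epsilon>)"
      using Cauchy_Schwarz_ineq2[of z p] Cauchy_Schwarz_ineq2[of z "m - v"] np mv \<epsilon>
        mult_left_mono[of "norm p" "?W + 1" ?n] mult_left_mono[OF mv, of ?n]
      by (intro mult_mono) auto
    moreover have "2 * ((?n * (?W + 1)) * (?n * \<epsilon>)) = \<epsilon> * (2 * ?W + 2) * ?n\<^sup>2"
      by (simp add: power2_eq_square algebra_simps)
    moreover have "\<bar>2 * (z \<bullet> p) * (z \<bullet> (m - v))\<bar> = 2 * (\<bar>z \<bullet> p\<bar> * \<bar>z \<bullet> (m - v)\<bar>)"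
      by (simp add: abs_mult del: inner_diff_right)
    ultimately show ?thesis by linarith
  qed
  have 3: "\<bar>2 * (z \<bullet> q) * (z \<bullet> \<xi>)\<bar> \<le> 2 * \<epsilon> * ?n\<^sup>2"
  proof -
    have "\<bar>z \<bullet> q\<bar> * \<bar>z \<bullet> \<xi>\<bar> \<le> (?n * \<epsilon>) * (?n * 1)"
      using Cauchy_Schwarz_ineq2[of z q] Cauchy_Schwarz_ineq2[of z \<xi>] \<xi> \<epsilon> mult_left_mono[OF q, of ?n]
      by (intro mult_mono) auto
    then show ?thesis by (simp add: abs_mult power2_eq_square algebra_simps)
  qed
  have "\<epsilon> * (6 + 4 * ?W) * ?n\<^sup>2 < l / 2 * ?n\<^sup>2"
    using A(4,5) by (intro mult_strict_right_mono) auto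
  then show "0 < a + 2 * (z \<bullet> p) * (z \<bullet> (m - v)) - 2 * (z \<bullet> q) * (z \<bullet> \<xi>) - (z \<bullet> p)\<^sup>2"
    using 1 2 3 A(2,3) unfolding zz by (simp add: algebra_simps abs_le_iff)
qed

section \<open>Improvement of a subsolution\<close>

text \<open>What one wave does on one ball. The gain is an integral over the ball, as the loss
  oscillates and has no useful pointwise lower bound. The mean of \<open>trace P\<close> is bounded
  in proportion to the slice of the ball, so disjoint balls together add at most \<open>d\<close> at
  every time.\<close>

definition bump_on where
  "bump_on \<rho> v M d y0 r p P \<longleftrightarrow> inc p P \<and> (\<forall>y. y \<notin> ball y0 r \<longrightarrow> p y = 0 \<and> P y = 0) \<and>
     (\<forall>y\<in>ball y0 r. \<forall>z. z \<noteq> 0 \<longrightarrow> qf (Emat \<rho> (\<lambda>y. v y + p y) (\<lambda>y. M y + P y) y) z > 0) \<and>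
     (\<forall>y. norm (p y) \<le> edens \<rho> v M y0 + 2) \<and>
     (\<forall>t c. (LINT x|LQ. p (t, x) \<bullet> c) = 0) \<and>
     (\<forall>t. (LINT x|LQ. trace (P (t, x))) \<le> d * (LINT x|LQ. indicator (ball y0 r) (t, x))) \<and>
     (1 / 400000) * (LINT y|lborel. indicator (ball y0 r) y * (exp (- fst y) * edens \<rho> v M y))
       \<le> (LINT y|lborel. indicator (ball y0 r) y *
            (exp (- fst y) * (edens \<rho> v M y - edens \<rho> (\<lambda>y. v y + p y) (\<lambda>y. M y + P y) y)))"

lemma integrable_ball_continuous:
  fixes F :: "'a::euclidean_space \<Rightarrow> real"
  assumes "continuous_on UNIV F"
  shows "integrable lborel (\<lambda>y. indicator (ball a r) y * F y)"
proof -
  have "integrable lborel (\<lambda>y. indicator (cball a r) y *\<^sub>R F y)"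
    by (rule borel_integrable_compact) (auto intro: continuous_on_subset[OF assms])
  then have "integrable lborel (\<lambda>y. indicator (ball a r) y *\<^sub>R (indicator (cball a r) y *\<^sub>R F y))"
    by (rule integrable_mult_indicator[rotated]) simp
  moreover have "(\<lambda>y. indicator (ball a r) y *\<^sub>R (indicator (cball a r) y *\<^sub>R F y)) = (\<lambda>y. indicator (ball a r) y * F y)"
    by (auto simp: indicator_def fun_eq_iff)
  ultimately show ?thesis by simp
qed

lemma integrable_slice_ball: "integrable LQ (\<lambda>x. indicator (ball y0 r) (t, x) :: real)"
proof -
  interpret finite_measure LQ by (rule measure_Q3(3))
  have "open ((\<lambda>x. (t, x)) -` ball y0 r)"
    by (intro open_vimage continuous_intros) auto
  then have "(\<lambda>x. indicator ((\<lambda>x. (t, x)) -` ball y0 r) x :: real) \<in> borel_measurable LQ"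
    by (intro borel_measurable_lebesgue_on borel_measurable_indicator) auto
  then have "(\<lambda>x. indicator (ball y0 r) (t, x) :: real) \<in> borel_measurable LQ"
    by (simp add: indicator_vimage)
  then show ?thesis
    by (intro integrable_const_bound[where B = 1]) (auto simp: indicator_def)
qed

text \<open>The data are frozen at \<open>y0\<close>: the velocity \<open>m\<close>, the defect
  \<open>A\<close> with a rank-one part \<open>w\<close>, and a unit vector \<open>\<xi>\<close>
  orthogonal to \<open>w\<close>. The error size \<open>\<epsilon>\<close> is fixed first, then a
  radius on which the coefficients vary little, and \<open>wave_exists\<close> supplies the
  frequency last.\<close>

lemma bump_exists:
  assumes sub: "subsol \<rho> U v M" and y0: "y0 \<in> ocyl" and d: "d > 0"
  obtains r0 where "r0 > 0" "\<And>r. 0 < r \<Longrightarrow> r < r0 \<Longrightarrow> cball y0 r \<subseteq> ocyl \<and> (\<exists>p P. bump_on \<rho> v M d y0 r p P)"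
proof -
  note S = subsolD[OF sub]
  have oc: "ocyl \<subseteq> cyl" using box_subset_cbox[of "0 :: real^3" 1] by fastforce
  define A where "A = Emat \<rho> v M y0"
  define T where "T = edens \<rho> v M y0"
  define m where "m = v y0"
  have Asym: "A $ i $ j = A $ j $ i" for i j
    using S(5)[of y0 i j] by (simp add: A_def Emat_def mat_def mult.commute)
  have Apos: "qf A z > 0" if "z \<noteq> 0" for z
    using S(6)[of y0 z] y0 oc that unfolding A_def by blast
  obtain w where w: "\<And>z. (z \<bullet> w)\<^sup>2 \<le> qf A z / 2" "trace A \<le> 6 * (w \<bullet> w)" "2 * (w \<bullet> w) \<le> trace A"
    using rank_one_below[OF Asym Apos] by blast
  obtain l where l: "l > 0" "\<And>z. l * (z \<bullet> z) \<le> qf A z"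
    using qf_lower_bound[OF Apos] by blast
  have Tr: "trace A = T" by (simp add: A_def T_def edens_def)
  have T: "T > 0"
  proof -
    have "A $ i $ i > 0" for i
      using Apos[of "axis i 1"] by (simp add: qf_axis axis_eq_0_iff)
    then show ?thesis unfolding Tr[symmetric] trace_def by (intro sum_pos) auto
  qed
  let ?W = "norm w"
  have W: "?W \<le> T + 1"
  proof -
    have "?W \<le> ?W\<^sup>2 + 1" using power2_diff[of ?W 1] zero_le_power2[of "?W - 1"] by (smt (verit) norm_ge_zero mult_1_right power_one)
    then show ?thesis using w(3) T unfolding Tr by (simp add: dot_square_norm)
  qed
  obtain \<xi> where \<xi>: "norm \<xi> = 1" "\<xi> \<bullet> w = 0"
  proof -
    obtain x where "x \<noteq> 0" "orthogonal w x"
      using orthogonal_to_vector_exists[of w] by auto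
    then show thesis
      by (intro that[of "x /\<^sub>R norm x"]) (auto simp: orthogonal_def inner_commute)
  qed
  \<comment> \<open>The entries serve, in order: crude bounds such as
    \<open>\<epsilon>\<^sup>2 \<le> \<epsilon>\<close>; the mean of \<open>trace P\<close>, whose
    integrand contributes at most \<open>2 * \<epsilon>\<close>; positivity of the new defect; and
    an error in the gain below half of its main term.\<close>
  define \<epsilon> where "\<epsilon> = Min {1, d / 2, l / (4 * (6 + 4 * ?W)), T / (200000 * (2 * ?W + 5))}"
  have pos: "6 + 4 * ?W > 0" "2 * ?W + 5 > 0"
    using norm_ge_zero[of w] by linarith+
  have \<epsilon>: "0 < \<epsilon>" "\<epsilon> \<le> 1" "\<epsilon> \<le> d / 2" "\<epsilon> \<le> l / (4 * (6 + 4 * ?W))" "\<epsilon> \<le> T / (200000 * (2 * ?W + 5))"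
  proof -
    have le: "\<epsilon> \<le> x" if "x \<in> {1, d / 2, l / (4 * (6 + 4 * ?W)), T / (200000 * (2 * ?W + 5))}" for x
      unfolding \<epsilon>_def by (rule Min_le[OF _ that]) simp
    show "\<epsilon> \<le> 1" "\<epsilon> \<le> d / 2" "\<epsilon> \<le> l / (4 * (6 + 4 * ?W))" "\<epsilon> \<le> T / (200000 * (2 * ?W + 5))"
      by (rule le, simp)+
    show "0 < \<epsilon>" unfolding \<epsilon>_def using d l(1) T pos by (subst Min_gr_iff) auto
  qed
  have \<epsilon>': "\<epsilon> * (6 + 4 * ?W) < l / 2" "\<epsilon> * (2 * ?W + 5) \<le> T / 200000"
    using \<epsilon>(4,5) pos l(1) by (simp_all add: field_simps)
  have cE: "continuous_on UNIV (Emat \<rho> v M)" "continuous_on UNIV (edens \<rho> v M)"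
    by (intro continuous_edens S)+
  have near: "\<exists>r>0. \<forall>y\<in>ball y0 r. dist (f y) (f y0) < e" if "continuous_on UNIV f" "e > 0"
    for f :: "real \<times> (real^3) \<Rightarrow> 'a::metric_space" and e
    using that unfolding continuous_on_iff by (metis UNIV_I dist_commute mem_ball)
  obtain r1 where r1: "r1 > 0" "\<forall>y\<in>ball y0 r1. dist (Emat \<rho> v M y) (Emat \<rho> v M y0) < \<epsilon> / 3"
    using near[OF cE(1), of "\<epsilon> / 3"] \<epsilon>(1) by auto
  obtain r2 where r2: "r2 > 0" "\<forall>y\<in>ball y0 r2. dist (edens \<rho> v M y) (edens \<rho> v M y0) < T"
    using near[OF cE(2) T] by auto
  obtain r3 where r3: "r3 > 0" "\<forall>y\<in>ball y0 r3. dist (v y) (v y0) < \<epsilon>"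
    using near[OF S(1) \<epsilon>(1)] by auto
  have "open ocyl" by (intro open_Times) auto
  then obtain r4 where r4: "r4 > 0" "cball y0 r4 \<subseteq> ocyl"
    using y0 open_contains_cball by blast
  \<comment> \<open>A radius of at most 1/2 keeps the weight \<open>exp (- t)\<close> within a
    factor 2 of its value at the centre, since \<open>exp (1 / 2) \<le> 2\<close>.\<close>
  define r0 where "r0 = Min {1 / 2, r1, r2, r3, r4}"
  have r0: "r0 > 0" "r0 \<le> 1 / 2" "r0 \<le> r1" "r0 \<le> r2" "r0 \<le> r3" "r0 \<le> r4"
    using r1 r2 r3 r4 by (auto simp: r0_def)
  have "cball y0 r \<subseteq> ocyl \<and> (\<exists>p P. bump_on \<rho> v M d y0 r p P)" if r: "0 < r" "r < r0" for r
  proof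
    have "cball y0 r \<subseteq> cball y0 r4" using r r0 by (intro subset_cball) auto
    then show cb: "cball y0 r \<subseteq> ocyl" using r4 by blast
    obtain \<psi> s where "\<forall>y. y \<notin> cball y0 (r / 2) \<longrightarrow> eval \<psi> y = 0"
      "\<forall>y. \<bar>s y\<bar> \<le> 1" "continuous_on UNIV s" "\<forall>y. y \<notin> ball y0 r \<longrightarrow> s y = 0"
      "\<forall>y. norm (pw \<psi> w \<xi> y - s y *\<^sub>R w) \<le> \<epsilon>" "\<forall>y. norm (qw \<psi> w \<xi> m y) \<le> \<epsilon>"
      "measure lborel (ball y0 r) / 2048 \<le> (LINT y|lborel. (s y)\<^sup>2)"
      using wave_exists[OF r(1) \<xi> \<epsilon>(1), of y0 m] by blast
    note \<psi> = this(1)[rule_format] this(2)[rule_format] this(3) this(4-6)[rule_format] this(7)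
    define p where "p = pw \<psi> w \<xi>"
    define q where "q = qw \<psi> w \<xi> m"
    define P where "P = Pw \<psi> w \<xi> m"
    have P: "P y = outer (p y) m + outer m (p y) - outer (q y) \<xi> - outer \<xi> (q y)" for y
      by (simp add: P_def p_def q_def Pw_def)
    have cb2: "cball y0 (r / 2) \<subseteq> ocyl"
      using r by (intro order_trans[OF _ cb] subset_cball) simp
    have zero: "p y = 0" "P y = 0" "q y = 0" if "y \<notin> ball y0 r" for y
    proof -
      have "y \<notin> cball y0 (r / 2)" using that r by auto
      then show "p y = 0" "P y = 0" "q y = 0"
        using wave_zero[of "cball y0 (r / 2)" \<psi> y] \<psi>(1) by (auto simp: p_def P_def q_def)
    qed
    have cont: "continuous_on A p" "continuous_on A q" "continuous_on A P" for A
      unfolding p_def q_def P_def by (rule continuous_wave)+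
    have inc: "inc p P"
      unfolding p_def P_def by (rule wave_inc[OF cb2 \<psi>(1)])
    have mean: "(LINT x|LQ. p (t, x) \<bullet> c) = 0" for t c
      unfolding p_def by (rule wave_mean_zero[OF compact_cball cb2 \<psi>(1)])
    have near: "norm (m - v y) \<le> \<epsilon>" "\<bar>qf (Emat \<rho> v M y) z - qf A z\<bar> \<le> \<epsilon> * (z \<bullet> z)" "0 \<le> edens \<rho> v M y" "edens \<rho> v M y \<le> 2 * T"
      "exp (- fst y0) / 2 \<le> exp (- fst y)" "exp (- fst y) \<le> 2 * exp (- fst y0)"
      if "y \<in> ball y0 r" for y z
    proof -
      have y: "y \<in> ball y0 r1" "y \<in> ball y0 r2" "y \<in> ball y0 r3" "dist y0 y < 1 / 2"
        using that r r0 by auto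
      show "norm (m - v y) \<le> \<epsilon>" using r3 y(3) by (force simp: m_def dist_norm norm_minus_commute)
      have "norm (Emat \<rho> v M y - A) \<le> \<epsilon> / 3" using r1 y(1) by (force simp: A_def dist_norm)
      then have "3 * norm (Emat \<rho> v M y - A) * (z \<bullet> z) \<le> \<epsilon> * (z \<bullet> z)"
        by (intro mult_right_mono) auto
      then show "\<bar>qf (Emat \<rho> v M y) z - qf A z\<bar> \<le> \<epsilon> * (z \<bullet> z)"
        using qf_bound[of "Emat \<rho> v M y - A" z] by (simp add: qf_algebra)
      have "\<bar>edens \<rho> v M y - T\<bar> < T" using r2 y(2) by (force simp: T_def dist_real_def)
      then show "0 \<le> edens \<rho> v M y" "edens \<rho> v M y \<le> 2 * T" by linarith+
      have "\<bar>fst y0 - fst y\<bar> \<le> 1 / 2"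
        using y(4) dist_fst_le[of y0 y] by (simp add: dist_real_def)
      then have "fst y0 - fst y \<le> 1 / 2" "fst y - fst y0 \<le> 1 / 2" by linarith+
      then have "exp (fst y0 - fst y) \<le> exp (1 / 2)" "exp (fst y - fst y0) \<le> exp (1 / 2)"
        unfolding exp_le_cancel_iff .
      then have "exp (fst y0 - fst y) \<le> 2" "exp (fst y - fst y0) \<le> 2" using exp_half_le2 by linarith+
      then show "exp (- fst y0) / 2 \<le> exp (- fst y)" "exp (- fst y) \<le> 2 * exp (- fst y0)"
        by (simp_all add: exp_diff exp_minus field_simps)
    qed
    have pt: "norm (p y) \<le> ?W + \<epsilon>"
      "(s y)\<^sup>2 * (w \<bullet> w) / 2 - \<epsilon> * (2 * ?W + 5) \<le> p y \<bullet> p y - 2 * ((m - v y) \<bullet> p y) + 2 * (\<xi> \<bullet> q y)"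
      if "y \<in> ball y0 r" for y
      by (rule wave_pointwise[OF \<psi>(5)[of y, folded p_def] \<psi>(2) \<psi>(6)[of y, folded q_def] near(1)[OF that]
            \<xi>(1) \<epsilon>(1,2)])+
    have posE: "qf (Emat \<rho> (\<lambda>y. v y + p y) (\<lambda>y. M y + P y) y) z > 0" if "y \<in> ball y0 r" "z \<noteq> 0" for y z
    proof -
      have "0 < qf (Emat \<rho> v M y) z + 2 * (z \<bullet> p y) * (z \<bullet> (m - v y)) - 2 * (z \<bullet> q y) * (z \<bullet> \<xi>) - (z \<bullet> p y)\<^sup>2"
        by (rule wave_pointwise(3)[OF \<psi>(5)[of y, folded p_def] \<psi>(2) \<psi>(6)[of y, folded q_def] near(1)[OF that(1)]
              \<xi>(1) \<epsilon>(1,2) w(1) l(2) near(2)[OF that(1)] \<epsilon>'(1) that(2)])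
      then show ?thesis by (simp only: qf_edens_wave(1)[where P = P and p = p and q = q, OF P])
    qed
    have bnd: "norm (p y) \<le> T + 2" for y
    proof (cases "y \<in> ball y0 r")
      case True
      then show ?thesis using pt(1)[OF True] W \<epsilon>(2) by linarith
    qed (use zero(1)[of y] T in simp)
    have trP: "(LINT x|LQ. trace (P (t, x))) \<le> d * (LINT x|LQ. indicator (ball y0 r) (t, x))" for t
    proof -
      have i1: "integrable LQ (\<lambda>x. p (t, x) \<bullet> (2 *\<^sub>R m))" "integrable LQ (\<lambda>x. - 2 * (\<xi> \<bullet> q (t, x)))"
        by (intro integrable_LQ_continuous continuous_intros continuous_on_compose2[OF cont(1)[of UNIV]]
            continuous_on_compose2[OF cont(2)[of UNIV]]; auto)+
      \<comment> \<open>The trace of the stress is twice \<open>p \<bullet> m\<close> minus twice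
        \<open>\<xi> \<bullet> q\<close>, and the first term has mean zero.\<close>
      have "(LINT x|LQ. trace (P (t, x))) = (LINT x|LQ. p (t, x) \<bullet> (2 *\<^sub>R m) + - 2 * (\<xi> \<bullet> q (t, x)))"
        by (intro Bochner_Integration.integral_cong refl) (simp add: P trace_algebra inner_commute)
      also have "\<dots> = (LINT x|LQ. - 2 * (\<xi> \<bullet> q (t, x)))"
        using i1 mean[of t "2 *\<^sub>R m"] by (subst Bochner_Integration.integral_add) auto
      also have "\<dots> \<le> (LINT x|LQ. d * indicator (ball y0 r) (t, x))"
      proof (rule integral_mono[OF i1(2)])
        show "integrable LQ (\<lambda>x. d * indicator (ball y0 r) (t, x))"
          by (intro integrable_mult_right integrable_slice_ball)
        show "- 2 * (\<xi> \<bullet> q (t, x)) \<le> d * indicator (ball y0 r) (t, x)" for x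
        proof (cases "(t, x) \<in> ball y0 r")
          case True
          have "\<bar>\<xi> \<bullet> q (t, x)\<bar> \<le> \<epsilon>"
            using Cauchy_Schwarz_ineq2[of \<xi> "q (t, x)"] \<xi>(1) \<psi>(6)[of "(t, x)"] by (simp add: q_def)
          then show ?thesis using True \<epsilon>(3) by simp
        qed (simp add: zero(3))
      qed
      finally show ?thesis by simp
    qed
    define e0 where "e0 = exp (- fst y0)"
    have e0: "e0 > 0" by (simp add: e0_def)
    let ?V = "measure lborel (ball y0 r)" and ?I = "indicator (ball y0 r) :: _ \<Rightarrow> real"
    let ?g = "\<lambda>y. edens \<rho> v M y - edens \<rho> (\<lambda>y. v y + p y) (\<lambda>y. M y + P y) y"
    have cg: "continuous_on UNIV ?g"
      by (intro continuous_intros continuous_edens continuous_on_add cont S)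
    have Iint: "(LINT y|lborel. ?I y * c) = c * ?V" "integrable lborel (\<lambda>y. ?I y * c)" for c
      using integrable_ball_continuous[OF continuous_on_const, of y0 r c] by (simp_all add: mult.commute)
    have "(LINT y|lborel. ?I y * (exp (- fst y) * edens \<rho> v M y)) \<le> (LINT y|lborel. ?I y * (2 * e0 * (2 * T)))"
    proof (rule integral_mono)
      show "integrable lborel (\<lambda>y. ?I y * (exp (- fst y) * edens \<rho> v M y))"
        by (intro integrable_ball_continuous continuous_intros cE)
      show "?I y * (exp (- fst y) * edens \<rho> v M y) \<le> ?I y * (2 * e0 * (2 * T))" for y
      proof (cases "y \<in> ball y0 r")
        case True
        then have "exp (- fst y) * edens \<rho> v M y \<le> 2 * e0 * (2 * T)"
          using near[OF True] e0 by (intro mult_mono) (auto simp: e0_def)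
        then show ?thesis using True by simp
      qed simp
    qed (rule Iint)
    then have up: "(LINT y|lborel. ?I y * (exp (- fst y) * edens \<rho> v M y)) \<le> 4 * e0 * T * ?V"
      unfolding Iint by simp
    have ints: "integrable lborel (\<lambda>y. ?I y * (s y)\<^sup>2)"
      by (intro integrable_ball_continuous continuous_intros \<psi>)
    \<comment> \<open>49152 = 6 * 4 * 2048: the 6 from
      \<open>trace A \<le> 6 * (w \<bullet> w)\<close>, the 4 from a factor 1/2 each in the weight
      and in the pointwise loss, and 2048 from the profile. The subtracted term is twice the error
      bound \<open>T / 200000\<close>.\<close>
    have "e0 * T * ?V / 49152 - e0 * T * ?V / 100000
        \<le> e0 * (w \<bullet> w) / 4 * (?V / 2048) - 2 * e0 * (\<epsilon> * (2 * ?W + 5)) * ?V"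
    proof -
      have "T * (e0 * ?V) \<le> 6 * (w \<bullet> w) * (e0 * ?V)"
        using w(2) e0 unfolding Tr by (intro mult_right_mono) auto
      moreover have "\<epsilon> * (2 * ?W + 5) * (e0 * ?V) \<le> T / 200000 * (e0 * ?V)"
        using \<epsilon>'(2) e0 by (intro mult_right_mono) auto
      ultimately show ?thesis by (simp add: algebra_simps)
    qed
    also have "\<dots> \<le> e0 * (w \<bullet> w) / 4 * (LINT y|lborel. (s y)\<^sup>2) - 2 * e0 * (\<epsilon> * (2 * ?W + 5)) * ?V"
      using \<psi>(7) e0 by (intro diff_right_mono mult_left_mono) auto
    also have "\<dots> = (LINT y|lborel. e0 * (w \<bullet> w) / 4 * (?I y * (s y)\<^sup>2) - ?I y * (2 * e0 * (\<epsilon> * (2 * ?W + 5))))"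
    proof -
      have "(\<lambda>y. (s y)\<^sup>2) = (\<lambda>y. ?I y * (s y)\<^sup>2)"
        using \<psi>(4) by (auto simp: indicator_def fun_eq_iff)
      then have eq: "(LINT y|lborel. (s y)\<^sup>2) = (LINT y|lborel. ?I y * (s y)\<^sup>2)" by metis
      have "(LINT y|lborel. e0 * (w \<bullet> w) / 4 * (?I y * (s y)\<^sup>2) - ?I y * (2 * e0 * (\<epsilon> * (2 * ?W + 5))))
          = (LINT y|lborel. e0 * (w \<bullet> w) / 4 * (?I y * (s y)\<^sup>2)) - (LINT y|lborel. ?I y * (2 * e0 * (\<epsilon> * (2 * ?W + 5))))"
        by (intro Bochner_Integration.integral_diff integrable_mult_right ints Iint)
      then show ?thesis unfolding eq Iint by simp
    qed
    also have "\<dots> \<le> (LINT y|lborel. ?I y * (exp (- fst y) * ?g y))"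
    proof (rule integral_mono)
      show "integrable lborel (\<lambda>y. e0 * (w \<bullet> w) / 4 * (?I y * (s y)\<^sup>2) - ?I y * (2 * e0 * (\<epsilon> * (2 * ?W + 5))))"
        by (intro Bochner_Integration.integrable_diff integrable_mult_right ints Iint)
      show "integrable lborel (\<lambda>y. ?I y * (exp (- fst y) * ?g y))"
        by (intro integrable_ball_continuous continuous_on_mult cg continuous_intros)
      fix y
      show "e0 * (w \<bullet> w) / 4 * (?I y * (s y)\<^sup>2) - ?I y * (2 * e0 * (\<epsilon> * (2 * ?W + 5))) \<le> ?I y * (exp (- fst y) * ?g y)"
      proof (cases "y \<in> ball y0 r")
        case True
        let ?a = "(s y)\<^sup>2 * (w \<bullet> w) / 2" and ?b = "\<epsilon> * (2 * ?W + 5)"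
        have b: "?b \<ge> 0" using \<epsilon>(1) pos by simp
        have "?a - ?b \<le> ?g y"
          using pt(2)[OF True] unfolding qf_edens_wave(2)[where P = P and p = p and q = q, OF P] by simp
        then have "exp (- fst y) * (?a - ?b) \<le> exp (- fst y) * ?g y"
          by (intro mult_left_mono) auto
        moreover have "e0 / 2 * ?a \<le> exp (- fst y) * ?a" "exp (- fst y) * ?b \<le> 2 * e0 * ?b"
          using near(5,6)[OF True] b by (intro mult_right_mono; simp add: e0_def)+
        ultimately have "e0 / 2 * ?a - 2 * e0 * ?b \<le> exp (- fst y) * ?g y"
          unfolding right_diff_distrib by linarith
        then show ?thesis using True by (simp add: algebra_simps)
      qed simp
    qed
    finally have lo: "e0 * T * ?V / 49152 - e0 * T * ?V / 100000 \<le> (LINT y|lborel. ?I y * (exp (- fst y) * ?g y))" .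
    \<comment> \<open>The weighted integral before the step is at most 4 X. The loss is at least
      (1/49152 - 1/100000) X, which exceeds X / 100000 = 4 X / 400000.\<close>
    define X where "X = e0 * T * ?V"
    have "0 \<le> X" using e0 T by (simp add: X_def)
    moreover have "(LINT y|lborel. ?I y * (exp (- fst y) * edens \<rho> v M y)) \<le> 4 * X"
      using up by (simp add: X_def mult.assoc)
    moreover note lo[folded X_def]
    ultimately have "(1 / 400000) * (LINT y|lborel. ?I y * (exp (- fst y) * edens \<rho> v M y)) \<le> (LINT y|lborel. ?I y * (exp (- fst y) * ?g y))"
      by linarith
    then have "bump_on \<rho> v M d y0 r p P"
      unfolding bump_on_def using inc zero posE bnd mean trP by (auto simp: T_def)
    then show "\<exists>p P. bump_on \<rho> v M d y0 r p P" by blast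
  qed
  then show thesis using r0(1) that by blast
qed

section \<open>Covering the cylinder by finitely many disjoint balls\<close>

lemma negligible_cyl_diff: "negligible (cyl - ocyl)"
proof -
  have "convex cyl" by (intro convex_Times) auto
  then have "negligible (frontier cyl)" by (rule negligible_convex_frontier)
  moreover have "interior cyl = ocyl" by (simp add: interior_Times interior_cbox)
  then have "cyl - ocyl \<subseteq> frontier cyl"
    using closure_subset[of cyl] unfolding frontier_def by blast
  ultimately show ?thesis by (rule negligible_subset)
qed

text \<open>Vitali's theorem extracts from the fine cover \<open>K\<close> countably many disjoint
  balls that miss only a null set of the open cylinder. Finitely many of them carry at least half of
  the integral; finiteness lets the waves be added as a finite sum.\<close>

lemma Vitali_finite_half:
  fixes G :: "real \<times> (real^3) \<Rightarrow> real"
  assumes G: "integrable lborel G" "\<And>y. 0 \<le> G y" "\<And>y. y \<notin> cyl \<Longrightarrow> G y = 0"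
    and K: "\<And>y e. y \<in> ocyl \<Longrightarrow> 0 < e \<Longrightarrow> \<exists>r. (y, r) \<in> K \<and> 0 < r \<and> r < e"
  obtains F where "finite F" "F \<subseteq> K" "disjoint_family_on (\<lambda>i. ball (fst i) (snd i)) F"
    "(LINT y|lborel. G y) / 2 \<le> (\<Sum>i\<in>F. LINT y|lborel. indicator (ball (fst i) (snd i)) y * G y)"
proof -
  let ?B = "\<lambda>i :: (real \<times> (real^3)) \<times> real. ball (fst i) (snd i)"
  have 1: "\<exists>i. i \<in> K \<and> y \<in> ball (fst i) (snd i) \<and> snd i < e" if "y \<in> ocyl" "0 < e" for y e
    using K[OF that] by (metis centre_in_ball fst_conv snd_conv)
  obtain C where C: "countable C" "C \<subseteq> K" "pairwise (\<lambda>i j. disjnt (?B i) (?B j)) C"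
    "negligible (ocyl - (\<Union>i\<in>C. ?B i))"
    by (rule Vitali_covering_theorem_balls[of ocyl K fst snd, OF 1])
  \<comment> \<open>\<open>from_nat_into\<close> enumerates exactly \<open>C\<close> only when
    \<open>C\<close> is nonempty.\<close>
  have "C \<noteq> {}"
  proof
    assume "C = {}"
    then have "negligible ocyl" using C(4) by simp
    moreover have "open ocyl" by (intro open_Times) auto
    moreover have "ocyl \<noteq> {}"
    proof -
      have "(1, \<chi> i. 1 / 2) \<in> ocyl" by (simp add: mem_box_cart)
      then show ?thesis by blast
    qed
    ultimately show False using open_not_negligible by blast
  qed
  then have ran: "range (from_nat_into C) = C" using C(1) by (rule range_from_nat_into)
  define F where "F n = from_nat_into C ` {..n}" for n
  have FC: "F n \<subseteq> C" for n using ran by (auto simp: F_def)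
  have dis: "disjoint_family_on ?B (F n)" for n
    using C(3) FC[of n] unfolding disjoint_family_on_def pairwise_def disjnt_def by (meson subsetD)
  have [measurable]: "G \<in> borel_measurable borel" using G(1) by auto
  have opU: "open (\<Union>i\<in>X. ?B i)" for X by auto
  have "(\<lambda>n. LINT y|lborel. indicator (\<Union>i\<in>F n. ?B i) y * G y) \<longlonglongrightarrow> (LINT y|lborel. indicator (\<Union>i\<in>C. ?B i) y * G y)"
  proof (rule integral_dominated_convergence[where w = G])
    show "(\<lambda>y. indicator (\<Union>i\<in>C. ?B i) y * G y) \<in> borel_measurable lborel"
      using opU[of C] by (intro borel_measurable_times borel_measurable_indicator) auto
    show "(\<lambda>y. indicator (\<Union>i\<in>F n. ?B i) y * G y) \<in> borel_measurable lborel" for n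
      using opU[of "F n"] by (intro borel_measurable_times borel_measurable_indicator) auto
    show "AE y in lborel. (\<lambda>n. indicator (\<Union>i\<in>F n. ?B i) y * G y) \<longlonglongrightarrow> indicator (\<Union>i\<in>C. ?B i) y * G y"
    proof (rule AE_I2)
      fix y
      have "eventually (\<lambda>n. indicator (\<Union>i\<in>F n. ?B i) y = (indicator (\<Union>i\<in>C. ?B i) y :: real)) sequentially"
      proof (cases "y \<in> (\<Union>i\<in>C. ?B i)")
        case True
        then obtain i where "i \<in> C" "y \<in> ?B i" by blast
        then obtain k where k: "y \<in> ?B (from_nat_into C k)" using ran by (metis imageE)
        have "y \<in> (\<Union>i\<in>F n. ?B i)" if "n \<ge> k" for n
          using k that by (auto simp: F_def)
        then show ?thesis
          using True by (intro eventually_sequentiallyI[of k]) (simp add: indicator_def)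
      next
        case False
        then have "y \<notin> (\<Union>i\<in>F n. ?B i)" for n using FC by blast
        then show ?thesis using False by (simp add: indicator_def)
      qed
      then show "(\<lambda>n. indicator (\<Union>i\<in>F n. ?B i) y * G y) \<longlonglongrightarrow> indicator (\<Union>i\<in>C. ?B i) y * G y"
        by (intro tendsto_mult tendsto_const tendsto_eventually)
    qed
  qed (use G in \<open>auto simp: indicator_def\<close>)
  moreover have "(LINT y|lborel. indicator (\<Union>i\<in>C. ?B i) y * G y) = (LINT y|lborel. G y)"
  proof -
    have "negligible (cyl - (\<Union>i\<in>C. ?B i))"
      by (rule negligible_subset[OF negligible_Un[OF negligible_cyl_diff C(4)]]) blast
    then have "AE y in lebesgue. y \<notin> cyl - (\<Union>i\<in>C. ?B i)"
      unfolding negligible_iff_null_sets by (rule AE_not_in)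
    then have "AE y in lborel. y \<notin> cyl - (\<Union>i\<in>C. ?B i)"
      by (simp add: AE_completion_iff)
    then have "AE y in lborel. indicator (\<Union>i\<in>C. ?B i) y * G y = G y"
      using G(3) by (auto simp: indicator_def elim!: eventually_mono)
    then show ?thesis
      using opU[of C] by (intro integral_cong_AE borel_measurable_times borel_measurable_indicator) auto
  qed
  ultimately have lim: "(\<lambda>n. LINT y|lborel. indicator (\<Union>i\<in>F n. ?B i) y * G y) \<longlonglongrightarrow> (LINT y|lborel. G y)"
    by simp
  have nn: "0 \<le> (LINT y|lborel. G y)" using G(2) by simp
  have "\<exists>n. (LINT y|lborel. G y) / 2 \<le> (LINT y|lborel. indicator (\<Union>i\<in>F n. ?B i) y * G y)"
  proof (cases "(LINT y|lborel. G y) = 0")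
    case True
    then show ?thesis using G(2) by (auto intro!: exI[of _ 0] integral_nonneg)
  next
    case False
    then have "(LINT y|lborel. G y) / 2 < (LINT y|lborel. G y)" using nn by simp
    from order_tendstoD(1)[OF lim this] show ?thesis
      by (auto simp: eventually_sequentially intro: less_imp_le)
  qed
  then obtain n where n: "(LINT y|lborel. G y) / 2 \<le> (LINT y|lborel. indicator (\<Union>i\<in>F n. ?B i) y * G y)" by blast
  have fin: "finite (F n)" by (simp add: F_def)
  have "(LINT y|lborel. indicator (\<Union>i\<in>F n. ?B i) y * G y) = (LINT y|lborel. (\<Sum>i\<in>F n. indicator (?B i) y * G y))"
    by (simp add: indicator_UN_disjoint[OF fin dis] sum_distrib_right)
  also have "\<dots> = (\<Sum>i\<in>F n. LINT y|lborel. indicator (?B i) y * G y)"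
  proof (rule Bochner_Integration.integral_sum)
    show "integrable lborel (\<lambda>y. indicator (?B i) y * G y)" for i
      using integrable_mult_indicator[OF _ G(1), of "?B i"] by simp
  qed
  finally show thesis
    using that[OF fin _ dis] FC C(2) n by auto
qed

text \<open>The weight \<open>exp (- t)\<close> makes the integral over the unbounded time axis finite.\<close>

definition Jfun where
  "Jfun \<rho> v M = (LINT y|lborel. indicator cyl y * (exp (- fst y) * edens \<rho> v M y))"

lemma edens_pos:
  assumes "subsol \<rho> U v M" "y \<in> cyl"
  shows "0 < edens \<rho> v M y"
proof -
  have "Emat \<rho> v M y $ i $ i > 0" for i
    using subsolD(6)[OF assms, of "axis i 1"] by (simp add: qf_axis axis_eq_0_iff)
  then show ?thesis unfolding edens_def trace_def by (intro sum_pos) auto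
qed

lemma edens_bounded:
  assumes "subsol \<rho> U v M"
  obtains B where "B \<ge> 0" "\<And>y. y \<in> cyl \<Longrightarrow> edens \<rho> v M y \<le> B"
proof -
  obtain B where B: "\<And>y. y \<in> cyl \<Longrightarrow> norm (M y) \<le> B" using subsolD(4)[OF assms] by blast
  have "edens \<rho> v M y \<le> \<bar>3 * \<rho> + 3 * B\<bar>" if "y \<in> cyl" for y
  proof -
    have "trace (M y) \<le> (\<Sum>i\<in>(UNIV :: 3 set). B)"
      unfolding trace_def
    proof (intro sum_mono)
      fix i :: 3
      have "\<bar>M y $ i $ i\<bar> \<le> norm (M y $ i)" by (rule component_le_norm_cart)
      also have "\<dots> \<le> norm (M y)" by (rule Finite_Cartesian_Product.norm_nth_le)
      finally show "M y $ i $ i \<le> B" using B[OF that] by linarith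
    qed
    then have "trace (M y) \<le> 3 * B" by simp
    then show ?thesis
      unfolding edens_eq using inner_ge_zero[of "v y"] abs_ge_self[of "3 * \<rho> + 3 * B"] by linarith
  qed
  then show thesis by (intro that[of "\<bar>3 * \<rho> + 3 * B\<bar>"]) auto
qed

lemma integrable_edens:
  assumes "subsol \<rho> U v M"
  shows "integrable lborel (\<lambda>y. indicator cyl y * (exp (- fst y) * edens \<rho> v M y))"
    and "Jfun \<rho> v M = (LINT t|LT. exp (- t) * (LINT x|LQ. edens \<rho> v M (t, x)))"
    and "integrable LT (\<lambda>t. exp (- t) * (LINT x|LQ. edens \<rho> v M (t, x)))"
proof -
  obtain B where B: "B \<ge> 0" "\<And>y. y \<in> cyl \<Longrightarrow> edens \<rho> v M y \<le> B" using edens_bounded[OF assms] by blast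
  have m: "(\<lambda>y. exp (- fst y) * edens \<rho> v M y) \<in> borel_measurable borel"
    by (intro borel_measurable_continuous_onI continuous_intros continuous_edens subsolD[OF assms])
  have b: "\<bar>exp (- fst y) * edens \<rho> v M y\<bar> \<le> B * exp (- fst y)" if "y \<in> cyl" for y
    using B(2)[OF that] edens_pos[OF assms that] by (simp add: abs_mult)
  note * = cyl_bounded_integrable[OF m b]
  show "integrable lborel (\<lambda>y. indicator cyl y * (exp (- fst y) * edens \<rho> v M y))" using *(1) by blast
  show "Jfun \<rho> v M = (LINT t|LT. exp (- t) * (LINT x|LQ. edens \<rho> v M (t, x)))"
    using *(2) by (simp add: Jfun_def)
  show "integrable LT (\<lambda>t. exp (- t) * (LINT x|LQ. edens \<rho> v M (t, x)))"
    using *(3) by simp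
qed

text \<open>The wave has mean zero at time \<open>t\<close>, so the constant \<open>g x0\<close>,
  with \<open>x0\<close> in the slice of the ball, may be subtracted from \<open>g\<close>. Points
  of the slice are closer than \<open>2 * r\<close>, and only the oscillation \<open>e\<close> is
  left.\<close>

lemma bump_oscillation:
  assumes b: "bump_on \<rho> v M d y0 r p P" and sub: "ball y0 r \<subseteq> cyl"
    and C: "edens \<rho> v M y0 + 2 \<le> C" and g: "continuous_on Q3 g"
    and osc: "\<And>x x'. x \<in> Q3 \<Longrightarrow> x' \<in> Q3 \<Longrightarrow> dist x x' < 2 * r \<Longrightarrow> norm (g x - g x') \<le> e" and e: "0 \<le> e"
  shows "\<bar>LINT x|LQ. p (t, x) \<bullet> g x\<bar> \<le> C * e * (LINT x|LQ. indicator (ball y0 r) (t, x))"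
proof -
  have inc: "inc p P" and zero: "\<And>y. y \<notin> ball y0 r \<Longrightarrow> p y = 0" and bd: "\<And>y. norm (p y) \<le> C"
    and mean: "\<And>c. (LINT x|LQ. p (t, x) \<bullet> c) = 0"
    using b C unfolding bump_on_def by (blast intro: order_trans)+
  have C0: "0 \<le> C" using bd[of undefined] norm_ge_zero order_trans by blast
  show ?thesis
  proof (cases "\<exists>x0\<in>Q3. (t, x0) \<in> ball y0 r")
    case True
    then obtain x0 where x0: "x0 \<in> Q3" "(t, x0) \<in> ball y0 r" by blast
    have i: "integrable LQ (\<lambda>x. p (t, x) \<bullet> h x)" if "continuous_on Q3 h" for h
      by (intro integrable_LQ_continuous continuous_intros that continuous_on_compose2[OF incD(1)[OF inc]]) auto
    have "(LINT x|LQ. p (t, x) \<bullet> g x) = (LINT x|LQ. p (t, x) \<bullet> (g x - g x0))"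
      using i[OF g] i[OF continuous_on_const, of "g x0"] mean[of "g x0"] by (simp add: inner_diff_right)
    also have "\<bar>\<dots>\<bar> \<le> (LINT x|LQ. C * e * indicator (ball y0 r) (t, x))"
    proof -
      have *: "\<bar>p (t, x) \<bullet> (g x - g x0)\<bar> \<le> C * e * indicator (ball y0 r) (t, x)" if "x \<in> Q3" for x
      proof (cases "(t, x) \<in> ball y0 r")
        case True
        have "dist x x0 \<le> dist (t, x) (t, x0)" by (simp add: dist_Pair_Pair)
        also have "\<dots> < 2 * r" using True x0(2) dist_triangle3[of "(t, x)" "(t, x0)" y0] by simp
        finally have "norm (g x - g x0) \<le> e" using osc that x0 by blast
        then have "norm (p (t, x)) * norm (g x - g x0) \<le> C * e"
          using bd C0 by (intro mult_mono) auto
        then show ?thesis using True Cauchy_Schwarz_ineq2[of "p (t, x)" "g x - g x0"] by simp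
      qed (simp add: zero)
      have "integrable LQ (\<lambda>x. p (t, x) \<bullet> (g x - g x0))" by (intro i continuous_intros g)
      then show ?thesis
        by (rule integral_abs_bound_integral)
          (use * in \<open>auto simp: space_LQ intro!: integrable_mult_right integrable_slice_ball\<close>)
    qed
    finally show ?thesis by simp
  next
    case False
    then have "(LINT x|LQ. p (t, x) \<bullet> g x) = (LINT x|LQ. 0)"
      by (intro Bochner_Integration.integral_cong refl) (auto simp: space_LQ zero)
    moreover have "0 \<le> (LINT x|LQ. indicator (ball y0 r) (t, x) :: real)" by simp
    ultimately show ?thesis using C0 e by simp
  qed
qed

text \<open>\<open>C\<close> depends only on a bound for the energy density of the given subsolution
  and is fixed before \<open>d\<close>; hence \<open>d\<close> can afterwards be matched to the
  modulus of continuity of any field. The factor combines the half kept by the covering with the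
  gain 1/400000 on each ball.\<close>

lemma improvement_step:
  assumes sub: "subsol \<rho> U v M"
  shows "\<exists>C>0. \<forall>d>0. \<exists>v' M'. subsol \<rho> U v' M' \<and>
     (\<forall>t g e. continuous_on Q3 g \<longrightarrow> 0 \<le> e \<longrightarrow> (\<forall>x\<in>Q3. \<forall>x'\<in>Q3. dist x x' < d \<longrightarrow> norm (g x - g x') \<le> e)
        \<longrightarrow> \<bar>LINT x|LQ. (v' (t, x) - v (t, x)) \<bullet> g x\<bar> \<le> C * e) \<and>
     (\<forall>t. (LINT x|LQ. trace (M' (t, x))) \<le> (LINT x|LQ. trace (M (t, x))) + d) \<and>
     Jfun \<rho> v' M' \<le> (1 - 1 / 800000) * Jfun \<rho> v M"
proof -
  note S = subsolD[OF sub]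
  have oc: "ocyl \<subseteq> cyl" using box_subset_cbox[of "0 :: real^3" 1] by fastforce
  obtain B0 where B0: "B0 \<ge> 0" "\<And>y. y \<in> cyl \<Longrightarrow> edens \<rho> v M y \<le> B0" using edens_bounded[OF sub] by blast
  define C where "C = B0 + 2"
  have C: "C > 0" using B0 by (simp add: C_def)
  show ?thesis
  proof (intro exI[of _ C] conjI C allI impI)
    fix d :: real assume d: "d > 0"
    have "\<forall>y0. \<exists>r0. y0 \<in> ocyl \<longrightarrow> r0 > 0 \<and> (\<forall>r. 0 < r \<longrightarrow> r < r0 \<longrightarrow> cball y0 r \<subseteq> ocyl \<and> (\<exists>p P. bump_on \<rho> v M d y0 r p P))"
      using bump_exists[OF sub _ d] by metis
    then obtain r0 where r0: "\<And>y0. y0 \<in> ocyl \<Longrightarrow> r0 y0 > 0"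
      "\<And>y0 r. y0 \<in> ocyl \<Longrightarrow> 0 < r \<Longrightarrow> r < r0 y0 \<Longrightarrow> cball y0 r \<subseteq> ocyl \<and> (\<exists>p P. bump_on \<rho> v M d y0 r p P)"
      by metis
    \<comment> \<open>The condition \<open>2 * r < d\<close> lets the oscillation hypothesis on
      \<open>g\<close> apply on every ball.\<close>
    define K where "K = {(y, r). y \<in> ocyl \<and> 0 < r \<and> r < r0 y \<and> 2 * r < d}"
    define G where "G y = indicator cyl y * (exp (- fst y) * edens \<rho> v M y)" for y
    have JG: "Jfun \<rho> v M = (LINT y|lborel. G y)" by (simp add: Jfun_def G_def)
    have Gint: "integrable lborel G" unfolding G_def by (rule integrable_edens[OF sub])
    have Gnn: "0 \<le> G y" for y
      using edens_pos[OF sub, of y] by (simp add: G_def indicator_def less_imp_le)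
    have G0: "G y = 0" if "y \<notin> cyl" for y using that by (simp add: G_def)
    have K: "\<exists>r. (y, r) \<in> K \<and> 0 < r \<and> r < e" if "y \<in> ocyl" "0 < e" for y e
      using r0(1)[OF that(1)] that d
      by (intro exI[of _ "Min {r0 y, e, d} / 3"]) (auto simp: K_def min_def)
    obtain F where F: "finite F" "F \<subseteq> K" "disjoint_family_on (\<lambda>i. ball (fst i) (snd i)) F"
      "(LINT y|lborel. G y) / 2 \<le> (\<Sum>i\<in>F. LINT y|lborel. indicator (ball (fst i) (snd i)) y * G y)"
      using Vitali_finite_half[OF Gint Gnn G0 K] by blast
    define B where "B i = ball (fst i) (snd i)" for i :: "(real \<times> (real^3)) \<times> real"
    have FK: "fst i \<in> ocyl" "0 < snd i" "2 * snd i < d" "cball (fst i) (snd i) \<subseteq> ocyl"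
      "\<exists>p P. bump_on \<rho> v M d (fst i) (snd i) p P" if "i \<in> F" for i
    proof -
      have "i \<in> K" using F(2) that by blast
      then show "fst i \<in> ocyl" "0 < snd i" "2 * snd i < d" "cball (fst i) (snd i) \<subseteq> ocyl"
        "\<exists>p P. bump_on \<rho> v M d (fst i) (snd i) p P"
        using r0(2)[of "fst i" "snd i"] by (auto simp: K_def split: prod.splits)
    qed
    have "\<forall>i. \<exists>p P. i \<in> F \<longrightarrow> bump_on \<rho> v M d (fst i) (snd i) p P" using FK(5) by blast
    then obtain p P where bump: "\<And>i. i \<in> F \<Longrightarrow> bump_on \<rho> v M d (fst i) (snd i) (p i) (P i)" by metis
    have inc: "inc (p i) (P i)" and zero: "\<And>y. y \<notin> B i \<Longrightarrow> p i y = 0 \<and> P i y = 0"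
      and posi: "\<And>y z. y \<in> B i \<Longrightarrow> z \<noteq> 0 \<Longrightarrow> qf (Emat \<rho> (\<lambda>y. v y + p i y) (\<lambda>y. M y + P i y) y) z > 0"
      and tri: "\<And>t. (LINT x|LQ. trace (P i (t, x))) \<le> d * (LINT x|LQ. indicator (B i) (t, x))"
      and gaini: "(1 / 400000) * (LINT y|lborel. indicator (B i) y * (exp (- fst y) * edens \<rho> v M y))
        \<le> (LINT y|lborel. indicator (B i) y *
            (exp (- fst y) * (edens \<rho> v M y - edens \<rho> (\<lambda>y. v y + p i y) (\<lambda>y. M y + P i y) y)))"
      if "i \<in> F" for i
      using bump[OF that] unfolding bump_on_def B_def by blast+
    have Bo: "B i \<subseteq> cyl" if "i \<in> F" for i
      using FK(4)[OF that] ball_subset_cball oc unfolding B_def by blast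
    define p' where "p' y = (\<Sum>i\<in>F. p i y)" for y
    define P' where "P' y = (\<Sum>i\<in>F. P i y)" for y
    have inc': "inc p' P'"
      unfolding p'_def [abs_def] P'_def [abs_def] by (rule inc_sum[OF F(1) inc])
    have disB: "i = j" if "i \<in> F" "j \<in> F" "y \<in> B i" "y \<in> B j" for i j y
      using F(3) that unfolding disjoint_family_on_def B_def by blast
    \<comment> \<open>The balls are disjoint, so at each point at most one wave is nonzero and the
      quadratic quantities can be computed ball by ball.\<close>
    have on: "p' y = p i y" "P' y = P i y" if "i \<in> F" "y \<in> B i" for i y
    proof -
      have "j \<noteq> i \<Longrightarrow> p j y = 0 \<and> P j y = 0" if "j \<in> F" for j
        using zero[OF that] disB[OF \<open>i \<in> F\<close> that \<open>y \<in> B i\<close>] by blast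
      then show "p' y = p i y" "P' y = P i y"
        unfolding p'_def P'_def using F(1) \<open>i \<in> F\<close> by (simp_all add: sum.remove[of F i])
    qed
    have off: "p' y = 0" "P' y = 0" if "\<And>i. i \<in> F \<Longrightarrow> y \<notin> B i" for y
      unfolding p'_def P'_def using zero that by (auto intro!: sum.neutral)
    have edon: "edens \<rho> (\<lambda>y. v y + p' y) (\<lambda>y. M y + P' y) y = edens \<rho> (\<lambda>y. v y + p i y) (\<lambda>y. M y + P i y) y"
      if "i \<in> F" "y \<in> B i" for i y
      by (simp add: edens_eq on[OF that])
    have pos': "qf (Emat \<rho> (\<lambda>y. v y + p' y) (\<lambda>y. M y + P' y) y) z > 0" if "y \<in> cyl" "z \<noteq> 0" for y z
    proof (cases "\<exists>i\<in>F. y \<in> B i")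
      case True
      then obtain i where i: "i \<in> F" "y \<in> B i" by blast
      then show ?thesis using posi[OF i that(2)] by (simp add: Emat_def on[OF i])
    next
      case False
      then have "Emat \<rho> (\<lambda>y. v y + p' y) (\<lambda>y. M y + P' y) y = Emat \<rho> v M y"
        using off[of y] by (auto simp: Emat_def)
      then show ?thesis using S(6)[OF that] by simp
    qed
    have sub': "subsol \<rho> U (\<lambda>y. v y + p' y) (\<lambda>y. M y + P' y)"
      by (rule subsol_add_inc[OF sub inc' pos'])
    \<comment> \<open>At a fixed time the slices of the balls are disjoint in a box of volume 1.
      This makes the bounds for oscillation and trace independent of the number of balls.\<close>
    have indsum: "(\<Sum>i\<in>F. LINT x|LQ. indicator (B i) (t, x)) \<le> (1 :: real)" for t
    proof -
      interpret finite_measure LQ by (rule measure_Q3(3))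
      have "(\<Sum>i\<in>F. LINT x|LQ. indicator (B i) (t, x)) = (LINT x|LQ. (\<Sum>i\<in>F. indicator (B i) (t, x)) :: real)"
        unfolding B_def by (intro Bochner_Integration.integral_sum[symmetric] integrable_slice_ball)
      also have "\<dots> \<le> (LINT x|LQ. 1)"
      proof (rule integral_mono)
        show "integrable LQ (\<lambda>x. (\<Sum>i\<in>F. indicator (B i) (t, x)) :: real)"
          unfolding B_def by (intro Bochner_Integration.integrable_sum integrable_slice_ball)
        have "(\<Sum>i\<in>F. indicator (B i) y) = (indicator (\<Union>i\<in>F. B i) y :: real)" for y
          unfolding B_def by (rule indicator_UN_disjoint[OF F(1,3), symmetric])
        then show "(\<Sum>i\<in>F. indicator (B i) (t, x)) \<le> (1 :: real)" for x
          by (simp add: indicator_def)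
      qed simp
      also have "\<dots> = 1" using measure_Q3(2) by (simp add: space_LQ)
      finally show ?thesis .
    qed
    have cslice: "continuous_on Q3 (\<lambda>x. f (t, x))" if "continuous_on UNIV f" for f :: "real \<times> (real^3) \<Rightarrow> 'a::topological_space" and t
      by (intro continuous_on_compose2[OF that] continuous_intros) auto
    have osc: "\<bar>LINT x|LQ. (v (t, x) + p' (t, x) - v (t, x)) \<bullet> g x\<bar> \<le> C * e"
      if g: "continuous_on Q3 g" and e: "0 \<le> e"
        and o: "\<forall>x\<in>Q3. \<forall>x'\<in>Q3. dist x x' < d \<longrightarrow> norm (g x - g x') \<le> e" for t g e
    proof -
      have "(LINT x|LQ. (v (t, x) + p' (t, x) - v (t, x)) \<bullet> g x) = (LINT x|LQ. (\<Sum>i\<in>F. p i (t, x) \<bullet> g x))"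
        by (simp add: p'_def inner_sum_left)
      also have "\<dots> = (\<Sum>i\<in>F. LINT x|LQ. p i (t, x) \<bullet> g x)"
        by (intro Bochner_Integration.integral_sum integrable_LQ_continuous continuous_intros g cslice incD(1)[OF inc])
      also have "\<bar>\<dots>\<bar> \<le> (\<Sum>i\<in>F. C * e * (LINT x|LQ. indicator (B i) (t, x)))"
      proof (rule order_trans[OF sum_abs sum_mono])
        fix i assume i: "i \<in> F"
        have "edens \<rho> v M (fst i) + 2 \<le> C" using B0(2)[of "fst i"] FK(1)[OF i] oc by (auto simp: C_def)
        then show "\<bar>LINT x|LQ. p i (t, x) \<bullet> g x\<bar> \<le> C * e * (LINT x|LQ. indicator (B i) (t, x))"
          using Bo[OF i] FK(3)[OF i] o unfolding B_def
          by (intro bump_oscillation[OF bump[OF i] _ _ g _ e]) auto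
      qed
      also have "\<dots> = C * e * (\<Sum>i\<in>F. LINT x|LQ. indicator (B i) (t, x))" by (simp add: sum_distrib_left)
      also have "\<dots> \<le> C * e * 1"
        using C e by (intro mult_left_mono indsum) auto
      finally show ?thesis by simp
    qed
    have ctr: "continuous_on UNIV (\<lambda>y. trace (f y))" if "continuous_on UNIV f" for f :: "real \<times> (real^3) \<Rightarrow> real^3^3"
      unfolding trace_def by (intro continuous_intros that)
    have tr: "(LINT x|LQ. trace (M (t, x) + P' (t, x))) \<le> (LINT x|LQ. trace (M (t, x))) + d" for t
    proof -
      have "trace (P' y) = (\<Sum>i\<in>F. trace (P i y))" for y
        unfolding P'_def trace_def by (simp add: sum.swap[of _ F])
      then have "(LINT x|LQ. trace (M (t, x) + P' (t, x))) = (LINT x|LQ. trace (M (t, x)) + (\<Sum>i\<in>F. trace (P i (t, x))))"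
        by (simp add: trace_algebra)
      also have "\<dots> = (LINT x|LQ. trace (M (t, x))) + (LINT x|LQ. (\<Sum>i\<in>F. trace (P i (t, x))))"
        by (intro Bochner_Integration.integral_add Bochner_Integration.integrable_sum integrable_LQ_continuous cslice ctr S incD(2)[OF inc])
      also have "(LINT x|LQ. (\<Sum>i\<in>F. trace (P i (t, x)))) = (\<Sum>i\<in>F. LINT x|LQ. trace (P i (t, x)))"
        by (intro Bochner_Integration.integral_sum integrable_LQ_continuous cslice ctr incD(2)[OF inc])
      also have "\<dots> \<le> (\<Sum>i\<in>F. d * (LINT x|LQ. indicator (B i) (t, x)))"
        by (intro sum_mono tri)
      also have "\<dots> = d * (\<Sum>i\<in>F. LINT x|LQ. indicator (B i) (t, x))" by (simp add: sum_distrib_left)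
      also have "\<dots> \<le> d * 1" using d by (intro mult_left_mono indsum) auto
      finally show ?thesis by simp
    qed
    let ?h = "\<lambda>i y. indicator (B i) y * (exp (- fst y) * (edens \<rho> v M y - edens \<rho> (\<lambda>y. v y + p i y) (\<lambda>y. M y + P i y) y)) :: real"
    have hint: "integrable lborel (?h i)" if "i \<in> F" for i
      unfolding B_def
      by (intro integrable_ball_continuous continuous_on_mult continuous_on_diff continuous_edens continuous_on_add
          S incD(1,2)[OF inc[OF that]] continuous_intros)
    have split: "indicator cyl y * (exp (- fst y) * edens \<rho> (\<lambda>y. v y + p' y) (\<lambda>y. M y + P' y) y) = G y - (\<Sum>i\<in>F. ?h i y)" for y
    proof (cases "\<exists>i\<in>F. y \<in> B i")
      case True
      then obtain i where i: "i \<in> F" "y \<in> B i" by blast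
      have "?h j y = 0" if "j \<in> F - {i}" for j
      proof -
        have "y \<notin> B j" using disB[OF i(1) _ i(2), of j] that by blast
        then show ?thesis by simp
      qed
      then have "(\<Sum>j\<in>F. ?h j y) = ?h i y"
        unfolding sum.remove[OF F(1) i(1)] by (subst sum.neutral) auto
      moreover have "y \<in> cyl" using Bo[OF i(1)] i(2) by blast
      ultimately show ?thesis using i(2) by (simp add: G_def edon[OF i] right_diff_distrib)
    next
      case False
      then have "(\<Sum>i\<in>F. ?h i y) = 0" by (intro sum.neutral) simp
      moreover have "p' y = 0" "P' y = 0" using False by (auto intro!: off)
      ultimately show ?thesis by (simp only: G_def edens_eq) simp
    qed
    have Jeq: "Jfun \<rho> (\<lambda>y. v y + p' y) (\<lambda>y. M y + P' y) = (LINT y|lborel. G y) - (\<Sum>i\<in>F. LINT y|lborel. ?h i y)"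
      unfolding Jfun_def split
      by (subst Bochner_Integration.integral_diff) (auto intro!: Gint Bochner_Integration.integrable_sum hint
          simp: Bochner_Integration.integral_sum[OF hint])
    have gain: "(1 / 400000) * (LINT y|lborel. indicator (B i) y * G y) \<le> (LINT y|lborel. ?h i y)" if "i \<in> F" for i
    proof -
      have "indicator (B i) y * G y = indicator (B i) y * (exp (- fst y) * edens \<rho> v M y)" for y
      proof (cases "y \<in> B i")
        case True
        then have "y \<in> cyl" using Bo[OF that] by blast
        then show ?thesis by (simp only: G_def) simp
      qed simp
      then show ?thesis using gaini[OF that] by (simp only: )
    qed
    have "(1 / 400000) * (\<Sum>i\<in>F. LINT y|lborel. indicator (B i) y * G y) \<le> (\<Sum>i\<in>F. LINT y|lborel. ?h i y)"
      unfolding sum_distrib_left by (intro sum_mono gain)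
    then have "Jfun \<rho> (\<lambda>y. v y + p' y) (\<lambda>y. M y + P' y) \<le> (1 - 1 / 800000) * Jfun \<rho> v M"
      using F(4) Jeq unfolding JG B_def[symmetric] by simp
    with sub' osc tr show "\<exists>v' M'. subsol \<rho> U v' M' \<and>
     (\<forall>t g e. continuous_on Q3 g \<longrightarrow> 0 \<le> e \<longrightarrow> (\<forall>x\<in>Q3. \<forall>x'\<in>Q3. dist x x' < d \<longrightarrow> norm (g x - g x') \<le> e)
        \<longrightarrow> \<bar>LINT x|LQ. (v' (t, x) - v (t, x)) \<bullet> g x\<bar> \<le> C * e) \<and>
     (\<forall>t. (LINT x|LQ. trace (M' (t, x))) \<le> (LINT x|LQ. trace (M (t, x))) + d) \<and>
     Jfun \<rho> v' M' \<le> (1 - 1 / 800000) * Jfun \<rho> v M"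
      by (intro exI[of _ "\<lambda>y. v y + p' y"] exI[of _ "\<lambda>y. M y + P' y"]) blast
  qed
qed

section \<open>Square-integrable fields on the box\<close>

abbreviation L2 :: "(real^3 \<Rightarrow> real^3) set" where "L2 \<equiv> L2_fields"

lemma L2D:
  assumes "f \<in> L2"
  shows "f \<in> borel_measurable LQ" "integrable LQ (\<lambda>x. (norm (f x))\<^sup>2)"
  using assms by (auto simp: L2_fields_def)

lemma L2_norm_nonneg: "0 \<le> L2_norm f" and L2_norm_power2: "(L2_norm f)\<^sup>2 = (LINT x|lebesgue_on Qbox. (norm (f x))\<^sup>2)"
  by (simp_all add: L2_norm_def)

lemma L2_dominated:
  assumes "g \<in> L2" "f \<in> borel_measurable LQ" "\<And>x. x \<in> Q3 \<Longrightarrow> norm (f x) \<le> K * norm (g x)" "0 \<le> K"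
  shows "f \<in> L2" "L2_norm f \<le> K * L2_norm g"
proof -
  have b: "(norm (f x))\<^sup>2 \<le> K\<^sup>2 * (norm (g x))\<^sup>2" if "x \<in> Q3" for x
    using power_mono[OF assms(3)[OF that], of 2] by (simp add: power_mult_distrib)
  have gi: "integrable LQ (\<lambda>x. K\<^sup>2 * (norm (g x))\<^sup>2)"
    using L2D[OF assms(1)] by simp
  have fi: "integrable LQ (\<lambda>x. (norm (f x))\<^sup>2)"
    using assms(2) b by (intro Bochner_Integration.integrable_bound[OF gi]) (auto intro!: AE_I2 simp: space_LQ)
  then show "f \<in> L2" using assms(2) by (simp add: L2_fields_def)
  have "(LINT x|LQ. (norm (f x))\<^sup>2) \<le> (LINT x|LQ. K\<^sup>2 * (norm (g x))\<^sup>2)"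
    by (intro integral_mono fi gi) (simp add: space_LQ b)
  then have "(L2_norm f)\<^sup>2 \<le> (K * L2_norm g)\<^sup>2"
    by (simp add: L2_norm_power2 power_mult_distrib)
  then show "L2_norm f \<le> K * L2_norm g"
    using assms(4) L2_norm_nonneg[of g] by (simp add: power2_le_iff_abs_le)
qed

lemma continuous_in_L2:
  assumes "continuous_on Q3 f"
  shows "f \<in> L2"
proof -
  have "f \<in> borel_measurable LQ"
    by (rule continuous_imp_measurable_on_sets_lebesgue[OF assms]) auto
  moreover have "integrable LQ (\<lambda>x. (norm (f x))\<^sup>2)"
    by (intro integrable_LQ_continuous continuous_intros assms)
  ultimately show ?thesis by (simp add: L2_fields_def)
qed

lemma L2_add:
  assumes "f \<in> L2" "g \<in> L2"
  shows "(\<lambda>x. f x + g x) \<in> L2"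
proof -
  note f = L2D[OF assms(1)] and g = L2D[OF assms(2)]
  have b: "(norm (f x + g x))\<^sup>2 \<le> 2 * (norm (f x))\<^sup>2 + 2 * (norm (g x))\<^sup>2" for x
    using power_mono[OF norm_triangle_ineq[of "f x" "g x"], of 2] zero_le_power2[of "norm (f x) - norm (g x)"]
    by (simp add: power2_sum power2_diff)
  have "integrable LQ (\<lambda>x. (norm (f x + g x))\<^sup>2)"
  proof (rule Bochner_Integration.integrable_bound)
    show "integrable LQ (\<lambda>x. 2 * (norm (f x))\<^sup>2 + 2 * (norm (g x))\<^sup>2)" using f g by simp
    show "AE x in LQ. norm ((norm (f x + g x))\<^sup>2) \<le> norm (2 * (norm (f x))\<^sup>2 + 2 * (norm (g x))\<^sup>2)"
      using order_trans[OF b abs_ge_self] by (intro AE_I2) simp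
  qed (use f g in auto)
  then show ?thesis using f g by (simp add: L2_fields_def)
qed

lemma L2_scale: "f \<in> L2 \<Longrightarrow> (\<lambda>x. c *\<^sub>R f x) \<in> L2"
  by (rule L2_dominated(1)[where K = "\<bar>c\<bar>"]) (auto dest: L2D)

lemma L2_diff: "f \<in> L2 \<Longrightarrow> g \<in> L2 \<Longrightarrow> (\<lambda>x. f x - g x) \<in> L2"
  using L2_add[of f "\<lambda>x. (-1) *\<^sub>R g x"] L2_scale[of g "-1"] by simp

lemma L2_inner_integrable:
  assumes "f \<in> L2" "g \<in> L2"
  shows "integrable LQ (\<lambda>x. f x \<bullet> g x)"
proof (rule Bochner_Integration.integrable_bound)
  show "integrable LQ (\<lambda>x. (norm (f x))\<^sup>2 + (norm (g x))\<^sup>2)"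
    using L2D[OF assms(1)] L2D[OF assms(2)] by simp
  show "(\<lambda>x. f x \<bullet> g x) \<in> borel_measurable LQ"
    using L2D[OF assms(1)] L2D[OF assms(2)] by (intro borel_measurable_inner)
  have "\<bar>f x \<bullet> g x\<bar> \<le> (norm (f x))\<^sup>2 + (norm (g x))\<^sup>2" for x
    using Cauchy_Schwarz_ineq2[of "f x" "g x"] zero_le_power2[of "norm (f x) - norm (g x)"]
      zero_le_power2[of "norm (f x)"] zero_le_power2[of "norm (g x)"]
    unfolding power2_diff by linarith
  then show "AE x in LQ. norm (f x \<bullet> g x) \<le> norm ((norm (f x))\<^sup>2 + (norm (g x))\<^sup>2)"
    by (intro AE_I2) simp
qed

lemma L2_inner_self: "L2_inner f f = (L2_norm f)\<^sup>2"
  by (simp add: L2_norm_power2 L2_inner_def dot_square_norm)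

lemma L2_inner_algebra:
  assumes "f \<in> L2" "g \<in> L2" "h \<in> L2"
  shows "L2_inner (\<lambda>x. f x + g x) h = L2_inner f h + L2_inner g h"
    "L2_inner (\<lambda>x. f x - g x) h = L2_inner f h - L2_inner g h"
    "L2_inner (\<lambda>x. c *\<^sub>R f x) h = c * L2_inner f h" "L2_inner f h = L2_inner h f"
  using L2_inner_integrable[OF assms(1,3)] L2_inner_integrable[OF assms(2,3)]
  by (simp_all add: L2_inner_def inner_add_left inner_diff_left) (simp add: inner_commute)

lemma L2_norm_add_power2:
  assumes "f \<in> L2" "g \<in> L2"
  shows "(L2_norm (\<lambda>x. f x + g x))\<^sup>2 = (L2_norm f)\<^sup>2 + 2 * L2_inner f g + (L2_norm g)\<^sup>2"
proof -
  have "(norm (f x + g x))\<^sup>2 = (norm (f x))\<^sup>2 + 2 * (f x \<bullet> g x) + (norm (g x))\<^sup>2" for x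
    by (simp add: power2_norm_eq_inner inner_add_left inner_add_right inner_commute)
  then show ?thesis
    using L2D[OF assms(1)] L2D[OF assms(2)] L2_inner_integrable[OF assms]
    by (simp add: L2_norm_power2 L2_inner_def)
qed

lemma discriminant_nonpos_bound:
  fixes a b c :: real
  assumes q: "\<And>s. 0 \<le> s\<^sup>2 * a + 2 * s * c + b" and "0 \<le> a"
  shows "c\<^sup>2 \<le> a * b"
proof (cases "a = 0")
  case True
  have "c = 0"
  proof (rule ccontr)
    assume "c \<noteq> 0"
    then have "2 * (- (b + 1) / (2 * c)) * c = - (b + 1)" by simp
    then show False using q[of "- (b + 1) / (2 * c)"] True by simp
  qed
  then show ?thesis using True by simp
next
  case False
  then have "a > 0" using assms(2) by simp
  then have "a * ((- c / a)\<^sup>2 * a + 2 * (- c / a) * c + b) = a * b - c\<^sup>2"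
    by (simp add: power2_eq_square field_simps)
  then show ?thesis using mult_left_mono[OF q[of "- c / a"], of a] \<open>a > 0\<close> by simp
qed

lemma L2_Cauchy_Schwarz:
  assumes "f \<in> L2" "g \<in> L2"
  shows "\<bar>L2_inner f g\<bar> \<le> L2_norm f * L2_norm g"
proof -
  let ?a = "(L2_norm f)\<^sup>2" and ?b = "(L2_norm g)\<^sup>2" and ?c = "L2_inner f g"
  have q: "0 \<le> s\<^sup>2 * ?a + 2 * s * ?c + ?b" for s
  proof -
    have "(L2_norm (\<lambda>x. s *\<^sub>R f x))\<^sup>2 = s\<^sup>2 * ?a"
      by (simp add: L2_norm_power2 power_mult_distrib)
    then have "(L2_norm (\<lambda>x. s *\<^sub>R f x + g x))\<^sup>2 = s\<^sup>2 * ?a + 2 * s * ?c + ?b"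
      using L2_norm_add_power2[OF L2_scale[OF assms(1)] assms(2), of s] L2_inner_algebra(3)[OF assms(1,1,2), of s] by simp
    then show ?thesis by (metis zero_le_power2)
  qed
  have "?c\<^sup>2 \<le> ?a * ?b" by (rule discriminant_nonpos_bound[OF q]) simp
  then have "?c\<^sup>2 \<le> (L2_norm f * L2_norm g)\<^sup>2" by (simp add: power_mult_distrib)
  then show ?thesis
    using L2_norm_nonneg[of f] L2_norm_nonneg[of g] by (simp add: power2_le_iff_abs_le)
qed

lemma L2_triangle:
  assumes "f \<in> L2" "g \<in> L2"
  shows "L2_norm (\<lambda>x. f x + g x) \<le> L2_norm f + L2_norm g"
proof -
  have "(L2_norm (\<lambda>x. f x + g x))\<^sup>2 \<le> (L2_norm f + L2_norm g)\<^sup>2"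
    unfolding L2_norm_add_power2[OF assms] power2_sum using L2_Cauchy_Schwarz[OF assms] by simp
  then show ?thesis
    using L2_norm_nonneg[of f] L2_norm_nonneg[of g] power2_le_imp_le add_nonneg_nonneg by blast
qed

lemma L2_norm_minus_commute: "L2_norm (\<lambda>x. f x - g x) = L2_norm (\<lambda>x. g x - f x)"
  by (simp add: L2_norm_def norm_minus_commute)

lemma L2_triangle_diff:
  assumes "f \<in> L2" "g \<in> L2" "h \<in> L2"
  shows "L2_norm (\<lambda>x. f x - h x) \<le> L2_norm (\<lambda>x. f x - g x) + L2_norm (\<lambda>x. g x - h x)"
  using L2_triangle[OF L2_diff[OF assms(1,2)] L2_diff[OF assms(2,3)]] by simp

lemma L2_inner_tendsto:
  assumes f: "\<And>n. f n \<in> L2" "F \<in> L2" "(\<lambda>n. L2_norm (\<lambda>x. f n x - F x)) \<longlonglongrightarrow> 0"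
    and g: "\<And>n. g n \<in> L2" "G \<in> L2" "(\<lambda>n. L2_norm (\<lambda>x. g n x - G x)) \<longlonglongrightarrow> 0"
  shows "(\<lambda>n. L2_inner (f n) (g n)) \<longlonglongrightarrow> L2_inner F G"
proof -
  have b: "norm (L2_inner (f n) (g n) - L2_inner F G) \<le> L2_norm (\<lambda>x. f n x - F x) * (L2_norm (\<lambda>x. g n x - G x) + L2_norm G)
      + L2_norm F * L2_norm (\<lambda>x. g n x - G x)" for n
  proof -
    have "L2_inner (f n) (g n) - L2_inner F G = L2_inner (\<lambda>x. f n x - F x) (g n) + L2_inner (\<lambda>x. g n x - G x) F"
      using L2_inner_algebra(2)[OF f(1,2) g(1), of n n] L2_inner_algebra(2)[OF g(1,2) f(2), of n]
        L2_inner_algebra(4)[OF g(1) g(1) f(2), of n] L2_inner_algebra(4)[OF g(2) g(2) f(2)] by simp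
    moreover have "\<bar>L2_inner (\<lambda>x. f n x - F x) (g n)\<bar> \<le> L2_norm (\<lambda>x. f n x - F x) * L2_norm (g n)"
      by (intro L2_Cauchy_Schwarz L2_diff f g)
    moreover have "L2_norm (g n) \<le> L2_norm (\<lambda>x. g n x - G x) + L2_norm G"
      using L2_triangle[OF L2_diff[OF g(1,2)] g(2), of n] by simp
    then have "L2_norm (\<lambda>x. f n x - F x) * L2_norm (g n) \<le> L2_norm (\<lambda>x. f n x - F x) * (L2_norm (\<lambda>x. g n x - G x) + L2_norm G)"
      by (intro mult_left_mono L2_norm_nonneg)
    moreover have "\<bar>L2_inner (\<lambda>x. g n x - G x) F\<bar> \<le> L2_norm (\<lambda>x. g n x - G x) * L2_norm F"
      by (intro L2_Cauchy_Schwarz L2_diff f g)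
    ultimately show ?thesis by (simp add: mult.commute)
  qed
  have l: "(\<lambda>n. L2_norm (\<lambda>x. f n x - F x) * (L2_norm (\<lambda>x. g n x - G x) + L2_norm G)
      + L2_norm F * L2_norm (\<lambda>x. g n x - G x)) \<longlonglongrightarrow> 0 * (0 + L2_norm G) + L2_norm F * 0"
    by (intro tendsto_intros f g)
  have "(\<lambda>n. L2_inner (f n) (g n) - L2_inner F G) \<longlonglongrightarrow> 0"
    by (rule Lim_null_comparison[OF always_eventually[OF allI[OF b]]]) (use l in simp)
  then show ?thesis by (simp add: LIM_zero_iff)
qed

text \<open>The Riesz-Fischer argument: a subsequence with summable increments converges almost
  everywhere, and Fatou's lemma yields convergence in norm of the whole sequence. It is carried out
  for continuous fields so that the limit is Borel, as slicing in \<open>ei_x3_orthogonal\<close>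
  requires.\<close>

lemma L2_complete:
  fixes v :: "nat \<Rightarrow> real^3 \<Rightarrow> real^3"
  assumes c: "\<And>n. continuous_on UNIV (v n)"
    and cau: "\<And>e. e > 0 \<Longrightarrow> \<exists>N. \<forall>m\<ge>N. \<forall>n\<ge>N. L2_norm (\<lambda>x. v m x - v n x) < e"
  obtains u where "u \<in> borel_measurable borel" "u \<in> L2" "(\<lambda>n. L2_norm (\<lambda>x. v n x - u x)) \<longlonglongrightarrow> 0"
proof -
  interpret finite_measure LQ by (rule measure_Q3(3))
  have vL: "v n \<in> L2" for n by (intro continuous_in_L2 continuous_on_subset[OF c]) auto
  have [measurable]: "v n \<in> borel_measurable borel" for n by (rule borel_measurable_continuous_onI[OF c])
  have "\<exists>r :: nat \<Rightarrow> nat. strict_mono r \<and> (\<forall>k. \<forall>m\<ge>r k. \<forall>n\<ge>r k. L2_norm (\<lambda>x. v m x - v n x) < (1/2)^k)"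
  proof -
    have "\<exists>r. \<forall>k. (\<forall>m\<ge>r k. \<forall>n\<ge>r k. L2_norm (\<lambda>x. v m x - v n x) < (1/2)^k) \<and> r k < r (Suc k)"
    proof (rule dependent_nat_choice)
      show "\<exists>N. \<forall>m\<ge>N. \<forall>n\<ge>N. L2_norm (\<lambda>x. v m x - v n x) < (1/2)^0" by (rule cau) simp
      fix N k :: nat
      obtain N' where N': "\<forall>m\<ge>N'. \<forall>n\<ge>N'. L2_norm (\<lambda>x. v m x - v n x) < (1/2)^(Suc k)" using cau[of "(1/2)^(Suc k)"] by auto
      show "\<exists>y. (\<forall>m\<ge>y. \<forall>n\<ge>y. L2_norm (\<lambda>x. v m x - v n x) < (1/2)^(Suc k)) \<and> N < y"
        using N' by (intro exI[of _ "max N' (Suc N)"]) auto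
    qed
    then show ?thesis by (metis strict_mono_Suc_iff)
  qed
  then obtain r :: "nat \<Rightarrow> nat" where r: "strict_mono r" "\<And>k m n. m \<ge> r k \<Longrightarrow> n \<ge> r k \<Longrightarrow> L2_norm (\<lambda>x. v m x - v n x) < (1/2)^k"
    by blast
  define D where "D k x = norm (v (r (Suc k)) x - v (r k) x)" for k x
  have cD: "continuous_on UNIV (D k)" for k
    unfolding D_def by (intro continuous_intros c)
  have iD: "integrable LQ (D k)" for k
    by (intro integrable_LQ_continuous continuous_on_subset[OF cD]) auto
  have LD: "(LINT x|LQ. D k x) \<le> (1/2)^k" for k
  proof -
    \<comment> \<open>The scalar \<open>D k\<close> is placed along a unit vector so that
      Cauchy-Schwarz for fields bounds its integral by the L2 norm; the box has volume 1.\<close>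
    let ?e = "axis 1 1 :: real^3"
    have 1: "(\<lambda>x. D k x *\<^sub>R ?e) \<in> L2" "(\<lambda>x. ?e) \<in> L2"
      by (intro continuous_in_L2 continuous_intros continuous_on_subset[OF cD] subset_UNIV)+
    have "(LINT x|LQ. D k x) = L2_inner (\<lambda>x. D k x *\<^sub>R ?e) (\<lambda>x. ?e)"
      by (simp add: L2_inner_def inner_axis_axis)
    also have "\<dots> \<le> L2_norm (\<lambda>x. D k x *\<^sub>R ?e) * L2_norm (\<lambda>x. ?e)"
      using L2_Cauchy_Schwarz[OF 1] by linarith
    also have "L2_norm (\<lambda>x. ?e) = 1"
      using measure_Q3(2) by (simp add: L2_norm_def space_LQ)
    also have "L2_norm (\<lambda>x. D k x *\<^sub>R ?e) = L2_norm (\<lambda>x. v (r (Suc k)) x - v (r k) x)"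
      by (simp add: L2_norm_def D_def)
    also have "\<dots> \<le> (1/2)^k"
      using r(2)[of k "r (Suc k)" "r k"] strict_mono_less_eq[OF r(1), of k "Suc k"] by simp
    finally show ?thesis by simp
  qed
  have "(\<integral>\<^sup>+ x. (\<Sum>k. ennreal (D k x)) \<partial>LQ) = (\<Sum>k. \<integral>\<^sup>+ x. ennreal (D k x) \<partial>LQ)"
    using iD by (intro nn_integral_suminf) auto
  also have "\<dots> = (\<Sum>k. ennreal (LINT x|LQ. D k x))"
    by (intro suminf_cong nn_integral_eq_integral iD) (simp add: D_def)
  also have "\<dots> \<le> (\<Sum>k. ennreal ((1/2)^k))"
    using LD by (intro suminf_le ennreal_leI) auto
  also have "\<dots> < \<infinity>"
    by (simp add: ennreal_suminf_neq_top summable_geometric top.not_eq_extremum[symmetric])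
  finally have "AE x in LQ. (\<Sum>k. ennreal (D k x)) \<noteq> \<infinity>"
    using iD by (intro nn_integral_PInf_AE) auto
  then have "AE x in LQ. summable (\<lambda>k. D k x)"
    by eventually_elim (rule summable_suminf_not_top, auto simp: D_def)
  then have conv: "AE x in LQ. (\<lambda>k. v (r k) x) \<longlonglongrightarrow> lim (\<lambda>k. v (r k) x)"
  proof eventually_elim
    case (elim x)
    have "summable (\<lambda>k. v (r (Suc k)) x - v (r k) x)"
      by (rule summable_norm_cancel[OF elim[unfolded D_def]])
    then have "convergent (\<lambda>n. \<Sum>k<n. v (r (Suc k)) x - v (r k) x)"
      by (simp add: summable_iff_convergent)
    then have "convergent (\<lambda>n. v (r n) x - v (r 0) x)"
      by (simp add: sum_lessThan_telescope[of "\<lambda>k. v (r k) x"])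
    then have "convergent (\<lambda>n. (v (r n) x - v (r 0) x) + v (r 0) x)"
      by (intro convergent_add convergent_const)
    then show ?case by (simp add: convergent_LIMSEQ_iff)
  qed
  define u where "u x = lim (\<lambda>k. v (r k) x)" for x
  have um: "u \<in> borel_measurable borel"
    unfolding u_def by measurable
  have bnd: "(\<integral>\<^sup>+ x. ennreal ((norm (v n x - u x))\<^sup>2) \<partial>LQ) \<le> ennreal (((1/2)^k)\<^sup>2)" if "n \<ge> r k" for n k
  proof -
    have "(\<integral>\<^sup>+ x. ennreal ((norm (v n x - u x))\<^sup>2) \<partial>LQ) = (\<integral>\<^sup>+ x. liminf (\<lambda>j. ennreal ((norm (v n x - v (r j) x))\<^sup>2)) \<partial>LQ)"
    proof (rule nn_integral_cong_AE, use conv in eventually_elim)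
      case (elim x)
      have "(\<lambda>j. ennreal ((norm (v n x - v (r j) x))\<^sup>2)) \<longlonglongrightarrow> ennreal ((norm (v n x - u x))\<^sup>2)"
        unfolding u_def by (intro tendsto_intros elim)
      then show ?case by (rule lim_imp_Liminf[OF sequentially_bot, symmetric])
    qed
    also have "\<dots> \<le> liminf (\<lambda>j. \<integral>\<^sup>+ x. ennreal ((norm (v n x - v (r j) x))\<^sup>2) \<partial>LQ)"
      by (intro nn_integral_liminf) (auto intro!: borel_measurable_lebesgue_on)
    also have "\<dots> \<le> ennreal (((1/2)^k)\<^sup>2)"
    proof (rule order_trans[OF Liminf_le_Limsup Limsup_bounded])
      have "(\<integral>\<^sup>+ x. ennreal ((norm (v n x - v (r j) x))\<^sup>2) \<partial>LQ) \<le> ennreal (((1/2)^k)\<^sup>2)" if "j \<ge> k" for j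
      proof -
        have "L2_norm (\<lambda>x. v n x - v (r j) x) < (1/2)^k"
          using r(2) \<open>n \<ge> r k\<close> that strict_mono_less_eq[OF r(1)] by blast
        then have "(L2_norm (\<lambda>x. v n x - v (r j) x))\<^sup>2 \<le> ((1/2)^k)\<^sup>2"
          by (intro power_mono L2_norm_nonneg) auto
        then show ?thesis
          using L2D(2)[OF L2_diff[OF vL vL], of n "r j"] unfolding L2_norm_power2
          by (subst nn_integral_eq_integral) (auto intro: ennreal_leI)
      qed
      then show "eventually (\<lambda>j. (\<integral>\<^sup>+ x. ennreal ((norm (v n x - v (r j) x))\<^sup>2) \<partial>LQ) \<le> ennreal (((1/2)^k)\<^sup>2)) sequentially"
        by (auto simp: eventually_sequentially)
    qed simp
    finally show ?thesis .
  qed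
  have dL: "(\<lambda>x. v n x - u x) \<in> L2" if "n \<ge> r k" for n k
  proof -
    have m: "(\<lambda>x. v n x - u x) \<in> borel_measurable LQ"
      using um by (intro borel_measurable_lebesgue_on borel_measurable_diff) auto
    moreover have "integrable LQ (\<lambda>x. (norm (v n x - u x))\<^sup>2)"
    proof (rule integrableI_bounded)
      show "(\<integral>\<^sup>+ x. ennreal (norm ((norm (v n x - u x))\<^sup>2)) \<partial>LQ) < \<infinity>"
        using order.strict_trans1[OF bnd[OF that] ennreal_less_top] by simp
    qed (use m in simp)
    ultimately show ?thesis by (simp add: L2_fields_def)
  qed
  have uL: "u \<in> L2"
    using L2_diff[OF vL dL[OF order_refl], of "r 0" 0] by simp
  have small: "L2_norm (\<lambda>x. v n x - u x) \<le> (1/2)^k" if "n \<ge> r k" for n k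
  proof -
    have "ennreal ((L2_norm (\<lambda>x. v n x - u x))\<^sup>2) \<le> ennreal (((1/2)^k)\<^sup>2)"
      using bnd[OF that] L2D(2)[OF dL[OF that]] unfolding L2_norm_power2 by (subst (asm) nn_integral_eq_integral) auto
    then have "(L2_norm (\<lambda>x. v n x - u x))\<^sup>2 \<le> ((1/2)^k)\<^sup>2"
      by (subst (asm) ennreal_le_iff) auto
    then show ?thesis by (rule power2_le_imp_le) simp
  qed
  have "(\<lambda>n. L2_norm (\<lambda>x. v n x - u x)) \<longlonglongrightarrow> 0"
  proof (rule LIMSEQ_I)
    fix e :: real assume "e > 0"
    then obtain k where "(1/2)^k < e" using real_arch_pow_inv[of e "1/2"] by auto
    then have "norm (L2_norm (\<lambda>x. v n x - u x) - 0) < e" if "n \<ge> r k" for n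
      using small[OF that] by (simp add: abs_of_nonneg[OF L2_norm_nonneg])
    then show "\<exists>N. \<forall>n\<ge>N. norm (L2_norm (\<lambda>x. v n x - u x) - 0) < e" by blast
  qed
  with um uL show thesis by (rule that)
qed

lemma L2_dominated_tendsto:
  fixes f :: "nat \<Rightarrow> real^3 \<Rightarrow> real^3"
  assumes "\<And>n. f n \<in> borel_measurable LQ" "g \<in> L2"
    and "\<And>n x. x \<in> Q3 \<Longrightarrow> norm (f n x) \<le> norm (g x)" "AE x in LQ. (\<lambda>n. f n x) \<longlonglongrightarrow> 0"
  shows "(\<lambda>n. L2_norm (f n)) \<longlonglongrightarrow> 0"
proof -
  have "(\<lambda>n. LINT x|LQ. (norm (f n x))\<^sup>2) \<longlonglongrightarrow> (LINT x|LQ. (0 :: real))"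
  proof (rule integral_dominated_convergence[where w = "\<lambda>x. (norm (g x))\<^sup>2"])
    show "AE x in LQ. (\<lambda>n. (norm (f n x))\<^sup>2) \<longlonglongrightarrow> 0"
      using assms(4) by eventually_elim (auto intro!: tendsto_eq_intros)
    show "AE x in LQ. norm ((norm (f n x))\<^sup>2) \<le> (norm (g x))\<^sup>2" for n
      using assms(3) by (intro AE_I2) (simp add: space_LQ power_mono)
  qed (use assms L2D in auto)
  then have "(\<lambda>n. sqrt (LINT x|LQ. (norm (f n x))\<^sup>2)) \<longlonglongrightarrow> sqrt 0"
    by (intro tendsto_real_sqrt) simp
  then show ?thesis by (simp add: L2_norm_def)
qed

section \<open>Density of Lipschitz fields\<close>

lemma real_polynomial_function_Lipschitz_on_box:
  assumes "real_polynomial_function (f :: real^3 \<Rightarrow> real)"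
  shows "\<exists>L\<ge>0. \<forall>x\<in>Q3. \<forall>y\<in>Q3. \<bar>f x - f y\<bar> \<le> L * dist x y"
  using assms
proof (induction f)
  case (linear f)
  then obtain K where K: "\<And>x. norm (f x) \<le> norm x * K" "K \<ge> 0"
    using bounded_linear.nonneg_bounded by blast
  have "\<bar>f x - f y\<bar> \<le> K * dist x y" for x y
    using K(1)[of "x - y"] linear_diff[OF bounded_linear.linear[OF linear], of x y] by (simp add: dist_norm mult.commute)
  then show ?case using K(2) by blast
next
  case (const c)
  then show ?case by (intro exI[of _ 0]) auto
next
  case (add f g)
  then obtain L L' where "L \<ge> 0" "L' \<ge> 0" and *: "\<forall>x\<in>Q3. \<forall>y\<in>Q3. \<bar>f x - f y\<bar> \<le> L * dist x y"
    "\<forall>x\<in>Q3. \<forall>y\<in>Q3. \<bar>g x - g y\<bar> \<le> L' * dist x y" by blast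
  have "\<bar>f x + g x - (f y + g y)\<bar> \<le> (L + L') * dist x y" if "x \<in> Q3" "y \<in> Q3" for x y
  proof -
    have "\<bar>f x - f y\<bar> \<le> L * dist x y" "\<bar>g x - g y\<bar> \<le> L' * dist x y" using * that by blast+
    then show ?thesis unfolding distrib_right by linarith
  qed
  then show ?case using \<open>L \<ge> 0\<close> \<open>L' \<ge> 0\<close> by (intro exI[of _ "L + L'"]) auto
next
  case (mult f g)
  then obtain L L' where L: "L \<ge> 0" "L' \<ge> 0" and *: "\<forall>x\<in>Q3. \<forall>y\<in>Q3. \<bar>f x - f y\<bar> \<le> L * dist x y"
    "\<forall>x\<in>Q3. \<forall>y\<in>Q3. \<bar>g x - g y\<bar> \<le> L' * dist x y" by blast
  have "\<exists>B. \<forall>x\<in>Q3. \<bar>h x\<bar> \<le> B" if "real_polynomial_function h" for h :: "real^3 \<Rightarrow> real"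
  proof -
    have "bounded (h ` Q3)"
      by (intro compact_imp_bounded compact_continuous_image continuous_on_polymonial_function)
        (use that in \<open>auto simp: real_polynomial_function_eq\<close>)
    then show ?thesis by (auto simp: bounded_iff)
  qed
  then obtain B B' where B: "\<forall>x\<in>Q3. \<bar>f x\<bar> \<le> B" "\<forall>x\<in>Q3. \<bar>g x\<bar> \<le> B'" using mult.hyps by meson
  have "\<bar>f x * g x - f y * g y\<bar> \<le> (\<bar>B\<bar> * L' + \<bar>B'\<bar> * L) * dist x y" if "x \<in> Q3" "y \<in> Q3" for x y
  proof -
    have "f x * g x - f y * g y = f x * (g x - g y) + g y * (f x - f y)" by (simp add: algebra_simps)
    moreover have "\<bar>f x\<bar> * \<bar>g x - g y\<bar> \<le> \<bar>B\<bar> * (L' * dist x y)"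
      using B(1) *(2) that by (intro mult_mono) (auto intro: order_trans)
    moreover have "\<bar>g y\<bar> * \<bar>f x - f y\<bar> \<le> \<bar>B'\<bar> * (L * dist x y)"
      using B(2) *(1) that by (intro mult_mono) (auto intro: order_trans)
    moreover have "(\<bar>B\<bar> * L' + \<bar>B'\<bar> * L) * dist x y = \<bar>B\<bar> * (L' * dist x y) + \<bar>B'\<bar> * (L * dist x y)"
      by (simp add: algebra_simps)
    ultimately show ?thesis
      using abs_triangle_ineq[of "f x * (g x - g y)" "g y * (f x - f y)"] unfolding abs_mult by linarith
  qed
  then show ?case using L by (intro exI[of _ "\<bar>B\<bar> * L' + \<bar>B'\<bar> * L"]) auto
qed

definition lip :: "real \<Rightarrow> (real^3 \<Rightarrow> real^3) \<Rightarrow> bool" where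
  "lip L g \<longleftrightarrow> L \<ge> 0 \<and> continuous_on Q3 g \<and> (\<forall>x\<in>Q3. \<forall>y\<in>Q3. norm (g x - g y) \<le> L * dist x y)"

text \<open>Truncate \<open>g\<close> by the nearest-point map of a ball, approximate by truncated
  continuous fields using dominated convergence, and approximate one of these uniformly by a
  polynomial, which is Lipschitz on the box. Lipschitz fields are the time-independent test fields
  of \<open>near_step\<close>.\<close>

lemma L2_Lipschitz_dense:
  assumes g: "g \<in> L2" and e: "e > 0"
  obtains h L where "lip L h" "L2_norm (\<lambda>x. g x - h x) < e"
proof -
  interpret finite_measure LQ by (rule measure_Q3(3))
  let ?T = "\<lambda>R. closest_point (cball (0 :: real^3) R)"
  have cT: "continuous_on S (?T R)" if "R \<ge> 0" for R S
    using that by (intro continuous_on_closest_point) auto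
  have nT: "norm (?T R x) \<le> R" if "R \<ge> 0" for R x
    using closest_point_in_set[of "cball (0 :: real^3) R" x] that by auto
  have mT: "?T R \<in> borel_measurable borel" if "R \<ge> 0" for R
    by (rule borel_measurable_continuous_onI[OF cT[OF that]])
  have gm: "g \<in> borel_measurable LQ" by (rule L2D(1)[OF g])
  have mTg: "(\<lambda>x. ?T R (g x)) \<in> borel_measurable LQ" if "R \<ge> 0" for R
    using measurable_compose[OF gm mT[OF that]] .
  have "(\<lambda>n. L2_norm (\<lambda>x. g x - ?T (real n) (g x))) \<longlonglongrightarrow> 0"
  proof (rule L2_dominated_tendsto[OF _ g])
    show "norm (g x - ?T (real n) (g x)) \<le> norm (g x)" for n x
      using closest_point_le[of "cball (0 :: real^3) (real n)" 0 "g x"] by (simp add: dist_norm)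
    show "AE x in LQ. (\<lambda>n. g x - ?T (real n) (g x)) \<longlonglongrightarrow> 0"
    proof (intro AE_I2 tendsto_eventually)
      fix x
      obtain N :: nat where N: "norm (g x) \<le> real N" using real_arch_simple by blast
      show "eventually (\<lambda>n. g x - ?T (real n) (g x) = 0) sequentially"
        using N by (intro eventually_sequentiallyI[of N]) (simp add: closest_point_self)
    qed
  qed (use gm mTg in auto)
  then obtain n where n: "L2_norm (\<lambda>x. g x - ?T (real n) (g x)) < e / 3"
    using order_tendstoD(2)[of _ 0 sequentially "e / 3"] e by (auto simp: eventually_sequentially)
  define R where "R = real n"
  have R: "R \<ge> 0" by (simp add: R_def)
  have "g measurable_on Q3"
    using gm by (subst measurable_on_iff_borel_measurable) auto
  then obtain N c where N: "negligible N" and c: "\<And>k. continuous_on UNIV (c k)"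
    and lim: "\<And>x. x \<notin> N \<Longrightarrow> (\<lambda>k. c k x) \<longlonglongrightarrow> (if x \<in> Q3 then g x else 0)"
    unfolding measurable_on_def by blast
  have AEN: "AE x in LQ. x \<notin> N"
  proof -
    have "AE x in lebesgue. x \<notin> N" using N unfolding negligible_iff_null_sets by (rule AE_not_in)
    then show ?thesis by (subst AE_restrict_space_iff) (auto elim: eventually_mono)
  qed
  have cTc: "continuous_on S (\<lambda>x. ?T R (c k x))" for S k
    by (rule continuous_on_compose2[OF cT[OF R]]) (auto intro: continuous_on_subset[OF c])
  have "(\<lambda>k. L2_norm (\<lambda>x. ?T R (g x) - ?T R (c k x))) \<longlonglongrightarrow> 0"
  proof (rule L2_dominated_tendsto[where g = "\<lambda>x. (2 * R) *\<^sub>R (axis 1 1 :: real^3)"])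
    show "(\<lambda>x. (2 * R) *\<^sub>R (axis 1 1 :: real^3)) \<in> L2" by (intro continuous_in_L2 continuous_on_const)
    show "norm (?T R (g x) - ?T R (c k x)) \<le> norm ((2 * R) *\<^sub>R (axis 1 1 :: real^3))" for k x
      using norm_triangle_ineq4[of "?T R (g x)" "?T R (c k x)"] nT[OF R, of "g x"] nT[OF R, of "c k x"] R
      by (simp add: norm_axis_1)
    show "(\<lambda>x. ?T R (g x) - ?T R (c k x)) \<in> borel_measurable LQ" for k
      using mTg[OF R] borel_measurable_lebesgue_on[OF borel_measurable_continuous_onI[OF cTc]] by simp
    show "AE x in LQ. (\<lambda>k. ?T R (g x) - ?T R (c k x)) \<longlonglongrightarrow> 0"
      using AEN AE_space
    proof eventually_elim
      case (elim x)
      then have "(\<lambda>k. c k x) \<longlonglongrightarrow> g x" using lim[of x] by (simp add: space_LQ)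
      moreover have "isCont (?T R) (g x)"
        using cT[OF R, of UNIV] by (simp add: continuous_on_eq_continuous_at)
      ultimately have "(\<lambda>k. ?T R (c k x)) \<longlonglongrightarrow> ?T R (g x)" by (rule isCont_tendsto_compose[rotated])
      then show ?case using tendsto_diff[OF tendsto_const, of "\<lambda>k. ?T R (c k x)" "?T R (g x)" sequentially "?T R (g x)"] by simp
    qed
  qed
  then obtain k where k: "L2_norm (\<lambda>x. ?T R (g x) - ?T R (c k x)) < e / 3"
    using order_tendstoD(2)[of _ 0 sequentially "e / 3"] e by (auto simp: eventually_sequentially)
  obtain h where h: "polynomial_function h" "\<And>x. x \<in> Q3 \<Longrightarrow> norm (?T R (c k x) - h x) < e / 4"
    using Stone_Weierstrass_polynomial_function[OF compact_cbox[of "0 :: real^3" 1] cTc[of Q3 k], of "e / 4"] e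
    by (meson divide_pos_pos zero_less_numeral)
  have ch: "continuous_on S h" for S using h(1) by (rule continuous_on_polymonial_function)
  have "\<exists>L\<ge>0. \<forall>x\<in>Q3. \<forall>y\<in>Q3. \<bar>h x $ i - h y $ i\<bar> \<le> L * dist x y" for i
  proof -
    have "real_polynomial_function ((\<lambda>z. z $ i) \<circ> h)"
      using h(1) unfolding polynomial_function_def by (blast intro: bounded_linear_vec_nth)
    from real_polynomial_function_Lipschitz_on_box[OF this] show ?thesis by simp
  qed
  then obtain l where l: "\<And>i. l i \<ge> 0" "\<And>i x y. x \<in> Q3 \<Longrightarrow> y \<in> Q3 \<Longrightarrow> \<bar>h x $ i - h y $ i\<bar> \<le> l i * dist x y"
    by metis
  have "lip (sum l UNIV) h"
    unfolding lip_def
  proof (intro conjI ch ballI)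
    fix x y assume xy: "x \<in> Q3" "y \<in> Q3"
    have "norm (h x - h y) \<le> (\<Sum>i\<in>UNIV. \<bar>(h x - h y) $ i\<bar>)" by (rule norm_le_l1_cart)
    also have "\<dots> \<le> (\<Sum>i\<in>UNIV. l i * dist x y)" using l(2)[OF xy] by (intro sum_mono) simp
    finally show "norm (h x - h y) \<le> sum l UNIV * dist x y" by (simp add: sum_distrib_right)
  qed (use l(1) in \<open>simp add: sum_nonneg\<close>)
  moreover have "L2_norm (\<lambda>x. g x - h x) < e"
  proof -
    have L: "(\<lambda>x. ?T R (g x)) \<in> L2"
    proof (rule L2_dominated(1)[where K = 1 and g = "\<lambda>x. R *\<^sub>R (axis 1 1 :: real^3)"])
      show "(\<lambda>x. R *\<^sub>R (axis 1 1 :: real^3)) \<in> L2" by (intro continuous_in_L2 continuous_on_const)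
    qed (use mTg[OF R] nT[OF R] R in \<open>auto simp: norm_axis_1\<close>)
    have L': "(\<lambda>x. ?T R (c k x)) \<in> L2" "h \<in> L2" by (intro continuous_in_L2 cTc ch)+
    have "L2_norm (\<lambda>x. ?T R (c k x) - h x) \<le> 1 * L2_norm (\<lambda>x. (e / 4) *\<^sub>R (axis 1 1 :: real^3))"
    proof (rule L2_dominated(2)[where K = 1 and g = "\<lambda>x. (e / 4) *\<^sub>R (axis 1 1 :: real^3)"])
      show "(\<lambda>x. (e / 4) *\<^sub>R (axis 1 1 :: real^3)) \<in> L2" by (intro continuous_in_L2 continuous_on_const)
      show "(\<lambda>x. ?T R (c k x) - h x) \<in> borel_measurable LQ" by (intro L2D L2_diff L')
    qed (use h(2) e in \<open>auto simp: norm_axis_1 intro: less_imp_le\<close>)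
    also have "\<dots> = e / 4" using e measure_Q3(2) by (simp add: L2_norm_def norm_axis_1 space_LQ)
    finally show ?thesis
      using n k L2_triangle_diff[OF g L L'(2)] L2_triangle_diff[OF L L'] e unfolding R_def by linarith
  qed
  ultimately show thesis by (rule that)
qed

section \<open>The iteration and its limit\<close>

definition adm :: "(real \<times> (real^3) \<Rightarrow> real^3) \<Rightarrow> bool" where
  "adm g \<longleftrightarrow> continuous_on UNIV g \<and> uniformly_continuous_on cyl g"

lemma adm_subsol: "subsol \<rho> U v M \<Longrightarrow> adm v"
  using subsolD unfolding adm_def by blast

lemma continuous_slice: "continuous_on UNIV f \<Longrightarrow> continuous_on S (\<lambda>x. f (t, x))"
  by (rule continuous_on_compose2[of UNIV f S "\<lambda>x. (t, x)"]) (auto intro!: continuous_intros)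

lemma adm_L2: "adm g \<Longrightarrow> (\<lambda>x. g (t, x)) \<in> L2"
  unfolding adm_def by (blast intro: continuous_in_L2 continuous_slice)

text \<open>Two smallness conditions with different uses. Pairings with the fields in
  \<open>G\<close> at the same time give almost orthogonality and control of the probe. Pairings
  with all Lipschitz fields, scaled by the Lipschitz constant, give weak continuity of the limit in
  time.\<close>

definition near_step where
  "near_step \<epsilon> G v v' \<longleftrightarrow>
     (\<forall>t\<ge>0. \<forall>g\<in>G. \<bar>L2_inner (\<lambda>x. v' (t, x) - v (t, x)) (\<lambda>x. g (t, x))\<bar> \<le> \<epsilon>) \<and>
     (\<forall>t L h. lip L h \<longrightarrow> \<bar>L2_inner (\<lambda>x. v' (t, x) - v (t, x)) h\<bar> \<le> L * \<epsilon>)"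

lemma refined_step:
  assumes sub: "subsol \<rho> U v M" and G: "finite G" "\<And>g. g \<in> G \<Longrightarrow> adm g" and \<epsilon>: "\<epsilon> > 0"
  shows "\<exists>v' M'. subsol \<rho> U v' M' \<and> near_step \<epsilon> G v v' \<and>
     (\<forall>t. (LINT x|LQ. trace (M' (t, x))) \<le> (LINT x|LQ. trace (M (t, x))) + \<epsilon>) \<and>
     Jfun \<rho> v' M' \<le> (1 - 1 / 800000) * Jfun \<rho> v M"
proof -
  obtain C where C: "C > 0" and st: "\<And>d. d > 0 \<Longrightarrow> \<exists>v' M'. subsol \<rho> U v' M' \<and>
     (\<forall>t g e. continuous_on Q3 g \<longrightarrow> 0 \<le> e \<longrightarrow> (\<forall>x\<in>Q3. \<forall>x'\<in>Q3. dist x x' < d \<longrightarrow> norm (g x - g x') \<le> e)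
        \<longrightarrow> \<bar>LINT x|LQ. (v' (t, x) - v (t, x)) \<bullet> g x\<bar> \<le> C * e) \<and>
     (\<forall>t. (LINT x|LQ. trace (M' (t, x))) \<le> (LINT x|LQ. trace (M (t, x))) + d) \<and>
     Jfun \<rho> v' M' \<le> (1 - 1 / 800000) * Jfun \<rho> v M"
    using improvement_step[OF sub] by blast
  have "\<exists>d>0. \<forall>t\<ge>0. \<forall>x\<in>Q3. \<forall>x'\<in>Q3. dist x x' < d \<longrightarrow> norm (g (t, x) - g (t, x')) \<le> \<epsilon> / C" if gG: "g \<in> G" for g
  proof -
    have "\<epsilon> / C > 0" using \<epsilon> C by simp
    then obtain d where d: "d > 0" "\<And>y y'. y \<in> cyl \<Longrightarrow> y' \<in> cyl \<Longrightarrow> dist y' y < d \<Longrightarrow> dist (g y') (g y) < \<epsilon> / C"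
      using G(2)[OF gG] unfolding adm_def uniformly_continuous_on_def by metis
    have "norm (g (t, x) - g (t, x')) \<le> \<epsilon> / C" if "t \<ge> 0" "x \<in> Q3" "x' \<in> Q3" "dist x x' < d" for t x x'
      using d(2)[of "(t, x')" "(t, x)"] that by (simp add: dist_Pair_Pair dist_norm)
    then show ?thesis using d(1) by blast
  qed
  then obtain D where D: "\<And>g. g \<in> G \<Longrightarrow> D g > 0"
    "\<And>g t x x'. g \<in> G \<Longrightarrow> t \<ge> 0 \<Longrightarrow> x \<in> Q3 \<Longrightarrow> x' \<in> Q3 \<Longrightarrow> dist x x' < D g \<Longrightarrow> norm (g (t, x) - g (t, x')) \<le> \<epsilon> / C"
    by metis
  \<comment> \<open>The entries serve, in order: the growth of the mean trace, the Lipschitz fields,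
    and the uniform moduli of continuity of the fields in \<open>G\<close>.\<close>
  define d where "d = Min ({\<epsilon>, \<epsilon> / C} \<union> D ` G)"
  have fin: "finite ({\<epsilon>, \<epsilon> / C} \<union> D ` G)" using G(1) by simp
  have d: "d > 0" "d \<le> \<epsilon>" "d \<le> \<epsilon> / C" "\<And>g. g \<in> G \<Longrightarrow> d \<le> D g"
  proof -
    show "d > 0" unfolding d_def using fin \<epsilon> C D(1) by (subst Min_gr_iff) auto
    show "d \<le> \<epsilon>" "d \<le> \<epsilon> / C" "\<And>g. g \<in> G \<Longrightarrow> d \<le> D g"
      unfolding d_def by (rule Min_le[OF fin], simp)+
  qed
  obtain v' M' where s: "subsol \<rho> U v' M'"
    and o: "\<forall>t g e. continuous_on Q3 g \<longrightarrow> 0 \<le> e \<longrightarrow> (\<forall>x\<in>Q3. \<forall>x'\<in>Q3. dist x x' < d \<longrightarrow> norm (g x - g x') \<le> e)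
        \<longrightarrow> \<bar>LINT x|LQ. (v' (t, x) - v (t, x)) \<bullet> g x\<bar> \<le> C * e"
    and tr: "\<forall>t. (LINT x|LQ. trace (M' (t, x))) \<le> (LINT x|LQ. trace (M (t, x))) + d"
    and J: "Jfun \<rho> v' M' \<le> (1 - 1 / 800000) * Jfun \<rho> v M"
    using st[OF d(1)] by blast
  have "\<bar>L2_inner (\<lambda>x. v' (t, x) - v (t, x)) (\<lambda>x. g (t, x))\<bar> \<le> \<epsilon>" if "t \<ge> 0" "g \<in> G" for t g
  proof -
    have "continuous_on Q3 (\<lambda>x. g (t, x))"
      using G(2)[OF that(2)] unfolding adm_def by (blast intro: continuous_slice)
    then have "\<bar>LINT x|LQ. (v' (t, x) - v (t, x)) \<bullet> g (t, x)\<bar> \<le> C * (\<epsilon> / C)"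
      using D(2)[OF that(2,1)] d(4)[OF that(2)] \<epsilon> C by (intro o[rule_format]) auto
    then show ?thesis using C by (simp add: L2_inner_def)
  qed
  moreover have "\<bar>L2_inner (\<lambda>x. v' (t, x) - v (t, x)) h\<bar> \<le> L * \<epsilon>" if "lip L h" for t L h
  proof -
    have "norm (h x - h x') \<le> L * d" if "x \<in> Q3" "x' \<in> Q3" "dist x x' < d" for x x'
      using \<open>lip L h\<close> that mult_left_mono[of "dist x x'" d L] unfolding lip_def by force
    then have "\<bar>LINT x|LQ. (v' (t, x) - v (t, x)) \<bullet> h x\<bar> \<le> C * (L * d)"
      using that d(1) by (intro o[rule_format]) (auto simp: lip_def)
    also have "\<dots> \<le> L * \<epsilon>"
      using d(3) C that mult_left_mono[of "C * d" \<epsilon> L] by (simp add: lip_def field_simps)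
    finally show ?thesis by (simp add: L2_inner_def)
  qed
  moreover have "(LINT x|LQ. trace (M' (t, x))) \<le> (LINT x|LQ. trace (M (t, x))) + \<epsilon>" for t
    using tr[rule_format, of t] d(2) by linarith
  ultimately show ?thesis using s J unfolding near_step_def by blast
qed

lemma approximating_sequence:
  assumes sub: "subsol \<rho> U v0 M0" and g0: "adm g0" and \<epsilon>: "\<epsilon> > 0"
  obtains v M where "v 0 = v0" "M 0 = M0" "\<And>k. subsol \<rho> U (v k) (M k)"
    "\<And>k. near_step (\<epsilon> * (1/2)^(Suc k)) (insert g0 (v ` {..k})) (v k) (v (Suc k))"
    "\<And>k t. (LINT x|LQ. trace (M (Suc k) (t, x))) \<le> (LINT x|LQ. trace (M k (t, x))) + \<epsilon> * (1/2)^(Suc k)"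
    "\<And>k. Jfun \<rho> (v (Suc k)) (M (Suc k)) \<le> (1 - 1 / 800000) * Jfun \<rho> (v k) (M k)"
proof -
  \<comment> \<open>Dependent choice sees only the last state, so the state itself carries the
    finite set \<open>G\<close> of all fields produced so far together with
    \<open>g0\<close>.\<close>
  define P where "P k s = (case s of (v, M, G) \<Rightarrow> subsol \<rho> U v M \<and> finite G \<and> (\<forall>g\<in>G. adm g) \<and> g0 \<in> G \<and> v \<in> G \<and> (k = 0 \<longrightarrow> v = v0 \<and> M = M0))"
    for k :: nat and s
  define Q where "Q k s s' = (case s of (v, M, G) \<Rightarrow> case s' of (v', M', G') \<Rightarrow> near_step (\<epsilon> * (1/2)^(Suc k)) G v v' \<and>
      (\<forall>t. (LINT x|LQ. trace (M' (t, x))) \<le> (LINT x|LQ. trace (M (t, x))) + \<epsilon> * (1/2)^(Suc k)) \<and>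
     Jfun \<rho> v' M' \<le> (1 - 1 / 800000) * Jfun \<rho> v M \<and> G' = insert v' G)" for k :: nat and s s'
  have "\<exists>s. \<forall>k. P k (s k) \<and> Q k (s k) (s (Suc k))"
  proof (rule dependent_nat_choice)
    have "P 0 (v0, M0, {g0, v0})" using sub g0 adm_subsol[OF sub] by (simp add: P_def)
    then show "\<exists>s. P 0 s" by blast
    fix s k assume Ps: "P k s"
    obtain v M G where s: "s = (v, M, G)" by (cases s)
    have 1: "subsol \<rho> U v M" "finite G" "\<And>g. g \<in> G \<Longrightarrow> adm g" "g0 \<in> G" using Ps by (auto simp: P_def s)
    have "\<epsilon> * (1/2)^(Suc k) > 0" using \<epsilon> by simp
    from refined_step[OF 1(1-3) this] obtain v' M' where
      2: "subsol \<rho> U v' M'" "near_step (\<epsilon> * (1/2)^(Suc k)) G v v'"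
      "\<forall>t. (LINT x|LQ. trace (M' (t, x))) \<le> (LINT x|LQ. trace (M (t, x))) + \<epsilon> * (1/2)^(Suc k)"
      "Jfun \<rho> v' M' \<le> (1 - 1 / 800000) * Jfun \<rho> v M" by blast
    have "P (Suc k) (v', M', insert v' G)" "Q k s (v', M', insert v' G)"
      using 1 2 adm_subsol[OF 2(1)] by (simp_all add: P_def Q_def s)
    then show "\<exists>s'. P (Suc k) s' \<and> Q k s s'" by blast
  qed
  then obtain s where s: "\<And>k. P k (s k)" "\<And>k. Q k (s k) (s (Suc k))" by blast
  define v where "v k = fst (s k)" for k
  define M where "M k = fst (snd (s k))" for k
  define G where "G k = snd (snd (s k))" for k
  have sk: "s k = (v k, M k, G k)" for k by (simp add: v_def M_def G_def)
  have P: "subsol \<rho> U (v k) (M k)" "g0 \<in> G k" "v k \<in> G k" "k = 0 \<Longrightarrow> v k = v0 \<and> M k = M0" for k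
    using s(1)[of k] by (auto simp: P_def sk)
  have Q: "near_step (\<epsilon> * (1/2)^(Suc k)) (G k) (v k) (v (Suc k))"
    "(LINT x|LQ. trace (M (Suc k) (t, x))) \<le> (LINT x|LQ. trace (M k (t, x))) + \<epsilon> * (1/2)^(Suc k)"
    "Jfun \<rho> (v (Suc k)) (M (Suc k)) \<le> (1 - 1 / 800000) * Jfun \<rho> (v k) (M k)" "G (Suc k) = insert (v (Suc k)) (G k)" for k t
    using s(2)[of k] by (auto simp: Q_def sk)
  have sub: "insert g0 (v ` {..k}) \<subseteq> G k" for k
  proof (induction k)
    case 0
    then show ?case using P(2,3)[of 0] by simp
  next
    case (Suc k)
    then show ?case using Q(4)[of k] by (auto simp: atMost_Suc)
  qed
  have "near_step (\<epsilon> * (1/2)^(Suc k)) (insert g0 (v ` {..k})) (v k) (v (Suc k))" for k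
    using Q(1)[of k] sub[of k] unfolding near_step_def by blast
  then show thesis using P Q by (intro that[of v M]) auto
qed

lemma telescoping_bound:
  fixes a :: "nat \<Rightarrow> real"
  assumes "\<And>k. n \<le> k \<Longrightarrow> \<bar>a (Suc k) - a k\<bar> \<le> c * (1/2)^(Suc k)" "n \<le> m" "0 \<le> c"
  shows "\<bar>a m - a n\<bar> \<le> c * (1/2)^n"
proof -
  have "\<bar>a (n + j) - a n\<bar> \<le> c * (1/2)^n - c * (1/2)^(n + j)" for j
  proof (induction j)
    case (Suc j)
    have "c * (1/2)^(n + j) = c * (1/2)^(Suc (n + j)) + c * (1/2)^(Suc (n + j))" by simp
    then show ?case using Suc assms(1)[of "n + j"] by (simp only: add_Suc_right) linarith
  qed simp
  from this[of "m - n"] have "\<bar>a m - a n\<bar> \<le> c * (1/2)^n - c * (1/2)^m" using assms(2) by simp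
  moreover have "0 \<le> c * (1/2)^m" using assms(3) by simp
  ultimately show ?thesis by linarith
qed

lemma continuous_on_uniform_approx:
  fixes F :: "'a::metric_space \<Rightarrow> real"
  assumes "\<And>e. e > 0 \<Longrightarrow> \<exists>f. continuous_on S f \<and> (\<forall>t\<in>S. \<bar>F t - f t\<bar> < e)"
  shows "continuous_on S F"
  unfolding continuous_on_iff
proof (intro ballI allI impI)
  fix x and e :: real assume x: "x \<in> S" and e: "e > 0"
  obtain f where f: "continuous_on S f" "\<And>t. t \<in> S \<Longrightarrow> \<bar>F t - f t\<bar> < e / 3"
    using assms[of "e / 3"] e by auto
  obtain d where d: "d > 0" "\<And>x'. x' \<in> S \<Longrightarrow> dist x' x < d \<Longrightarrow> dist (f x') (f x) < e / 3"
    using f(1) x e unfolding continuous_on_iff by (metis divide_pos_pos zero_less_numeral)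
  have "dist (F x') (F x) < e" if "x' \<in> S" "dist x' x < d" for x'
    using d(2)[OF that] f(2)[OF x] f(2)[OF that(1)] unfolding dist_real_def by linarith
  then show "\<exists>d>0. \<forall>x'\<in>S. dist x' x < d \<longrightarrow> dist (F x') (F x) < e" using d(1) by blast
qed

section \<open>Control of the weak equation by the weighted defect\<close>

lemma trace_bound_entries:
  fixes A :: "real^3^3"
  assumes sym: "\<And>i j. A $ i $ j = A $ j $ i" and pos: "\<And>z. z \<noteq> 0 \<Longrightarrow> qf A z > 0"
  shows "\<bar>A $ i $ j\<bar> \<le> trace A"
proof -
  have d: "0 < A $ k $ k" for k using pos[of "axis k 1"] by (simp add: qf_axis axis_eq_0_iff)
  have tr: "A $ k $ k \<le> trace A" for k
    unfolding trace_def using d by (intro member_le_sum) (auto intro: less_imp_le)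
  have nn: "0 \<le> qf A z" for z using less_imp_le[OF pos[of z]] by (cases "z = 0") (auto simp: qf_def)
  \<comment> \<open>Nonnegativity for s = 1 and s = -1 bounds twice the absolute value of the entry
    by the sum of two diagonal entries.\<close>
  have "qf A (axis i 1 + s *\<^sub>R axis j 1) = A $ i $ i + 2 * s * A $ i $ j + s\<^sup>2 * A $ j $ j" for s
    using sym[of j i]
    by (simp add: qf_def matrix_vector_right_distrib matrix_vector_mult_scaleR inner_add_left inner_add_right inner_axis'
        matrix_vector_mul_component inner_axis power2_eq_square algebra_simps)
  from this[of 1] this[of "-1"] have "2 * \<bar>A $ i $ j\<bar> \<le> A $ i $ i + A $ j $ j"
    using nn[of "axis i 1 + 1 *\<^sub>R axis j 1"] nn[of "axis i 1 + (-1) *\<^sub>R axis j 1"] by (simp add: abs_if)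
  then show ?thesis using tr[of i] tr[of j] by linarith
qed

lemma test_field_bounds:
  assumes "test_field \<phi>"
  obtains D T where "D \<ge> 0"
    "\<And>t x. t \<ge> 0 \<Longrightarrow> x \<in> Q3 \<Longrightarrow> norm (vector_derivative (\<lambda>s. \<phi> s x) (at t within {0..})) \<le> D"
    "\<And>t x j. t \<ge> 0 \<Longrightarrow> x \<in> Q3 \<Longrightarrow> norm (partial j (\<phi> t) x) \<le> D"
    "\<And>t x. t > T \<Longrightarrow> t \<ge> 0 \<Longrightarrow> vector_derivative (\<lambda>s. \<phi> s x) (at t within {0..}) = 0"
    "\<And>t x j. t > T \<Longrightarrow> t \<ge> 0 \<Longrightarrow> partial j (\<phi> t) x = 0"
    "\<And>t. t \<ge> 0 \<Longrightarrow> continuous_on Q3 (\<lambda>x. vector_derivative (\<lambda>s. \<phi> s x) (at t within {0..}))"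
    "\<And>t j. t \<ge> 0 \<Longrightarrow> continuous_on Q3 (\<lambda>x. partial j (\<phi> t) x)"
proof -
  obtain \<Phi>' T where "test_derivative \<phi> \<Phi>' T"
    using test_field_derivative[OF assms] .
  note \<Phi> = test_derivativeD[OF this]
  have b: "\<exists>B\<ge>0. \<forall>t\<ge>0. \<forall>x\<in>Q3. norm (\<Phi>' (t, x) d) \<le> B" for d
  proof -
    have "compact ({0..T} \<times> Q3)" by (intro compact_Times) auto
    then have "bounded ((\<lambda>y. \<Phi>' y d) ` ({0..T} \<times> Q3))"
      by (intro compact_imp_bounded compact_continuous_image continuous_on_subset[OF \<Phi>(2)]) auto
    then obtain B where B: "\<forall>y\<in>{0..T} \<times> Q3. norm (\<Phi>' y d) \<le> B" by (auto simp: bounded_iff)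
    have "norm (\<Phi>' (t, x) d) \<le> \<bar>B\<bar>" if "t \<ge> 0" "x \<in> Q3" for t x
    proof (cases "t \<le> T")
      case True
      then have "norm (\<Phi>' (t, x) d) \<le> B" using B that by simp
      then show ?thesis by linarith
    next
      case False
      then show ?thesis using \<Phi>(7)[of t x d] by simp
    qed
    then show ?thesis by (intro exI[of _ "\<bar>B\<bar>"]) auto
  qed
  obtain B0 where B0: "B0 \<ge> 0" "\<forall>t\<ge>0. \<forall>x\<in>Q3. norm (\<Phi>' (t, x) (1, 0)) \<le> B0" using b by blast
  have "\<forall>j. \<exists>B. B \<ge> 0 \<and> (\<forall>t\<ge>0. \<forall>x\<in>Q3. norm (\<Phi>' (t, x) (0, axis j 1)) \<le> B)" using b by blast
  then obtain B where B: "\<And>j. B j \<ge> 0" "\<And>j. \<forall>t\<ge>0. \<forall>x\<in>Q3. norm (\<Phi>' (t, x) (0, axis j 1)) \<le> B j" by metis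
  have Bj: "B j \<le> sum B UNIV" for j using B(1) by (intro member_le_sum) auto
  have S0: "0 \<le> sum B UNIV" using B(1) by (simp add: sum_nonneg)
  show thesis
  proof (rule that[of "B0 + sum B UNIV" T])
    show "norm (partial j (\<phi> t) x) \<le> B0 + sum B UNIV" if "t \<ge> 0" "x \<in> Q3" for t x j
    proof -
      have "norm (partial j (\<phi> t) x) \<le> B j" using B(2)[of j] that \<Phi>(4)[OF that(1)] by simp
      then show ?thesis using Bj[of j] B0(1) by linarith
    qed
    show "norm (vector_derivative (\<lambda>s. \<phi> s x) (at t within {0..})) \<le> B0 + sum B UNIV" if "t \<ge> 0" "x \<in> Q3" for t x
    proof -
      have "norm (vector_derivative (\<lambda>s. \<phi> s x) (at t within {0..})) \<le> B0" using B0(2) that \<Phi>(3)[OF that(1)] by simp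
      then show ?thesis using S0 by linarith
    qed
    have "continuous_on Q3 (\<lambda>x. \<Phi>' (t, x) d)" if "t \<ge> 0" for t d
      by (rule continuous_on_compose2[OF \<Phi>(2)]) (use that in \<open>auto intro!: continuous_intros\<close>)
    then show "continuous_on Q3 (\<lambda>x. vector_derivative (\<lambda>s. \<phi> s x) (at t within {0..}))"
      "continuous_on Q3 (\<lambda>x. partial j (\<phi> t) x)" if "t \<ge> 0" for t j
      using that by (simp_all add: \<Phi>(3,4))
  qed (use B0 S0 \<Phi> in auto)
qed

text \<open>All entries of a positive symmetric matrix are bounded by its trace, so
  \<open>trace E\<close> alone controls how far the Euler equation fails. The constant depends on
  the test field only: 9 entries, the bound \<open>D\<close>, and \<open>exp T\<close> to undo the
  weight on the time support.\<close>

lemma wk_error_bound: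
  assumes \<phi>: "test_field \<phi>"
  obtains K where "\<And>\<rho> U v M. subsol \<rho> U v M \<Longrightarrow> \<bar>wk \<phi> (\<lambda>_. 0) (Emat \<rho> v M)\<bar> \<le> K * Jfun \<rho> v M"
proof -
  obtain D T where D: "D \<ge> 0"
    "\<And>t x j. t \<ge> 0 \<Longrightarrow> x \<in> Q3 \<Longrightarrow> norm (partial j (\<phi> t) x) \<le> D"
    "\<And>t x j. t > T \<Longrightarrow> t \<ge> 0 \<Longrightarrow> partial j (\<phi> t) x = 0"
    using test_field_bounds[OF \<phi>] by metis
  have "\<bar>wk \<phi> (\<lambda>_. 0) (Emat \<rho> v M)\<bar> \<le> (9 * D * exp T) * Jfun \<rho> v M" if sub: "subsol \<rho> U v M" for \<rho> U v M
  proof -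
    note S = subsolD[OF sub]
    let ?F = "tpair \<phi> (\<lambda>_. 0) (Emat \<rho> v M)"
    have cE: "continuous_on A (Emat \<rho> v M)" "continuous_on A (edens \<rho> v M)" for A
      by (intro continuous_edens continuous_on_subset[OF S(1)] continuous_on_subset[OF S(2)]; simp)+
    have ts: "time_supp ?F" by (intro time_supp_tpair \<phi> continuous_on_const cE)
    have pt: "\<bar>?F (t, x)\<bar> \<le> (9 * D * exp T) * (exp (- t) * edens \<rho> v M (t, x))" if "t \<ge> 0" "x \<in> Q3" for t x
    proof -
      have c: "(t, x) \<in> cyl" using that by simp
      have e: "0 < edens \<rho> v M (t, x)" by (rule edens_pos[OF sub c])
      have Esym: "Emat \<rho> v M (t, x) $ i $ j = Emat \<rho> v M (t, x) $ j $ i" for i j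
        using S(5)[of "(t, x)" i j] by (simp add: Emat_def mat_def mult.commute)
      have ent: "\<bar>Emat \<rho> v M (t, x) $ i $ j\<bar> \<le> edens \<rho> v M (t, x)" for i j
        unfolding edens_def by (rule trace_bound_entries[OF Esym S(6)[OF c]])
      show ?thesis
      proof (cases "t > T")
        case True
        then show ?thesis using D(1,3) e that by (simp add: tpair_def)
      next
        case False
        have "\<bar>?F (t, x)\<bar> \<le> (\<Sum>j\<in>(UNIV :: 3 set). \<Sum>i\<in>(UNIV :: 3 set). D * edens \<rho> v M (t, x))"
          unfolding tpair_def inner_zero_right add_0 fst_conv snd_conv
        proof (rule order_trans[OF sum_abs], rule sum_mono, rule order_trans[OF sum_abs], rule sum_mono)
          fix i j :: 3
          have "\<bar>partial j (\<phi> t) x $ i\<bar> \<le> D" using component_le_norm_cart[of "partial j (\<phi> t) x" i] D(2)[OF that, of j] by linarith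
          then show "\<bar>partial j (\<phi> t) x $ i * Emat \<rho> v M (t, x) $ i $ j\<bar> \<le> D * edens \<rho> v M (t, x)"
            unfolding abs_mult using ent[of i j] D(1) by (intro mult_mono) auto
        qed
        also have "\<dots> = 9 * D * edens \<rho> v M (t, x) * 1" by simp
        also have "\<dots> \<le> 9 * D * edens \<rho> v M (t, x) * exp (T - t)"
          using False D(1) e by (intro mult_left_mono) auto
        finally show ?thesis by (simp add: exp_diff exp_minus field_simps)
      qed
    qed
    have i1: "integrable LQ (\<lambda>x. ?F (t, x))" if "t \<ge> 0" for t using time_supp_integrable(1)[OF ts that] .
    have i2: "integrable LQ (\<lambda>x. c * edens \<rho> v M (t, x))" for c t
      by (intro integrable_LQ_continuous continuous_intros continuous_slice cE)
    have "\<bar>LINT x|LQ. ?F (t, x)\<bar> \<le> (9 * D * exp T) * (exp (- t) * (LINT x|LQ. edens \<rho> v M (t, x)))" if "t \<ge> 0" for t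
    proof -
      have "\<bar>LINT x|LQ. ?F (t, x)\<bar> \<le> (LINT x|LQ. (9 * D * exp T * exp (- t)) * edens \<rho> v M (t, x))"
        by (rule integral_abs_bound_integral[OF i1[OF that] i2]) (use pt[OF that] in \<open>simp add: space_LQ mult.assoc\<close>)
      then show ?thesis by (simp add: mult.assoc)
    qed
    then have "\<bar>LINT t|LT. LINT x|LQ. ?F (t, x)\<bar> \<le> (LINT t|LT. (9 * D * exp T) * (exp (- t) * (LINT x|LQ. edens \<rho> v M (t, x))))"
      by (intro integral_abs_bound_integral time_supp_integrable(2)[OF ts] integrable_mult_right integrable_edens(3)[OF sub])
        (simp add: space_restrict_space)
    then show ?thesis
      by (simp add: wk_def space_time_int_def integrable_edens(2)[OF sub])
  qed
  then show thesis by (rule that)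
qed

text \<open>\<open>M\<close> is \<open>outer v v + E\<close> minus \<open>\<rho>\<close> times the
  identity, and the identity paired with the gradient of a test field gives its divergence, which is
  zero.\<close>

lemma wk_split:
  assumes \<phi>: "test_field \<phi>" and sub: "subsol \<rho> U v M"
  shows "wk \<phi> v M = wk \<phi> v (\<lambda>y. outer (v y) (v y)) + wk \<phi> (\<lambda>_. 0) (Emat \<rho> v M)"
proof -
  note S = subsolD[OF sub]
  have c: "continuous_on cyl v" "continuous_on cyl M" using S(1,2) by (auto intro: continuous_on_subset)
  have "wk \<phi> v (\<lambda>y. outer (v y) (v y)) + wk \<phi> (\<lambda>_. 0) (Emat \<rho> v M)
      = wk \<phi> (\<lambda>y. v y + 0) (\<lambda>y. outer (v y) (v y) + Emat \<rho> v M y)"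
    by (intro wk_add[symmetric] \<phi> c continuous_on_const continuous_edens continuous_on_outer)
  also have "\<dots> = wk \<phi> v M"
    unfolding wk_def
  proof (rule space_time_int_cong)
    fix y assume y: "y \<in> cyl"
    have "(\<Sum>j\<in>UNIV. \<Sum>i\<in>UNIV. partial j (\<phi> (fst y)) (snd y) $ i * (\<rho> * (mat 1 :: real^3^3) $ i $ j))
        = \<rho> * divergence (\<phi> (fst y)) (snd y)"
      by (simp add: divergence_def mat_def sum_distrib_left if_distrib mult.commute cong: if_cong)
    also have "\<dots> = 0" using \<phi> y by (auto simp: test_field_def)
    finally show "tpair \<phi> (\<lambda>y. v y + 0) (\<lambda>y. outer (v y) (v y) + Emat \<rho> v M y) y = tpair \<phi> v M y"
      by (simp add: tpair_def Emat_def distrib_left sum.distrib)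
  qed
  finally show ?thesis by simp
qed

lemma LIMSEQ_null_sandwich:
  fixes a b :: "nat \<Rightarrow> real"
  assumes "\<And>k. 0 \<le> a k" "\<And>k. a k \<le> b k" "b \<longlonglongrightarrow> 0"
  shows "a \<longlonglongrightarrow> 0"
  by (rule tendsto_sandwich[OF _ _ tendsto_const assms(3)]) (simp_all add: assms(1,2))

lemma L2_norm_cong: "(\<And>x. x \<in> Q3 \<Longrightarrow> f x = g x) \<Longrightarrow> L2_norm f = L2_norm (g :: real^3 \<Rightarrow> real^3)"
  unfolding L2_norm_def by (intro arg_cong[of _ _ sqrt] Bochner_Integration.integral_cong) (auto simp: space_LQ)

lemma L2_cong:
  assumes "f \<in> L2" "\<And>x. x \<in> Q3 \<Longrightarrow> f x = g x"
  shows "g \<in> L2"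
proof -
  have "g \<in> borel_measurable LQ"
    using L2D(1)[OF assms(1)] assms(2) by (subst measurable_cong[where g = f]) (auto simp: space_LQ)
  then show ?thesis
    by (rule L2_dominated(1)[OF assms(1), where K = 1]) (use assms(2) in auto)
qed

lemma L2_norm_zero_eq_ae:
  assumes "f \<in> L2" "g \<in> L2" "L2_norm (\<lambda>x. f x - g x) = 0"
  shows "eq_ae f g"
proof -
  have i: "integrable LQ (\<lambda>x. (norm (f x - g x))\<^sup>2)" by (rule L2D(2)[OF L2_diff[OF assms(1,2)]])
  have "(LINT x|LQ. (norm (f x - g x))\<^sup>2) = 0"
    using assms(3) L2_norm_power2[of "\<lambda>x. f x - g x"] by simp
  then have "AE x in LQ. (norm (f x - g x))\<^sup>2 = 0"
    using integral_nonneg_eq_0_iff_AE[OF i] by simp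
  then show ?thesis unfolding eq_ae_def by (auto elim: eventually_mono)
qed

lemma advect_bound:
  assumes "\<And>j. norm (partial j f x) \<le> D"
  shows "norm (advect a f x) \<le> 3 * D * norm (a :: real^3)"
proof -
  have "norm (advect a f x) \<le> (\<Sum>j\<in>(UNIV :: 3 set). norm a * D)"
    unfolding advect_def
    by (intro sum_norm_le) (simp add: mult_mono component_le_norm_cart assms)
  then show ?thesis by (simp add: mult_ac)
qed

lemma advect_diff: "advect (a - b) f x = advect a f x - advect (b :: real^3) f x"
  by (simp add: advect_def scaleR_diff_left sum_subtractf)

lemma tpair_outer:
  "tpair \<phi> v (\<lambda>y. outer (v y) (v y)) y = vector_derivative (\<lambda>s. \<phi> s (snd y)) (at (fst y) within {0..}) \<bullet> v y
     + advect (v y) (\<phi> (fst y)) (snd y) \<bullet> v y"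
  unfolding tpair_def advect_def
  by (simp add: inner_sum_left) (simp add: inner_vec_def sum_distrib_left mult_ac)

section \<open>The strong limit of the approximating sequence\<close>

locale limit_setup =
  fixes \<rho> U v M \<epsilon> g0
  assumes sub: "\<And>k. subsol \<rho> U (v k) (M k)" and g0: "adm g0" and \<epsilon>: "\<epsilon> > 0"
    and near: "\<And>k. near_step (\<epsilon> * (1/2)^(Suc k)) (insert g0 (v ` {..k})) (v k) (v (Suc k))"
    and trM: "\<And>k t. (LINT x|LQ. trace (M (Suc k) (t, x))) \<le> (LINT x|LQ. trace (M k (t, x))) + \<epsilon> * (1/2)^(Suc k)"
    and Jdec: "\<And>k. Jfun \<rho> (v (Suc k)) (M (Suc k)) \<le> (1 - 1 / 800000) * Jfun \<rho> (v k) (M k)"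
begin

abbreviation V :: "nat \<Rightarrow> real \<Rightarrow> real^3 \<Rightarrow> real^3" where "V k t \<equiv> \<lambda>x. v k (t, x)"

lemma cv: "continuous_on UNIV (v k)" and cM: "continuous_on UNIV (M k)"
  using subsolD[OF sub] by blast+

lemma VL: "V k t \<in> L2"
  by (rule adm_L2[OF adm_subsol[OF sub]])

lemma tel_inner:
  assumes "w \<in> insert g0 (v ` {..n})" "t \<ge> 0" "n \<le> m"
  shows "\<bar>L2_inner (V m t) (\<lambda>x. w (t, x)) - L2_inner (V n t) (\<lambda>x. w (t, x))\<bar> \<le> \<epsilon> * (1/2)^n"
proof (rule telescoping_bound[where a = "\<lambda>k. L2_inner (V k t) (\<lambda>x. w (t, x))"])
  fix k assume k: "n \<le> k"
  have w: "w \<in> insert g0 (v ` {..k})" using assms(1) k by auto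
  have wL: "(\<lambda>x. w (t, x)) \<in> L2"
    using assms(1) adm_L2[OF g0] VL by auto
  show "\<bar>L2_inner (V (Suc k) t) (\<lambda>x. w (t, x)) - L2_inner (V k t) (\<lambda>x. w (t, x))\<bar> \<le> \<epsilon> * (1/2)^(Suc k)"
    using near[of k] w assms(2) unfolding near_step_def L2_inner_algebra(2)[OF VL VL wL, symmetric] by blast
qed (use assms \<epsilon> in auto)

lemma tel_lip:
  assumes "lip L h" "n \<le> m"
  shows "\<bar>L2_inner (V m t) h - L2_inner (V n t) h\<bar> \<le> (L * \<epsilon>) * (1/2)^n"
proof (rule telescoping_bound[where a = "\<lambda>k. L2_inner (V k t) h"])
  fix k
  have hL: "h \<in> L2" using assms(1) by (auto simp: lip_def intro: continuous_in_L2)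
  have "\<bar>L2_inner (\<lambda>x. v (Suc k) (t, x) - v k (t, x)) h\<bar> \<le> L * (\<epsilon> * (1/2)^(Suc k))"
    using near[of k] assms(1) unfolding near_step_def by blast
  then show "\<bar>L2_inner (V (Suc k) t) h - L2_inner (V k t) h\<bar> \<le> (L * \<epsilon>) * (1/2)^(Suc k)"
    unfolding L2_inner_algebra(2)[OF VL VL hL, symmetric] by (simp add: mult.assoc)
qed (use assms \<epsilon> in \<open>auto simp: lip_def\<close>)

text \<open>Positivity of the defect gives \<open>v \<bullet> v < 3 * \<rho> + trace M\<close>
  pointwise, and at every time the spatial mean of \<open>trace M\<close> rises by less than
  \<open>\<epsilon>\<close> over the whole iteration.\<close>

lemma energy_bound: "\<exists>B\<ge>0. \<forall>k. \<forall>t\<ge>0. (L2_norm (V k t))\<^sup>2 \<le> B"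
proof -
  interpret LQ: finite_measure LQ by (rule measure_Q3(3))
  obtain b where b: "\<And>y. y \<in> cyl \<Longrightarrow> norm (M 0 y) \<le> b" using subsolD(4)[OF sub[of 0]] by blast
  have ctr: "continuous_on S (\<lambda>x. trace (M k (t, x)))" for S k t
    unfolding trace_def by (intro continuous_intros continuous_slice cM)
  have itr: "integrable LQ (\<lambda>x. trace (M k (t, x)))" for k t
    by (intro integrable_LQ_continuous ctr)
  have tr0: "(LINT x|LQ. trace (M 0 (t, x))) \<le> 3 * b" if "t \<ge> 0" for t
  proof -
    have "(LINT x|LQ. trace (M 0 (t, x))) \<le> (LINT x|LQ. 3 * b)"
    proof (rule integral_mono[OF itr])
      fix x assume "x \<in> space LQ"
      then have n: "norm (M 0 (t, x)) \<le> b" using b that by (simp add: space_LQ)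
      have "trace (M 0 (t, x)) \<le> (\<Sum>i\<in>(UNIV :: 3 set). b)"
        unfolding trace_def
      proof (intro sum_mono)
        fix i :: 3
        show "M 0 (t, x) $ i $ i \<le> b"
          using component_le_norm_cart[of "M 0 (t, x) $ i" i] Finite_Cartesian_Product.norm_nth_le[of "M 0 (t, x)" i] n by linarith
      qed
      then show "trace (M 0 (t, x)) \<le> 3 * b" by simp
    qed simp
    then show ?thesis using measure_Q3(2) by (simp add: space_LQ)
  qed
  have trk: "(LINT x|LQ. trace (M k (t, x))) \<le> (LINT x|LQ. trace (M 0 (t, x))) + \<epsilon> - \<epsilon> * (1/2)^k" for k t
  proof (induction k)
    case (Suc k)
    then show ?case using trM[where k = k and t = t] by simp
  qed simp
  have "(L2_norm (V k t))\<^sup>2 \<le> 3 * \<bar>\<rho>\<bar> + 3 * \<bar>b\<bar> + \<epsilon>" if "t \<ge> 0" for k t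
  proof -
    have "(L2_norm (V k t))\<^sup>2 \<le> (LINT x|LQ. 3 * \<rho> + trace (M k (t, x)))"
      unfolding L2_norm_power2
    proof (rule integral_mono)
      show "integrable LQ (\<lambda>x. (norm (V k t x))\<^sup>2)" by (rule L2D(2)[OF VL])
      show "integrable LQ (\<lambda>x. 3 * \<rho> + trace (M k (t, x)))" using itr by simp
      fix x assume "x \<in> space LQ"
      then have "0 < edens \<rho> (v k) (M k) (t, x)" using that by (intro edens_pos[OF sub]) (simp add: space_LQ)
      then show "(norm (V k t x))\<^sup>2 \<le> 3 * \<rho> + trace (M k (t, x))"
        unfolding edens_eq dot_square_norm by simp
    qed
    also have "\<dots> = 3 * \<rho> + (LINT x|LQ. trace (M k (t, x)))"
      using itr measure_Q3(2) by (simp add: space_LQ)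
    also have "\<dots> \<le> 3 * \<bar>\<rho>\<bar> + 3 * \<bar>b\<bar> + \<epsilon>"
    proof -
      have "0 \<le> \<epsilon> * (1/2)^k" using \<epsilon> by simp
      then show ?thesis using trk[of k t] tr0[OF that] by linarith
    qed
    finally show ?thesis .
  qed
  then show ?thesis using \<epsilon> by (intro exI[of _ "3 * \<bar>\<rho>\<bar> + 3 * \<bar>b\<bar> + \<epsilon>"]) auto
qed

text \<open>The increments are almost orthogonal to the earlier terms at every single time, so the norms
  almost increase; being bounded they converge, which makes the sequence strongly Cauchy.\<close>

lemma strongly_Cauchy:
  assumes t: "t \<ge> 0" and e: "e > 0"
  shows "\<exists>N. \<forall>m\<ge>N. \<forall>n\<ge>N. L2_norm (\<lambda>x. V m t x - V n t x) < e"
proof -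
  define a where "a k = (L2_norm (V k t))\<^sup>2" for k
  have diff: "(L2_norm (\<lambda>x. V m t x - V n t x))\<^sup>2 \<le> a m - a n + 2 * (\<epsilon> * (1/2)^n)" if "n \<le> m" for m n
  proof -
    have D: "(\<lambda>x. V m t x - V n t x) \<in> L2" by (intro L2_diff VL)
    have "a m = (L2_norm (\<lambda>x. V m t x - V n t x))\<^sup>2 + 2 * L2_inner (\<lambda>x. V m t x - V n t x) (V n t) + a n"
      unfolding a_def using L2_norm_add_power2[OF D VL[of n t]] by simp
    moreover have "\<bar>L2_inner (\<lambda>x. V m t x - V n t x) (V n t)\<bar> \<le> \<epsilon> * (1/2)^n"
      using tel_inner[of "v n" n t m] t that L2_inner_algebra(2)[OF VL[of m t] VL[of n t] VL[of n t]] by simp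
    ultimately show ?thesis by linarith
  qed
  obtain B where B: "\<And>k. a k \<le> B" using energy_bound t unfolding a_def by blast
  \<comment> \<open>The squared norm can drop by at most \<open>2 * \<epsilon> * (1/2)^k\<close> in
    step \<open>k\<close>. The correction \<open>4 * \<epsilon> * (1/2)^k\<close> shrinks by exactly
    that amount, so \<open>b\<close> is increasing.\<close>
  define b where "b k = a k - 4 * \<epsilon> * (1/2)^k" for k
  have "incseq b"
  proof (rule incseq_SucI)
    fix k
    have "a k - 2 * (\<epsilon> * (1/2)^k) \<le> a (Suc k)"
      using diff[of k "Suc k"] zero_le_power2[of "L2_norm (\<lambda>x. V (Suc k) t x - V k t x)"] by linarith
    then show "b k \<le> b (Suc k)" by (simp add: b_def)
  qed
  moreover have "b k \<le> B" for k
  proof -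
    have "0 \<le> 4 * \<epsilon> * (1/2)^k" using \<epsilon> by simp
    then show ?thesis using B[of k] by (simp add: b_def)
  qed
  ultimately obtain l where l: "b \<longlonglongrightarrow> l" using incseq_convergent by blast
  have half: "(\<lambda>k. c * (1/2 :: real)^k) \<longlonglongrightarrow> 0" for c
    using tendsto_mult_right_zero[OF LIMSEQ_power_zero, of "1/2 :: real" c] by simp
  have "(\<lambda>k. b k + 4 * \<epsilon> * (1/2)^k) \<longlonglongrightarrow> l + 0" by (intro tendsto_add l half)
  then have "a \<longlonglongrightarrow> l" by (simp add: b_def)
  then have "Cauchy a" by (rule LIMSEQ_imp_Cauchy)
  have e2: "e\<^sup>2 / 2 > 0" using e by simp
  obtain N1 where N1: "\<And>m n. m \<ge> N1 \<Longrightarrow> n \<ge> N1 \<Longrightarrow> \<bar>a m - a n\<bar> < e\<^sup>2 / 2"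
    using CauchyD[OF \<open>Cauchy a\<close> e2] by auto
  obtain N2 where N2: "\<And>n. n \<ge> N2 \<Longrightarrow> \<bar>2 * \<epsilon> * (1/2)^n\<bar> < e\<^sup>2 / 2"
    using LIMSEQ_D[OF half[of "2 * \<epsilon>"] e2] by auto
  have "L2_norm (\<lambda>x. V m t x - V n t x) < e" if "n \<ge> max N1 N2" "m \<ge> n" for m n
  proof -
    have "(L2_norm (\<lambda>x. V m t x - V n t x))\<^sup>2 < e\<^sup>2"
    proof -
      have "\<bar>a m - a n\<bar> < e\<^sup>2 / 2" "\<bar>2 * \<epsilon> * (1/2)^n\<bar> < e\<^sup>2 / 2" using N1[of m n] N2[of n] that by auto
      moreover have "2 * (\<epsilon> * (1/2)^n) = 2 * \<epsilon> * (1/2)^n" by simp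
      ultimately show ?thesis using diff[OF that(2)] by linarith
    qed
    then show ?thesis using e by (simp add: power2_less_imp_less)
  qed
  note * = this
  have "L2_norm (\<lambda>x. V m t x - V n t x) < e" if "n \<ge> max N1 N2" "m \<ge> max N1 N2" for m n
  proof (cases "n \<le> m")
    case True
    then show ?thesis using *[OF that(1)] by blast
  next
    case False
    then have "L2_norm (\<lambda>x. V n t x - V m t x) < e" using *[OF that(2), of n] by simp
    then show ?thesis by (subst L2_norm_minus_commute)
  qed
  then show ?thesis by blast
qed

text \<open>The L2 limit is determined only up to null sets; at each time a Borel representative is
  picked, since \<open>ei_x3\<close> evaluates the field on slices.\<close>

definition u :: "real \<Rightarrow> real^3 \<Rightarrow> real^3" where
  "u t = (SOME f. f \<in> borel_measurable borel \<and> f \<in> L2 \<and> (\<lambda>k. L2_norm (\<lambda>x. V k t x - f x)) \<longlonglongrightarrow> 0)"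

lemma u:
  assumes "t \<ge> 0"
  shows "u t \<in> borel_measurable borel" "u t \<in> L2" "(\<lambda>k. L2_norm (\<lambda>x. V k t x - u t x)) \<longlonglongrightarrow> 0"
proof -
  have "\<exists>f. f \<in> borel_measurable borel \<and> f \<in> L2 \<and> (\<lambda>k. L2_norm (\<lambda>x. V k t x - f x)) \<longlonglongrightarrow> 0"
    using L2_complete[of "\<lambda>k. V k t", OF continuous_slice[OF cv] strongly_Cauchy[OF assms]] by blast
  from someI_ex[OF this]
  show "u t \<in> borel_measurable borel" "u t \<in> L2" "(\<lambda>k. L2_norm (\<lambda>x. V k t x - u t x)) \<longlonglongrightarrow> 0"
    unfolding u_def by blast+
qed

lemma inner_limit: "t \<ge> 0 \<Longrightarrow> g \<in> L2 \<Longrightarrow> (\<lambda>k. L2_inner (V k t) g) \<longlonglongrightarrow> L2_inner (u t) g"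
  by (intro L2_inner_tendsto VL u) (simp_all add: L2_norm_def)

lemma u_norm: "\<exists>B\<ge>0. \<forall>t\<ge>0. L2_norm (u t) \<le> B"
proof -
  obtain B where B: "B \<ge> 0" "\<And>k t. t \<ge> 0 \<Longrightarrow> (L2_norm (V k t))\<^sup>2 \<le> B" using energy_bound by blast
  have "L2_norm (u t) \<le> sqrt B" if "t \<ge> 0" for t
  proof -
    have "(\<lambda>k. L2_inner (V k t) (V k t)) \<longlonglongrightarrow> L2_inner (u t) (u t)"
      by (intro L2_inner_tendsto VL u that)
    then have "(L2_norm (u t))\<^sup>2 \<le> B"
      unfolding L2_inner_self by (rule LIMSEQ_le_const2) (use B(2)[OF that] in blast)
    then show ?thesis by (simp add: real_le_rsqrt)
  qed
  then show ?thesis using B(1) by (intro exI[of _ "sqrt B"]) auto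
qed

lemma u_in_H: "t \<ge> 0 \<Longrightarrow> u t \<in> H_space"
  unfolding H_space_def
proof (intro CollectI conjI allI impI u)
  fix e :: real assume t: "t \<ge> 0" and e: "e > 0"
  obtain k where k: "L2_norm (\<lambda>x. V k t x - u t x) < e"
    using order_tendstoD(2)[OF u(3)[OF t] e] by (auto simp: eventually_sequentially)
  obtain f where f: "smooth_periodic_divfree f" "\<forall>x\<in>Q3. f x = v k (t, x)"
    using subsolD(8)[OF sub] by blast
  have "L2_norm (\<lambda>x. u t x - f x) = L2_norm (\<lambda>x. u t x - V k t x)"
    by (rule L2_norm_cong) (use f(2) in simp)
  also have "\<dots> < e" using k by (subst L2_norm_minus_commute)
  finally show "\<exists>v. smooth_periodic_divfree v \<and> L2_norm (\<lambda>x. u t x - v x) < e" using f(1) by blast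
qed

lemma u_initial: "eq_ae (u 0) U" "U \<in> H_space"
proof -
  have eq: "V k 0 x = U x" if "x \<in> Q3" for k x using subsolD(7)[OF sub that] .
  have UL: "U \<in> L2" by (rule L2_cong[OF VL[of 0 0]]) (rule eq)
  have "L2_norm (\<lambda>x. V k 0 x - u 0 x) = L2_norm (\<lambda>x. U x - u 0 x)" for k
    by (rule L2_norm_cong) (simp add: eq)
  then have "(\<lambda>k :: nat. L2_norm (\<lambda>x. U x - u 0 x)) \<longlonglongrightarrow> 0"
    using u(3)[of 0] by simp
  then have "L2_norm (\<lambda>x. U x - u 0 x) = 0"
    by (simp add: LIMSEQ_const_iff)
  then show "eq_ae (u 0) U"
    using L2_norm_minus_commute[of U "u 0"] by (intro L2_norm_zero_eq_ae UL u) auto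
  obtain f where f: "smooth_periodic_divfree f" "\<forall>x\<in>Q3. f x = v 0 (0, x)"
    using subsolD(8)[OF sub] by blast
  have "L2_norm (\<lambda>x. U x - f x) = L2_norm (\<lambda>x :: real^3. 0 :: real^3)"
    by (rule L2_norm_cong) (use f(2) eq in simp)
  then show "U \<in> H_space"
    unfolding H_space_def using UL f(1) by (auto simp: L2_norm_def)
qed

text \<open>Pairings with a Lipschitz field converge uniformly in time, by \<open>tel_lip\<close>,
  and those of each approximation are continuous in time. Density of Lipschitz fields and the
  uniform L2 bound extend continuity to all \<open>g\<close>.\<close>

lemma u_weakly_continuous: "continuous_map (top_of_set {0..}) H_weak u"
  unfolding continuous_map_H_weak_iff
proof (intro conjI ballI)
  fix g :: "real^3 \<Rightarrow> real^3" assume g: "g \<in> L2"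
  obtain B where B: "B \<ge> 0" "\<And>t. t \<ge> 0 \<Longrightarrow> L2_norm (u t) \<le> B" using u_norm by blast
  show "continuous_on {0..} (\<lambda>t. L2_inner (u t) g)"
  proof (rule continuous_on_uniform_approx)
    fix e :: real assume e: "e > 0"
    have "e / (2 * (B + 1)) > 0" using e B(1) by simp
    then obtain h L where h: "lip L h" "L2_norm (\<lambda>x. g x - h x) < e / (2 * (B + 1))"
      using L2_Lipschitz_dense[OF g] by blast
    have hL: "h \<in> L2" using h(1) by (auto simp: lip_def intro: continuous_in_L2)
    have "(\<lambda>k. (L * \<epsilon>) * (1/2 :: real)^k) \<longlonglongrightarrow> 0"
      using tendsto_mult_right_zero[OF LIMSEQ_power_zero, of "1/2 :: real" "L * \<epsilon>"] by simp
    from LIMSEQ_D[OF this, of "e / 2"] e obtain n where n: "\<bar>(L * \<epsilon>) * (1/2)^n\<bar> < e / 2" by auto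
    show "\<exists>f. continuous_on {0..} f \<and> (\<forall>t\<in>{0..}. \<bar>L2_inner (u t) g - f t\<bar> < e)"
    proof (intro exI[of _ "\<lambda>t. L2_inner (V n t) h"] conjI ballI)
      show "continuous_on {0..} (\<lambda>t. L2_inner (V n t) h)"
        unfolding L2_inner_def
      proof (rule continuous_on_integral_LQ[where F = "\<lambda>y. v n y \<bullet> h (snd y)", unfolded snd_conv])
        have "continuous_on cyl (\<lambda>y. h (snd y))"
          using h(1) by (intro continuous_on_compose2[of Q3 h cyl snd] continuous_on_snd continuous_on_id) (auto simp: lip_def)
        then show "continuous_on cyl (\<lambda>y. v n y \<bullet> h (snd y))"
          by (intro continuous_intros continuous_on_subset[OF cv]) auto
      qed
      fix t :: real assume "t \<in> {0..}"
      then have t: "t \<ge> 0" by simp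
      have "(\<lambda>m. \<bar>L2_inner (V m t) h - L2_inner (V n t) h\<bar>) \<longlonglongrightarrow> \<bar>L2_inner (u t) h - L2_inner (V n t) h\<bar>"
        by (intro tendsto_intros inner_limit t hL)
      then have 1: "\<bar>L2_inner (u t) h - L2_inner (V n t) h\<bar> \<le> (L * \<epsilon>) * (1/2)^n"
        by (rule LIMSEQ_le_const2) (use tel_lip[OF h(1)] in blast)
      have "L2_inner (u t) g - L2_inner (u t) h = L2_inner (\<lambda>x. g x - h x) (u t)"
        using L2_inner_algebra(2)[OF g hL u(2)[OF t]] L2_inner_algebra(4)[OF g g u(2)[OF t]] L2_inner_algebra(4)[OF hL hL u(2)[OF t]] by simp
      also have "\<bar>\<dots>\<bar> \<le> L2_norm (\<lambda>x. g x - h x) * L2_norm (u t)"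
        by (intro L2_Cauchy_Schwarz L2_diff g hL u t)
      also have "\<dots> \<le> e / (2 * (B + 1)) * (B + 1)"
        using h(2) B(2)[OF t] B(1) e by (intro mult_mono) (auto simp: L2_norm_nonneg)
      also have "\<dots> = e / 2" using B(1) by (simp add: field_simps)
      finally show "\<bar>L2_inner (u t) g - L2_inner (V n t) h\<bar> < e" using 1 n by linarith
    qed
  qed
qed (use u_in_H in auto)

lemma J_tendsto: "(\<lambda>k. Jfun \<rho> (v k) (M k)) \<longlonglongrightarrow> 0"
proof -
  define q :: real where "q = 1 - 1 / 800000"
  have q: "0 \<le> q" "q < 1" by (auto simp: q_def)
  have nn: "0 \<le> Jfun \<rho> (v k) (M k)" for k
    unfolding Jfun_def using edens_pos[OF sub]
    by (intro Bochner_Integration.integral_nonneg) (auto simp: indicator_def less_imp_le)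
  have "Jfun \<rho> (v k) (M k) \<le> q ^ k * Jfun \<rho> (v 0) (M 0)" for k
  proof (induction k)
    case (Suc k)
    have "Jfun \<rho> (v (Suc k)) (M (Suc k)) \<le> q * Jfun \<rho> (v k) (M k)" using Jdec[of k] by (simp add: q_def)
    also have "\<dots> \<le> q * (q ^ k * Jfun \<rho> (v 0) (M 0))" using Suc q by (intro mult_left_mono)
    finally show ?case by simp
  qed simp
  moreover have "(\<lambda>k. q ^ k * Jfun \<rho> (v 0) (M 0)) \<longlonglongrightarrow> 0"
    using q by (intro tendsto_mult_left_zero LIMSEQ_power_zero) simp
  ultimately show ?thesis
    using nn by (rule LIMSEQ_null_sandwich[rotated])
qed

text \<open>Strong convergence at every time carries the quadratic term to the limit, dominated
  convergence in time treats the outer integral, and the defect term tends to zero together with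
  \<open>Jfun\<close>.\<close>

lemma u_weak_identity:
  assumes \<phi>: "test_field \<phi>"
  shows "(LINT t|LT. LINT x|LQ. vector_derivative (\<lambda>s. \<phi> s x) (at t within {0..}) \<bullet> u t x
            + advect (u t x) (\<phi> t) x \<bullet> u t x) + (LINT x|LQ. U x \<bullet> \<phi> 0 x) = 0"
proof -
  obtain D T where D: "D \<ge> 0"
    "\<And>t x. t \<ge> 0 \<Longrightarrow> x \<in> Q3 \<Longrightarrow> norm (vector_derivative (\<lambda>s. \<phi> s x) (at t within {0..})) \<le> D"
    "\<And>t x j. t \<ge> 0 \<Longrightarrow> x \<in> Q3 \<Longrightarrow> norm (partial j (\<phi> t) x) \<le> D"
    "\<And>t x. t > T \<Longrightarrow> t \<ge> 0 \<Longrightarrow> vector_derivative (\<lambda>s. \<phi> s x) (at t within {0..}) = 0"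
    "\<And>t x j. t > T \<Longrightarrow> t \<ge> 0 \<Longrightarrow> partial j (\<phi> t) x = 0"
    "\<And>t. t \<ge> 0 \<Longrightarrow> continuous_on Q3 (\<lambda>x. vector_derivative (\<lambda>s. \<phi> s x) (at t within {0..}))"
    "\<And>t j. t \<ge> 0 \<Longrightarrow> continuous_on Q3 (\<lambda>x. partial j (\<phi> t) x)"
    by (rule test_field_bounds[OF \<phi>]) blast
  let ?d = "\<lambda>t x. vector_derivative (\<lambda>s. \<phi> s x) (at t within {0..})"
  define Z where "Z f t x = advect (f x) (\<phi> t) x" for f :: "real^3 \<Rightarrow> real^3" and t x
  have dL: "?d t \<in> L2" if "t \<ge> 0" for t by (intro continuous_in_L2 D that)
  have Zb: "norm (Z f t x) \<le> 3 * D * norm (f x)" if "t \<ge> 0" "x \<in> Q3" for f t x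
    unfolding Z_def by (rule advect_bound) (rule D(3)[OF that])
  have Zm: "Z f t \<in> borel_measurable LQ" if "t \<ge> 0" "f \<in> L2" for f t
  proof -
    have "(\<lambda>x. f x $ j *\<^sub>R partial j (\<phi> t) x) \<in> borel_measurable LQ" for j
    proof (intro borel_measurable_scaleR)
      show "(\<lambda>x. f x $ j) \<in> borel_measurable LQ"
        by (rule measurable_compose[OF L2D(1)[OF that(2)]]) (intro borel_measurable_continuous_onI continuous_intros)
      show "partial j (\<phi> t) \<in> borel_measurable LQ"
        by (rule L2D(1)[OF continuous_in_L2[OF D(7)[OF that(1)]]])
    qed
    then show ?thesis unfolding Z_def [abs_def] advect_def by (intro borel_measurable_sum)
  qed
  have ZL: "Z f t \<in> L2" "L2_norm (Z f t) \<le> 3 * D * L2_norm f" if "t \<ge> 0" "f \<in> L2" for f t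
    using L2_dominated[OF that(2) Zm[OF that] Zb[OF that(1)]] D(1) by auto
  define A where "A f t = L2_inner (?d t) f + L2_inner (Z f t) f" for f t
  have Aint: "(LINT x|LQ. ?d t x \<bullet> f x + advect (f x) (\<phi> t) x \<bullet> f x) = A f t" if "t \<ge> 0" "f \<in> L2" for f t
    using L2_inner_integrable[OF dL[OF that(1)] that(2)] L2_inner_integrable[OF ZL(1)[OF that] that(2)]
    by (simp add: A_def L2_inner_def Z_def)
  have lim: "(\<lambda>k. A (V k t) t) \<longlonglongrightarrow> A (u t) t" if t: "t \<ge> 0" for t
    unfolding A_def
  proof (intro tendsto_add L2_inner_tendsto dL ZL VL u t)
    show "(\<lambda>n. L2_norm (\<lambda>x. ?d t x - ?d t x)) \<longlonglongrightarrow> 0" by (simp add: L2_norm_def)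
    have "L2_norm (\<lambda>x. Z (V k t) t x - Z (u t) t x) \<le> 3 * D * L2_norm (\<lambda>x. V k t x - u t x)" for k
      using ZL(2)[OF t L2_diff[OF VL u(2)[OF t]], of k t] unfolding Z_def advect_diff .
    moreover have "(\<lambda>k. 3 * D * L2_norm (\<lambda>x. V k t x - u t x)) \<longlonglongrightarrow> 0"
      by (intro tendsto_mult_right_zero u t)
    ultimately show "(\<lambda>k. L2_norm (\<lambda>x. Z (V k t) t x - Z (u t) t x)) \<longlonglongrightarrow> 0"
      by (rule LIMSEQ_null_sandwich[OF L2_norm_nonneg])
  qed
  obtain B where B: "B \<ge> 0" "\<And>k t. t \<ge> 0 \<Longrightarrow> (L2_norm (V k t))\<^sup>2 \<le> B" using energy_bound by blast
  \<comment> \<open>Beyond \<open>T\<close> the integrand vanishes, and up to \<open>T\<close> one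
    has \<open>exp (T - t) \<ge> 1\<close>; so a constant bound becomes one that is integrable over
    the half-line.\<close>
  have bound: "\<bar>A (V k t) t\<bar> \<le> (D * (1 + B) + 3 * D * B) * exp T * exp (- t)" if t: "t \<ge> 0" for k t
  proof (cases "t > T")
    case True
    have "?d t = (\<lambda>x. 0)" "Z (V k t) t = (\<lambda>x. 0)" using D(4,5)[OF True t] by (auto simp: Z_def advect_def)
    then show ?thesis using D(1) B(1) by (simp add: A_def L2_inner_def)
  next
    case False
    have n: "L2_norm (V k t) \<le> 1 + B"
    proof -
      have "L2_norm (V k t) \<le> 1 + (L2_norm (V k t))\<^sup>2"
        using zero_le_power2[of "L2_norm (V k t) - 1"] zero_le_power2[of "L2_norm (V k t)"]
        unfolding power2_diff power_one by linarith
      then show ?thesis using B(2)[OF t, of k] by linarith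
    qed
    let ?e = "axis 1 1 :: real^3"
    have "L2_norm (?d t) \<le> D * L2_norm (\<lambda>x. ?e)"
      by (rule L2_dominated(2)) (use D(1,2) t L2D(1)[OF dL[OF t]] in \<open>auto simp: norm_axis_1 intro: continuous_in_L2\<close>)
    then have d: "L2_norm (?d t) \<le> D" using measure_Q3(2) by (simp add: L2_norm_def space_LQ)
    have "\<bar>L2_inner (?d t) (V k t)\<bar> \<le> D * (1 + B)"
      by (rule order_trans[OF L2_Cauchy_Schwarz[OF dL[OF t] VL]])
        (use d n D(1) L2_norm_nonneg in \<open>intro mult_mono; auto\<close>)
    moreover have "\<bar>L2_inner (Z (V k t) t) (V k t)\<bar> \<le> 3 * D * B"
    proof -
      have "\<bar>L2_inner (Z (V k t) t) (V k t)\<bar> \<le> L2_norm (Z (V k t) t) * L2_norm (V k t)"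
        by (rule L2_Cauchy_Schwarz[OF ZL(1)[OF t VL] VL])
      also have "\<dots> \<le> 3 * D * L2_norm (V k t) * L2_norm (V k t)"
        by (intro mult_right_mono ZL(2) t VL L2_norm_nonneg)
      also have "\<dots> \<le> 3 * D * B"
        using mult_left_mono[OF B(2)[OF t, of k], of "3 * D"] D(1) by (simp add: power2_eq_square mult.assoc)
      finally show ?thesis .
    qed
    ultimately have "\<bar>A (V k t) t\<bar> \<le> (D * (1 + B) + 3 * D * B) * 1"
      unfolding A_def mult_1_right by (rule order_trans[OF abs_triangle_ineq add_mono])
    also have "\<dots> \<le> (D * (1 + B) + 3 * D * B) * (exp T * exp (- t))"
      using False D(1) B(1) by (intro mult_left_mono) (auto simp: exp_add[symmetric])
    finally show ?thesis by (simp add: mult.assoc)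
  qed
  define Wk where "Wk k = wk \<phi> (v k) (\<lambda>y. outer (v k y) (v k y))" for k
  have WkA: "Wk k = (LINT t|LT. A (V k t) t)" for k
    unfolding Wk_def wk_def space_time_int_def tpair_outer fst_conv snd_conv
    by (intro Bochner_Integration.integral_cong refl Aint VL) (simp add: space_restrict_space)
  have meas: "(\<lambda>t. A (V k t) t) \<in> borel_measurable LT" for k
  proof -
    have "time_supp (tpair \<phi> (v k) (\<lambda>y. outer (v k y) (v k y)))"
      by (intro time_supp_tpair \<phi> continuous_on_outer continuous_on_subset[OF cv]) auto
    then have "integrable LT (\<lambda>t. LINT x|LQ. tpair \<phi> (v k) (\<lambda>y. outer (v k y) (v k y)) (t, x))"
      by (rule time_supp_integrable)
    then have "(\<lambda>t. LINT x|LQ. tpair \<phi> (v k) (\<lambda>y. outer (v k y) (v k y)) (t, x)) \<in> borel_measurable LT" by simp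
    then show ?thesis
      unfolding tpair_outer fst_conv snd_conv
      by (subst measurable_cong[where g = "\<lambda>t. LINT x|LQ. ?d t x \<bullet> V k t x + advect (V k t x) (\<phi> t) x \<bullet> V k t x"])
        (auto simp: space_restrict_space Aint VL)
  qed
  have mlim: "(\<lambda>t. A (u t) t) \<in> borel_measurable LT"
    by (rule borel_measurable_LIMSEQ_real[where u = "\<lambda>k t. A (V k t) t"]) (simp_all add: space_restrict_space lim meas)
  have "(\<lambda>k. LINT t|LT. A (V k t) t) \<longlonglongrightarrow> (LINT t|LT. A (u t) t)"
  proof (rule integral_dominated_convergence[OF mlim meas, where w = "\<lambda>t. (D * (1 + B) + 3 * D * B) * exp T * exp (- t)"])
    show "integrable LT (\<lambda>t. (D * (1 + B) + 3 * D * B) * exp T * exp (- t))"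
      by (intro integrable_mult_right integrable_exp_minus_LT)
    show "AE t in LT. norm (A (V k t) t) \<le> (D * (1 + B) + 3 * D * B) * exp T * exp (- t)" for k
      by (intro AE_I2) (simp add: space_restrict_space bound)
    show "AE t in LT. (\<lambda>k. A (V k t) t) \<longlonglongrightarrow> A (u t) t"
      by (intro AE_I2) (simp add: space_restrict_space lim)
  qed
  then have 1: "Wk \<longlonglongrightarrow> (LINT t|LT. A (u t) t)" by (simp add: WkA[abs_def])
  obtain K where K: "\<And>k. \<bar>wk \<phi> (\<lambda>_. 0) (Emat \<rho> (v k) (M k))\<bar> \<le> K * Jfun \<rho> (v k) (M k)"
    using wk_error_bound[OF \<phi>] sub by metis
  have "(\<lambda>k. wk \<phi> (\<lambda>_. 0) (Emat \<rho> (v k) (M k))) \<longlonglongrightarrow> 0"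
    by (rule Lim_null_comparison[OF always_eventually tendsto_mult_right_zero[OF J_tendsto, of K]]) (simp add: K)
  then have "(\<lambda>k. - (LINT x|LQ. U x \<bullet> \<phi> 0 x) - wk \<phi> (\<lambda>_. 0) (Emat \<rho> (v k) (M k))) \<longlonglongrightarrow> - (LINT x|LQ. U x \<bullet> \<phi> 0 x) - 0"
    by (intro tendsto_diff tendsto_const)
  moreover have "Wk = (\<lambda>k. - (LINT x|LQ. U x \<bullet> \<phi> 0 x) - wk \<phi> (\<lambda>_. 0) (Emat \<rho> (v k) (M k)))"
  proof
    show "Wk k = - (LINT x|LQ. U x \<bullet> \<phi> 0 x) - wk \<phi> (\<lambda>_. 0) (Emat \<rho> (v k) (M k))" for k
      using subsolD(9)[OF sub \<phi>, of k] wk_split[OF \<phi> sub, of k] by (simp add: Wk_def)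
  qed
  ultimately have "Wk \<longlonglongrightarrow> - (LINT x|LQ. U x \<bullet> \<phi> 0 x)" by simp
  with 1 have "(LINT t|LT. A (u t) t) = - (LINT x|LQ. U x \<bullet> \<phi> 0 x)" by (rule LIMSEQ_unique)
  moreover have "(LINT t|LT. LINT x|LQ. ?d t x \<bullet> u t x + advect (u t x) (\<phi> t) x \<bullet> u t x) = (LINT t|LT. A (u t) t)"
    by (intro Bochner_Integration.integral_cong refl Aint u) (simp_all add: space_restrict_space)
  ultimately show ?thesis by simp
qed

lemma u_solution: "Euler_weak_solution U u"
  unfolding Euler_weak_solution_def using u_initial u_weakly_continuous u_weak_identity by blast

lemma u_close:
  assumes "t \<ge> 0"
  shows "\<bar>L2_inner (u t) (\<lambda>x. g0 (t, x)) - L2_inner (V 0 t) (\<lambda>x. g0 (t, x))\<bar> \<le> \<epsilon>"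
proof -
  have "(\<lambda>m. \<bar>L2_inner (V m t) (\<lambda>x. g0 (t, x)) - L2_inner (V 0 t) (\<lambda>x. g0 (t, x))\<bar>)
      \<longlonglongrightarrow> \<bar>L2_inner (u t) (\<lambda>x. g0 (t, x)) - L2_inner (V 0 t) (\<lambda>x. g0 (t, x))\<bar>"
    by (intro tendsto_intros inner_limit assms adm_L2 g0)
  then show ?thesis
    by (rule LIMSEQ_le_const2) (use tel_inner[of g0 0 t] assms in force)
qed

end

lemma subsolution_to_solution:
  assumes "subsol \<rho> U v0 M0" "adm g0" "\<epsilon> > 0"
  obtains u where "Euler_weak_solution U u" "eq_ae (u 0) U"
    "\<And>t. t \<ge> 0 \<Longrightarrow> u t \<in> borel_measurable borel" "\<And>t. t \<ge> 0 \<Longrightarrow> u t \<in> L2"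
    "\<And>t. t \<ge> 0 \<Longrightarrow> \<bar>L2_inner (u t) (\<lambda>x. g0 (t, x)) - L2_inner (\<lambda>x. v0 (t, x)) (\<lambda>x. g0 (t, x))\<bar> \<le> \<epsilon>"
proof -
  obtain v M where s: "v 0 = v0" "M 0 = M0" "\<And>k. subsol \<rho> U (v k) (M k)"
    "\<And>k. near_step (\<epsilon> * (1/2)^(Suc k)) (insert g0 (v ` {..k})) (v k) (v (Suc k))"
    "\<And>k t. (LINT x|LQ. trace (M (Suc k) (t, x))) \<le> (LINT x|LQ. trace (M k (t, x))) + \<epsilon> * (1/2)^(Suc k)"
    "\<And>k. Jfun \<rho> (v (Suc k)) (M (Suc k)) \<le> (1 - 1 / 800000) * Jfun \<rho> (v k) (M k)"
    by (rule approximating_sequence[OF assms]) blast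
  interpret limit_setup \<rho> U v M \<epsilon> g0
    by unfold_locales (use s assms in auto)
  show thesis
    using that[OF u_solution u_initial(1) u(1,2)] u_close s(1) by simp
qed

section \<open>Subsolutions over planar flows\<close>

definition plane_proj :: "real^3 \<Rightarrow> real^2" where "plane_proj x = vector [x $ 1, x $ 2]"

definition plane_incl :: "real^2 \<Rightarrow> real^3" where "plane_incl w = vector [w $ 1, w $ 2, 0]"

lemma planar_lift_eq: "planar_lift u0 x = plane_incl (u0 (plane_proj x))"
  by (simp add: planar_lift_def plane_incl_def plane_proj_def Let_def)

lemma bounded_linear_plane: "bounded_linear plane_proj" "bounded_linear plane_incl"
proof -
  have "linear plane_proj"
    by (rule linearI) (auto simp: plane_proj_def vec_eq_iff forall_2)
  then show "bounded_linear plane_proj" by (rule linear_conv_bounded_linear[THEN iffD1])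
  have "linear plane_incl"
    by (rule linearI) (auto simp: plane_incl_def vec_eq_iff forall_3)
  then show "bounded_linear plane_incl" by (rule linear_conv_bounded_linear[THEN iffD1])
qed

lemma plane_proj_axis:
  "plane_proj (axis 1 1) = axis 1 1" "plane_proj (axis 2 1) = axis 2 1" "plane_proj (axis 3 1) = 0"
  by (simp_all add: plane_proj_def vec_eq_iff forall_2 axis_def)

lemma plane_incl_nth: "plane_incl w $ 1 = w $ 1" "plane_incl w $ 2 = w $ 2" "plane_incl w $ 3 = 0"
  by (simp_all add: plane_incl_def)

text \<open>Lifts of smooth planar fields form a family closed under partial derivatives: a
  coordinate direction projects to a coordinate direction of the plane or, for the third, to
  0.\<close>

lemma planar_lift_smooth_periodic_divfree:
  fixes u0 :: "real^2 \<Rightarrow> real^2"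
  assumes s: "smooth_on UNIV u0" and p: "periodic u0" and d: "\<forall>x. divergence u0 x = 0"
  shows "smooth_periodic_divfree (planar_lift u0)"
proof -
  have der: "((\<lambda>x. plane_incl (f (plane_proj x))) has_derivative
      (\<lambda>h. plane_incl (frechet_derivative f (at (plane_proj x)) (plane_proj h)))) (at x)"
    if "smooth_on UNIV f" for f x
  proof -
    have "(f has_derivative frechet_derivative f (at (plane_proj x))) (at (plane_proj x))"
      using smooth_onD(1)[OF that] by (simp add: frechet_derivative_works)
    from has_derivative_compose[OF has_derivative_compose[OF bounded_linear_imp_has_derivative[OF bounded_linear_plane(1)] this]
        bounded_linear_imp_has_derivative[OF bounded_linear_plane(2)]]
    show ?thesis by simp
  qed
  have lift: "planar_lift u0 = (\<lambda>x. plane_incl (u0 (plane_proj x)))"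
    by (simp add: planar_lift_eq fun_eq_iff)
  note fd = frechet_derivative_at[OF der, symmetric]
  let ?F = "{\<lambda>x. plane_incl (f (plane_proj x)) |f. smooth_on UNIV f}"
  have "smooth_on UNIV (planar_lift u0)"
  proof (rule smooth_on_coinduct[where F = ?F])
    show "planar_lift u0 \<in> ?F" using s lift by blast
    show "f differentiable at x" if "f \<in> ?F" for f x
      using that der by (auto simp: differentiable_def)
    fix f :: "real^3 \<Rightarrow> real^3" and b :: "real^3" assume "f \<in> ?F" and b: "b \<in> Basis"
    then obtain g where g: "f = (\<lambda>x. plane_incl (g (plane_proj x)))" "smooth_on UNIV g" by blast
    have "plane_proj b \<in> Basis \<or> plane_proj b = 0"
    proof -
      obtain i where "b = axis i 1" using b by (auto simp: Basis_vec_def)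
      moreover have "i = 1 \<or> i = 2 \<or> i = 3" by (rule exhaust_3)
      ultimately show ?thesis using plane_proj_axis by (auto simp: axis_in_Basis_iff)
    qed
    then have "smooth_on UNIV (\<lambda>z. frechet_derivative g (at z) (plane_proj b))"
    proof
      assume "plane_proj b = 0"
      then have "(\<lambda>z. frechet_derivative g (at z) (plane_proj b)) = (\<lambda>z. 0)"
        using smooth_onD(1)[OF g(2)] linear_frechet_derivative linear_0 by (auto simp: fun_eq_iff)
      then show ?thesis by (simp add: smooth_on_const)
    qed (rule smooth_onD(2)[OF g(2)])
    then show "(\<lambda>x. frechet_derivative f (at x) b) \<in> ?F"
      unfolding g(1) fd[OF g(2)]
      by (intro CollectI exI[of _ "\<lambda>z. frechet_derivative g (at z) (plane_proj b)"]) simp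
  qed
  moreover have "periodic (planar_lift u0)"
  proof -
    have "plane_proj (x + axis i 1) = plane_proj x + plane_proj (axis i 1)" for x i
      by (rule linear_add[OF bounded_linear.linear[OF bounded_linear_plane(1)]])
    moreover have "u0 (z + plane_proj (axis i 1)) = u0 z" for z i
      using p exhaust_3[of i] by (auto simp: plane_proj_axis periodic_def)
    ultimately show ?thesis by (simp add: periodic_def planar_lift_eq)
  qed
  moreover have "divergence (planar_lift u0) x = 0" for x
    using d[rule_format, of "plane_proj x"] unfolding lift
    by (simp add: divergence_def partial_def sum_3 sum_2 fd[OF s] plane_proj_axis plane_incl_nth)
  ultimately show ?thesis by (simp add: smooth_periodic_divfree_def)
qed

lemma spd_continuous: "smooth_periodic_divfree U \<Longrightarrow> continuous_on S U"
  using smooth_onD(1) unfolding smooth_periodic_divfree_def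
  by (intro continuous_at_imp_continuous_on) (auto intro: differentiable_imp_continuous_within)

lemma adm_snd:
  assumes "continuous_on UNIV G"
  shows "adm (\<lambda>y. G (snd y))"
proof -
  have "uniformly_continuous_on Q3 G"
    by (intro compact_uniformly_continuous continuous_on_subset[OF assms]) auto
  then have "uniformly_continuous_on cyl (\<lambda>y. G (snd y))"
    unfolding uniformly_continuous_on_def
  proof (intro allI impI)
    fix e :: real assume "\<forall>e>0. \<exists>d>0. \<forall>x\<in>Q3. \<forall>x'\<in>Q3. dist x' x < d \<longrightarrow> dist (G x') (G x) < e" "e > 0"
    then obtain d where d: "d > 0" "\<forall>x\<in>Q3. \<forall>x'\<in>Q3. dist x' x < d \<longrightarrow> dist (G x') (G x) < e" by blast
    have "dist (G (snd y')) (G (snd y)) < e" if "y \<in> cyl" "y' \<in> cyl" "dist y' y < d" for y y'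
      using d(2) that dist_snd_le[of y' y] by (auto simp: mem_Times_iff)
    then show "\<exists>d>0. \<forall>y\<in>cyl. \<forall>y'\<in>cyl. dist y' y < d \<longrightarrow> dist (G (snd y')) (G (snd y)) < e"
      using d(1) by blast
  qed
  moreover have "continuous_on UNIV (\<lambda>y. G (snd y))"
    by (rule continuous_on_compose2[OF assms]) (auto intro!: continuous_intros)
  ultimately show ?thesis by (simp add: adm_def)
qed

text \<open>A field constant in time with zero stress solves the linear equation, for every
  continuous \<open>U\<close>. The time derivative of the pairing with the test field is integrated
  from 0 to a time beyond its support.\<close>

lemma wk_steady:
  assumes \<phi>: "test_field \<phi>" and U: "continuous_on UNIV U"
  shows "wk \<phi> (\<lambda>y. U (snd y)) (\<lambda>_. 0) + (LINT x|LQ. U x \<bullet> \<phi> 0 x) = 0"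
proof -
  obtain \<Phi>' T where "test_derivative \<phi> \<Phi>' T"
    using test_field_derivative[OF \<phi>] .
  note \<Phi> = test_derivativeD[OF this]
  \<comment> \<open>Strictly beyond \<open>T\<close> the test field vanishes, so only the endpoint 0
    contributes.\<close>
  define S where "S = T + 1"
  have S: "S > T" "S \<ge> 0" using \<Phi>(5) by (auto simp: S_def)
  have cU: "continuous_on A (\<lambda>y. U (snd y))" for A :: "(real \<times> (real^3)) set"
    using adm_snd[OF U] unfolding adm_def by (blast intro: continuous_on_subset)
  have cphi: "continuous_on hcyl (\<lambda>y. \<phi> (fst y) (snd y))"
    using has_derivative_continuous_on[OF \<Phi>(1)] by (simp add: case_prod_unfold)
  define f where "f t x = \<phi> t x \<bullet> U x" for t x
  define f' where "f' t x = \<Phi>' (t, x) (1, 0) \<bullet> U x" for t x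
  have cf: "continuous_on hcyl (\<lambda>y. f (fst y) (snd y))"
    unfolding f_def by (intro continuous_intros cphi cU)
  have cf': "continuous_on hcyl (\<lambda>y. f' (fst y) (snd y))"
    unfolding f'_def prod.collapse by (intro continuous_intros \<Phi>(2) cU)
  have slice: "continuous_on Q3 (f t)" "continuous_on Q3 (f' t)" if "t \<ge> 0" for t
  proof -
    have "continuous_on Q3 (\<lambda>x. (t, x))" "(\<lambda>x. (t, x)) ` Q3 \<subseteq> hcyl"
      using that by (auto intro!: continuous_intros)
    then show "continuous_on Q3 (f t)" "continuous_on Q3 (f' t)"
      using continuous_on_compose2[OF cf, of Q3 "\<lambda>x. (t, x)"] continuous_on_compose2[OF cf', of Q3 "\<lambda>x. (t, x)"] by auto
  qed
  have I: "(LINT x|LQ. f t x) = integral Q3 (f t)" "(LINT x|LQ. f' t x) = integral Q3 (f' t)" if "t \<ge> 0" for t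
    using slice[OF that] by (auto intro!: lebesgue_integral_eq_integral integrable_LQ_continuous)
  have d: "((\<lambda>t. integral Q3 (f t)) has_vector_derivative integral Q3 (f' t)) (at t within {0..S})" if t: "t \<in> {0..S}" for t
  proof (rule leibniz_rule_vector_derivative[OF _ _ _ t])
    show "((\<lambda>t. f t x) has_vector_derivative f' t x) (at t within {0..S})" if "t \<in> {0..S}" "x \<in> Q3" for t x
    proof -
      have "((\<lambda>s. \<phi> s x) has_vector_derivative \<Phi>' (t, x) (1, 0)) (at t within {0..})"
        by (rule slice_has_vector_derivative[OF \<Phi>(1)]) (use that in auto)
      then have "((\<lambda>s. \<phi> s x) has_vector_derivative \<Phi>' (t, x) (1, 0)) (at t within {0..S})"
        by (rule has_vector_derivative_within_subset) auto
      from bounded_linear.has_vector_derivative[OF bounded_linear_inner_left this, of "U x"]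
      show ?thesis by (simp add: f_def f'_def)
    qed
    show "f t integrable_on Q3" if "t \<in> {0..S}" for t
      using that by (intro integrable_continuous slice) auto
    show "continuous_on ({0..S} \<times> cbox 0 1) (\<lambda>(t, x). f' t x)"
      unfolding case_prod_unfold by (rule continuous_on_subset[OF cf']) auto
  qed simp
  have "((\<lambda>t. integral Q3 (f' t)) has_integral (integral Q3 (f S) - integral Q3 (f 0))) {0..S}"
    by (rule fundamental_theorem_of_calculus[OF S(2) d])
  moreover have "f S = (\<lambda>x. 0)" using \<Phi>(6)[OF S(1)] by (simp add: f_def fun_eq_iff)
  ultimately have "((\<lambda>t. integral Q3 (f' t)) has_integral - integral Q3 (f 0)) {0..S}" by simp
  then have "((\<lambda>t. if t \<in> {0..S} then integral Q3 (f' t) else 0) has_integral - integral Q3 (f 0)) {0..}"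
    by (subst has_integral_restrict) auto
  moreover have "(if t \<in> {0..S} then integral Q3 (f' t) else 0) = (LINT x|LQ. f' t x)" if "t \<ge> 0" for t
  proof (cases "t \<le> S")
    case False
    then have "f' t = (\<lambda>x. 0)" using S \<Phi>(7)[of t] by (simp add: f'_def fun_eq_iff)
    then show ?thesis using False by simp
  qed (use that I in simp)
  ultimately have hi: "((\<lambda>t. LINT x|LQ. f' t x) has_integral - integral Q3 (f 0)) {0..}"
    by (rule has_integral_eq[rotated]) simp
  have eq: "tpair \<phi> (\<lambda>y. U (snd y)) (\<lambda>_. 0) (t, x) = f' t x" if "t \<ge> 0" for t x
    using that by (simp add: tpair_def f'_def \<Phi>(3))
  have ts: "time_supp (tpair \<phi> (\<lambda>y. U (snd y)) (\<lambda>_. 0))"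
    by (intro time_supp_tpair \<phi> cU continuous_on_const)
  have sl: "(LINT x|LQ. tpair \<phi> (\<lambda>y. U (snd y)) (\<lambda>_. 0) (t, x)) = (LINT x|LQ. f' t x)" if "t \<in> space LT" for t
    using that by (simp add: eq space_restrict_space)
  have "wk \<phi> (\<lambda>y. U (snd y)) (\<lambda>_. 0) = (LINT t|LT. LINT x|LQ. f' t x)"
    unfolding wk_def space_time_int_def by (rule Bochner_Integration.integral_cong[OF refl], rule sl)
  moreover have "integrable LT (\<lambda>t. LINT x|LQ. f' t x)"
    using time_supp_integrable(2)[OF ts] by (subst Bochner_Integration.integrable_cong[OF refl sl[symmetric]])
  moreover from this have "(LINT t|LT. LINT x|LQ. f' t x) = integral {0..} (\<lambda>t. LINT x|LQ. f' t x)"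
    by (intro lebesgue_integral_eq_integral) auto
  moreover have "\<dots> = - integral Q3 (f 0)" using hi by (rule integral_unique)
  moreover have "integral Q3 (f 0) = (LINT x|LQ. U x \<bullet> \<phi> 0 x)"
    using I(1)[of 0] by (simp add: f_def inner_commute)
  ultimately show ?thesis by simp
qed

text \<open>The quadratic term is not balanced by the stress but outweighed by a large multiple of
  the identity, which acts as a pressure. So the initial field can simply be held fixed in
  time.\<close>

lemma steady_plus_increment_subsol:
  assumes U: "smooth_periodic_divfree U" and inc: "inc p P"
  obtains \<rho> where "subsol \<rho> U (\<lambda>y. U (snd y) + p y) P"
proof -
  note I = incD[OF inc]
  have cU: "continuous_on A U" for A by (rule spd_continuous[OF U])
  have aU: "adm (\<lambda>y. U (snd y))" by (rule adm_snd[OF cU])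
  obtain B where B: "\<And>y. norm (p y) \<le> B" "\<And>y. norm (P y) \<le> B" using I(4) by blast
  have "bounded (U ` Q3)" by (intro compact_imp_bounded compact_continuous_image cU) auto
  then obtain b where b: "\<And>x. x \<in> Q3 \<Longrightarrow> norm (U x) \<le> b" by (auto simp: bounded_iff)
  \<comment> \<open>\<open>3 * B\<close> dominates the form of \<open>P\<close> through
    \<open>qf_bound\<close>, \<open>(b + B)\<^sup>2\<close> dominates the square of the velocity,
    and the summand 1 gives strict positivity.\<close>
  define \<rho> where "\<rho> = 3 * B + (b + B)\<^sup>2 + 1"
  have vb: "norm (U (snd y) + p y) \<le> b + B" if "y \<in> cyl" for y
    using b[of "snd y"] B(1)[of y] that by (intro norm_triangle_le) auto
  have "subsol \<rho> U (\<lambda>y. U (snd y) + p y) P"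
    unfolding subsol_def
  proof (intro conjI ballI allI impI)
    show "continuous_on UNIV (\<lambda>y. U (snd y) + p y)"
      using aU I(1) by (auto simp: adm_def intro: continuous_on_add)
    show "continuous_on UNIV P" by (rule I(2))
    have "uniformly_continuous_on cyl p" by (rule uniformly_continuous_on_mono[OF I(3)]) simp
    then show "uniformly_continuous_on cyl (\<lambda>y. U (snd y) + p y)"
      using aU unfolding adm_def by (intro uniformly_continuous_on_add) auto
    have "norm (U (snd y) + p y) \<le> max (b + B) B \<and> norm (P y) \<le> max (b + B) B" if "y \<in> cyl" for y
      using vb[OF that] B(2)[of y] by auto
    then show "\<exists>C. \<forall>y\<in>cyl. norm (U (snd y) + p y) \<le> C \<and> norm (P y) \<le> C" by blast
    show "P y $ i $ j = P y $ j $ i" for y i j by (rule I(5))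
    show "U (snd (0, x)) + p (0, x) = U x" for x using I(6)[of "(0, x)"] by simp
    show "\<exists>f. smooth_periodic_divfree f \<and> (\<forall>x\<in>Q3. f x = U (snd (t, x)) + p (t, x))" for t
    proof -
      obtain f where "smooth_periodic_divfree f" "\<forall>x\<in>Q3. f x = p (t, x)" using I(7) by blast
      then show ?thesis
        using smooth_periodic_divfree_add[OF U] by (intro exI[of _ "\<lambda>x. U x + f x"]) auto
    qed
    show "wk \<phi> (\<lambda>y. U (snd y) + p y) P + (LINT x|LQ. U x \<bullet> \<phi> 0 x) = 0" if \<phi>: "test_field \<phi>" for \<phi>
    proof -
      have "wk \<phi> (\<lambda>y. U (snd y) + p y) (\<lambda>y. 0 + P y) = wk \<phi> (\<lambda>y. U (snd y)) (\<lambda>_. 0) + wk \<phi> p P"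
        using aU unfolding adm_def
        by (intro wk_add \<phi> continuous_on_const) (auto intro: continuous_on_subset I(1,2))
      then show ?thesis using wk_steady[OF \<phi> cU] I(8)[OF \<phi>] by simp
    qed
    fix y and z :: "real^3" assume y: "y \<in> cyl" and z: "z \<noteq> 0"
    let ?v = "U (snd y) + p y"
    have "(z \<bullet> ?v) * (?v \<bullet> z) \<le> (b + B)\<^sup>2 * (z \<bullet> z)"
    proof -
      have "(z \<bullet> ?v)\<^sup>2 \<le> (z \<bullet> z) * (?v \<bullet> ?v)" by (rule Cauchy_Schwarz_ineq)
      also have "\<dots> \<le> (z \<bullet> z) * (b + B)\<^sup>2"
        using power_mono[OF vb[OF y], of 2] by (intro mult_left_mono) (auto simp: dot_square_norm)
      finally show ?thesis by (simp add: power2_eq_square inner_commute mult.commute)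
    qed
    moreover have "- (3 * B * (z \<bullet> z)) \<le> qf (P y) z"
      using qf_bound[of "P y" z] mult_right_mono[OF mult_left_mono[OF B(2)[of y], of 3], of "z \<bullet> z"] by simp
    moreover have "z \<bullet> z > 0" using z by simp
    moreover have "qf (Emat \<rho> (\<lambda>y. U (snd y) + p y) P y) z = \<rho> * (z \<bullet> z) + qf (P y) z - (z \<bullet> ?v) * (?v \<bullet> z)"
      by (simp add: Emat_def qf_algebra)
    moreover have "\<rho> * (z \<bullet> z) = 3 * B * (z \<bullet> z) + (b + B)\<^sup>2 * (z \<bullet> z) + z \<bullet> z"
      by (simp add: \<rho>_def distrib_right)
    ultimately show "qf (Emat \<rho> (\<lambda>y. U (snd y) + p y) P y) z > 0" by linarith
  qed
  then show thesis by (rule that)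
qed

section \<open>Fields independent of the third coordinate\<close>

text \<open>The height comes first, so that in Fubini's theorem the outer integral runs over the
  third coordinate and the inner one over a horizontal slice.\<close>

definition join3 :: "real \<times> (real^2) \<Rightarrow> real^3" where
  "join3 z = vector [snd z $ 1, snd z $ 2, fst z]"

lemma join3_nth: "join3 z $ 1 = snd z $ 1" "join3 z $ 2 = snd z $ 2" "join3 z $ 3 = fst z"
  by (simp_all add: join3_def)

lemma bounded_linear_join3: "bounded_linear join3"
proof -
  have "linear join3"
    by (rule linearI) (auto simp: join3_nth vec_eq_iff forall_3)
  then show ?thesis by (rule linear_conv_bounded_linear[THEN iffD1])
qed

lemma prod_Basis_cart: "(\<Prod>b\<in>(Basis :: (real^'n) set). f b) = (\<Prod>i\<in>UNIV. f (axis i 1))"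
proof -
  have "(Basis :: (real^'n) set) = range (\<lambda>i. axis i 1)" by (auto simp: Basis_vec_def)
  moreover have "inj (\<lambda>i :: 'n. axis i (1::real))" by (simp add: inj_on_def axis_eq_axis)
  ultimately show ?thesis using prod.reindex[of "\<lambda>i :: 'n. axis i (1::real)" UNIV f] by (simp only: o_def)
qed

text \<open>A permutation of coordinates carries boxes to boxes with the same side lengths, and
  boxes determine Lebesgue measure.\<close>

lemma distr_join3: "distr lborel borel join3 = lborel"
proof (rule lborel_eqI[symmetric])
  have m: "join3 \<in> borel_measurable borel"
    by (intro borel_measurable_continuous_onI linear_continuous_on bounded_linear_join3)
  fix l u :: "real^3" assume le: "\<And>b. b \<in> Basis \<Longrightarrow> l \<bullet> b \<le> u \<bullet> b"
  have le': "l $ i \<le> u $ i" for i using le[of "axis i 1"] by (simp add: inner_axis axis_in_Basis_iff)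
  let ?l = "vector [l $ 1, l $ 2] :: real^2" and ?u = "vector [u $ 1, u $ 2] :: real^2"
  have vim: "join3 -` box l u = box (l $ 3) (u $ 3) \<times> box ?l ?u"
    by (auto simp: mem_box_cart forall_3 forall_2 join3_nth)
  have b3: "emeasure lborel (box (l $ 3) (u $ 3)) = ennreal (u $ 3 - l $ 3)"
    using le'[of 3] by (simp add: box_real)
  have "emeasure lborel (box ?l ?u) = (\<Prod>b\<in>Basis. (?u - ?l) \<bullet> b)"
  proof (intro emeasure_lborel_box)
    fix b :: "real^2" assume "b \<in> Basis"
    then obtain i where "b = axis i 1" by (auto simp: Basis_vec_def)
    then show "?l \<bullet> b \<le> ?u \<bullet> b" using le'[of 1] le'[of 2] exhaust_2[of i] by (auto simp: inner_axis)
  qed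
  also have "(\<Prod>b\<in>Basis. (?u - ?l) \<bullet> b) = (u $ 1 - l $ 1) * (u $ 2 - l $ 2)"
    by (simp add: prod_Basis_cart inner_axis UNIV_2)
  finally have b12: "emeasure lborel (box ?l ?u) = ennreal ((u $ 1 - l $ 1) * (u $ 2 - l $ 2))" .
  have "emeasure (distr lborel borel join3) (box l u) = emeasure lborel (join3 -` box l u)"
    using m by (subst emeasure_distr) auto
  also have "\<dots> = emeasure (lborel \<Otimes>\<^sub>M lborel) (box (l $ 3) (u $ 3) \<times> box ?l ?u)"
    unfolding vim lborel_prod ..
  also have "\<dots> = emeasure lborel (box (l $ 3) (u $ 3)) * emeasure lborel (box ?l ?u)"
    by (intro lborel.emeasure_pair_measure_Times) auto
  also have "\<dots> = ennreal ((u $ 3 - l $ 3) * ((u $ 1 - l $ 1) * (u $ 2 - l $ 2)))"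
    using le'[of 1] le'[of 2] le'[of 3] unfolding b3 b12 by (simp add: ennreal_mult)
  also have "\<dots> = ennreal (\<Prod>b\<in>Basis. (u - l) \<bullet> b)"
    unfolding prod_Basis_cart UNIV_3 by (simp add: inner_axis ac_simps)
  finally show "emeasure (distr lborel borel join3) (box l u) = ennreal (\<Prod>b\<in>Basis. (u - l) \<bullet> b)" .
qed simp

lemma integral_join3:
  fixes H :: "real^3 \<Rightarrow> real"
  assumes "integrable lborel H"
  shows "integrable (lborel \<Otimes>\<^sub>M lborel) (\<lambda>z. H (join3 z))"
    and "(LINT x|lborel. H x) = (LINT s|lborel. LINT y|lborel. H (join3 (s, y)))"
proof -
  have m: "join3 \<in> measurable lborel borel"
    using borel_measurable_continuous_onI[OF linear_continuous_on[OF bounded_linear_join3]] by simp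
  have Hm: "H \<in> borel_measurable borel" using assms by auto
  have "integrable (distr lborel borel join3) H" using assms by (simp add: distr_join3)
  then show i: "integrable (lborel \<Otimes>\<^sub>M lborel) (\<lambda>z. H (join3 z))"
    unfolding lborel_prod using integrable_distr_eq[OF m Hm] by simp
  have "(LINT x|lborel. H x) = (LINT z|lborel. H (join3 z))"
    using integral_distr[OF m Hm] by (simp add: distr_join3)
  also have "\<dots> = (LINT s|lborel. LINT y|lborel. H (join3 (s, y)))"
    using lborel_pair.integral_fst'[OF i] by (simp add: lborel_prod)
  finally show "(LINT x|lborel. H x) = (LINT s|lborel. LINT y|lborel. H (join3 (s, y)))" .
qed

lemma AE_lebesgue_on_iff_lborel:
  assumes "S \<in> sets borel"
  shows "(AE x in lebesgue_on S. P x) \<longleftrightarrow> (AE x in lborel. x \<in> S \<longrightarrow> P x)"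
  using assms by (subst AE_restrict_space_iff) (auto simp: AE_completion_iff)

text \<open>For almost every height \<open>s\<close> the slice of \<open>F\<close> is a fixed function of the horizontal
  variables, so the vertical integral of the weight can be carried out first.\<close>

lemma ei_x3_orthogonal:
  assumes Fm: "F \<in> borel_measurable borel" and Fi: "integrable LQ F" and ei: "ei_x3 F"
    and A: "continuous_on UNIV A" "\<And>x. x \<notin> box 0 1 \<Longrightarrow> A x = 0"
    and mean: "\<And>y. (LINT s|lborel. A (join3 (s, y))) = 0"
  shows "(LINT x|LQ. F x * A x) = 0"
proof -
  define G where "G x = indicator Q3 x * F x" for x
  have bQ: "box 0 1 \<subseteq> Q3" by (rule box_subset_cbox)
  have GA: "G x * A x = F x * A x" for x using A(2)[of x] bQ by (auto simp: G_def indicator_def)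
  have Gi: "integrable lborel G"
    using Fi Fm unfolding G_def by (subst (asm) integral_lebesgue_on_eq_lborel(2)) auto
  have "bounded (A ` Q3)" by (intro compact_imp_bounded compact_continuous_image continuous_on_subset[OF A(1)]) auto
  then obtain C where C: "\<And>x. x \<in> Q3 \<Longrightarrow> \<bar>A x\<bar> \<le> C" by (auto simp: bounded_iff)
  have Cb: "\<bar>A x\<bar> \<le> \<bar>C\<bar>" for x
  proof (cases "x \<in> Q3")
    case True
    then show ?thesis using C[of x] by linarith
  next
    case False
    then have "A x = 0" using bQ by (intro A(2)) blast
    then show ?thesis by simp
  qed
  have Am: "A \<in> borel_measurable borel" by (rule borel_measurable_continuous_onI[OF A(1)])
  have GAi: "integrable lborel (\<lambda>x. G x * A x)"
  proof (rule Bochner_Integration.integrable_bound[OF integrable_mult_right[OF Gi, of C]])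
    show "(\<lambda>x. G x * A x) \<in> borel_measurable lborel" using Gi Am by auto
    show "AE x in lborel. norm (G x * A x) \<le> norm (C * G x)"
      using Cb by (intro AE_I2) (auto simp: abs_mult mult.commute intro: mult_right_mono)
  qed
  have join_box: "join3 (s, y) \<in> box 0 1 \<longleftrightarrow> s \<in> {0<..<1} \<and> y \<in> box 0 1" for s y
    by (auto simp: mem_box_cart forall_3 forall_2 join3_nth)
  have join_Q: "join3 (s, y) \<in> Q3 \<longleftrightarrow> s \<in> {0..1} \<and> y \<in> cbox 0 1" for s y
    by (auto simp: mem_box_cart forall_3 forall_2 join3_nth)
  have ei': "AE a in lborel. a \<in> {0<..<1} \<longrightarrow> (AE b in lborel. b \<in> {0<..<1} \<longrightarrow>
      (AE y in lborel. y \<in> cbox 0 1 \<longrightarrow> F (join3 (a, y)) = F (join3 (b, y))))"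
    using ei unfolding ei_x3_def join3_def by (simp add: AE_lebesgue_on_iff_lborel)
  have sl: "AE s in lborel. integrable lborel (\<lambda>y. G (join3 (s, y)))"
    using lborel_pair.AE_integrable_fst'[OF integral_join3(1)[OF Gi]] .
  have not0: "\<not> (AE s in lborel. s \<notin> {0<..<1 :: real})"
  proof
    assume "AE s in lborel. s \<notin> {0<..<1 :: real}"
    then have "{0<..<1 :: real} \<in> null_sets lborel" by (subst AE_iff_null_sets) auto
    then show False by (simp add: null_sets_def)
  qed
  \<comment> \<open>The unit interval is not null, so some height \<open>a\<close> satisfies both
    almost-everywhere statements; its slice represents almost all slices.\<close>
  have "\<exists>a. a \<in> {0<..<1} \<and> integrable lborel (\<lambda>y. G (join3 (a, y))) \<and> (AE b in lborel. b \<in> {0<..<1} \<longrightarrow>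
      (AE y in lborel. y \<in> cbox 0 1 \<longrightarrow> F (join3 (a, y)) = F (join3 (b, y))))"
  proof (rule ccontr)
    assume n: "\<not> ?thesis"
    have "AE s in lborel. s \<notin> {0<..<1 :: real}"
      using ei' sl by eventually_elim (use n in blast)
    then show False using not0 by blast
  qed
  then obtain a where a: "a \<in> {0<..<1}" "integrable lborel (\<lambda>y. G (join3 (a, y)))"
    "AE b in lborel. b \<in> {0<..<1} \<longrightarrow> (AE y in lborel. y \<in> cbox 0 1 \<longrightarrow> F (join3 (a, y)) = F (join3 (b, y)))" by blast
  define H where "H y = G (join3 (a, y))" for y
  have Hi: "integrable lborel H" using a(2) by (simp add: H_def [abs_def])
  have jm: "join3 \<in> borel_measurable borel"
    by (intro borel_measurable_continuous_onI linear_continuous_on bounded_linear_join3)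
  have Aj: "(\<lambda>z. A (join3 z)) \<in> borel_measurable (lborel \<Otimes>\<^sub>M lborel)"
    unfolding lborel_prod using measurable_compose[OF jm Am] by simp
  have Hm: "(\<lambda>z. H (snd z)) \<in> borel_measurable (lborel \<Otimes>\<^sub>M lborel)"
    using Hi by (intro measurable_compose[OF measurable_snd]) auto
  have HAm: "(\<lambda>z. H (snd z) * A (join3 z)) \<in> borel_measurable (lborel \<Otimes>\<^sub>M lborel)"
    by (intro borel_measurable_times Hm Aj)
  have GAm: "(\<lambda>z. G (join3 z) * A (join3 z)) \<in> borel_measurable (lborel \<Otimes>\<^sub>M lborel)"
    using integral_join3(1)[OF GAi] by auto
  have m1: "(\<lambda>s. LINT y|lborel. G (join3 (s, y)) * A (join3 (s, y))) \<in> borel_measurable lborel"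
    by (rule lborel.borel_measurable_lebesgue_integral) (use GAm in \<open>simp add: case_prod_beta'\<close>)
  have m2: "(\<lambda>s. LINT y|lborel. H y * A (join3 (s, y))) \<in> borel_measurable lborel"
    by (rule lborel.borel_measurable_lebesgue_integral) (use HAm in \<open>simp add: case_prod_beta'\<close>)
  have sec: "(\<lambda>y. A (join3 (s, y))) \<in> borel_measurable lborel" for s
    using measurable_compose[OF measurable_Pair1' Aj, of s] by simp
  have AEs: "AE s in lborel. (LINT y|lborel. G (join3 (s, y)) * A (join3 (s, y))) = (LINT y|lborel. H y * A (join3 (s, y)))"
    using a(3) sl
  proof eventually_elim
    case (elim s)
    show ?case
    proof (cases "s \<in> {0<..<1}")
      case True
      then have "AE y in lborel. y \<in> cbox 0 1 \<longrightarrow> F (join3 (a, y)) = F (join3 (s, y))" using elim(1) by blast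
      then have "AE y in lborel. G (join3 (s, y)) * A (join3 (s, y)) = H y * A (join3 (s, y))"
      proof eventually_elim
        case (elim y)
        then show ?case using True a(1) by (cases "y \<in> cbox 0 1") (auto simp: H_def G_def join_Q)
      qed
      then show ?thesis
        using elim(2) Hi sec by (intro integral_cong_AE borel_measurable_times) auto
    next
      case False
      then have "A (join3 (s, y)) = 0" for y using A(2) join_box by blast
      then show ?thesis by simp
    qed
  qed
  have i01: "integrable lborel (\<lambda>s :: real. indicator {0..1} s * c :: real)" for c
    by (intro integrable_mult_left integrable_real_indicator) auto
  have HAi: "integrable (lborel \<Otimes>\<^sub>M lborel) (\<lambda>(s, y). H y * A (join3 (s, y)))"
  proof -
    have b: "norm (H y * A (join3 (s, y))) \<le> indicator {0..1} s * \<bar>C\<bar> * norm (H y)" for s y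
    proof (cases "s \<in> {0..1}")
      case True
      then show ?thesis using mult_left_mono[OF Cb[of "join3 (s, y)"], of "\<bar>H y\<bar>"] by (simp add: abs_mult mult.commute)
    next
      case False
      then show ?thesis using A(2)[of "join3 (s, y)"] by (auto simp: join_box)
    qed
    have iy: "integrable lborel (\<lambda>y. H y * A (join3 (s, y)))" for s
      by (rule Bochner_Integration.integrable_bound[OF integrable_mult_right[OF integrable_norm[OF Hi], of "indicator {0..1} s * \<bar>C\<bar>"]])
        (use Hi sec b[of _ s] in \<open>auto intro!: AE_I2 order_trans[OF b abs_ge_self]\<close>)
    have "integrable lborel (\<lambda>s. LINT y|lborel. norm (H y * A (join3 (s, y))))"
    proof (rule Bochner_Integration.integrable_bound[OF i01[of "\<bar>C\<bar> * (LINT y|lborel. norm (H y))"]])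
      show "(\<lambda>s. LINT y|lborel. norm (H y * A (join3 (s, y)))) \<in> borel_measurable lborel"
        by (rule lborel.borel_measurable_lebesgue_integral)
          (use borel_measurable_abs[OF HAm] in \<open>simp add: case_prod_beta'\<close>)
      have "(LINT y|lborel. norm (H y * A (join3 (s, y)))) \<le> (LINT y|lborel. indicator {0..1} s * \<bar>C\<bar> * norm (H y))" for s
        using iy[of s] Hi b by (intro integral_mono integrable_norm integrable_mult_right) auto
      then show "AE s in lborel. norm (LINT y|lborel. norm (H y * A (join3 (s, y))))
          \<le> norm (indicator {0..1} s * (\<bar>C\<bar> * (LINT y|lborel. norm (H y))))"
        by (intro AE_I2) (simp add: mult.assoc abs_mult)
    qed
    then show ?thesis
      using HAm iy by (intro lborel_pair.Fubini_integrable) (auto simp: case_prod_beta')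
  qed
  have "(LINT x|LQ. F x * A x) = (LINT x|lborel. G x * A x)"
    using Fm Am by (subst integral_lebesgue_on_eq_lborel(1)) (auto simp: G_def mult.assoc)
  also have "\<dots> = (LINT s|lborel. LINT y|lborel. G (join3 (s, y)) * A (join3 (s, y)))"
    by (rule integral_join3(2)[OF GAi])
  also have "\<dots> = (LINT s|lborel. LINT y|lborel. H y * A (join3 (s, y)))"
    by (rule integral_cong_AE[OF m1 m2 AEs])
  \<comment> \<open>\<open>H\<close> does not depend on the height, so after the exchange the inner
    integral is \<open>H y\<close> times the vertical mean of the weight.\<close>
  also have "\<dots> = (LINT y|lborel. LINT s|lborel. H y * A (join3 (s, y)))"
    by (rule lborel_pair.Fubini_integral[OF HAi, symmetric])
  also have "\<dots> = 0" by (simp add: mean)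
  finally show ?thesis .
qed

section \<open>The seed wave and its probe\<close>

lemma cutoff_second_derivative_centre:
  assumes "r > 0"
  shows "eval (dd s (dd s (cutoff y0 r))) y0 = - 2 * (s \<bullet> s) / r\<^sup>2"
proof -
  define q where "q = Plus (Cst (1 - (y0 \<bullet> y0) / r\<^sup>2)) (Plus (Lin ((2 / r\<^sup>2) *\<^sub>R y0)) (Times (Cst (- 1 / r\<^sup>2)) Sqn))"
  have q: "eval q y0 = 1" "eval (dd s q) y0 = 0" "eval (dd s (dd s q)) y0 = - 2 * (s \<bullet> s) / r\<^sup>2"
    using assms by (auto simp: q_def inner_commute field_simps)
  have c: "cutoff y0 r = Flat [:exp 1:] q" by (simp add: cutoff_def q_def)
  \<comment> \<open>At the centre \<open>q\<close> equals 1 with zero gradient, and exp(1 - 1/g) has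
    derivative 1 at g = 1, so only the second derivative of \<open>q\<close> survives. Its value
    makes \<open>seed_weight\<close> nonzero at the centre.\<close>
  have "[:0, 0, 1:] * ([:exp 1:] - pderiv [:exp 1:]) = [:0, 0, exp (1::real):]" by simp
  then have f: "flat ([:0, 0, 1:] * ([:exp 1:] - pderiv [:exp 1:])) 1 = 1"
    by (simp add: flat_def mult_exp_exp)
  have "eval (dd s (dd s (Flat [:exp 1:] q))) y0
      = eval (dd s (Flat ([:0, 0, 1:] * ([:exp 1:] - pderiv [:exp 1:])) q)) y0 * eval (dd s q) y0
        + flat ([:0, 0, 1:] * ([:exp 1:] - pderiv [:exp 1:])) (eval q y0) * eval (dd s (dd s q)) y0"
    by (simp only: dd.simps eval.simps)
  then show ?thesis unfolding c q f by simp
qed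

definition seed_point :: "real \<times> (real^3)" where "seed_point = (1, \<chi> i. 1 / 2)"

definition seed :: "real \<Rightarrow> (real \<times> (real^3)) expr" where
  "seed \<alpha> = Times (Cst \<alpha>) (cutoff seed_point (1 / 4))"

text \<open>For the wave \<open>pw (seed \<alpha>)\<close> with \<open>w = axis 1 1\<close> and
  \<open>\<xi> = axis 3 1\<close>, the first component is \<open>\<alpha>\<close> times this
  function. Being a derivative in the third coordinate it has mean zero on every vertical line, so
  fields independent of \<open>x\<^sub>3\<close> do not see it.\<close>

definition seed_weight :: "real \<times> (real^3) \<Rightarrow> real" where
  "seed_weight = eval (dd (0, axis 3 1) (dd (0, axis 3 1) (cutoff seed_point (1 / 4))))"

lemma seed_support: "cball seed_point (1 / 4) \<subseteq> ocyl"
  "y \<notin> cball seed_point (1 / 4) \<Longrightarrow> eval (seed \<alpha>) y = 0"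
  "y \<notin> cball seed_point (1 / 4) \<Longrightarrow> eval (cutoff seed_point (1 / 4)) y = 0"
  "y \<notin> cball seed_point (1 / 4) \<Longrightarrow> seed_weight y = 0"
proof -
  show "cball seed_point (1 / 4) \<subseteq> ocyl"
  proof
    fix y assume y: "y \<in> cball seed_point (1 / 4)"
    have "\<bar>1 - fst y\<bar> \<le> 1 / 4"
      using y dist_fst_le[of seed_point y] by (simp add: seed_point_def dist_real_def)
    moreover have s: "\<bar>1 / 2 - snd y $ i\<bar> \<le> 1 / 4" for i
      using y dist_snd_le[of seed_point y] dist_vec_nth_le[of "snd seed_point" i "snd y"]
      by (simp add: seed_point_def dist_real_def)
    have "0 < snd y $ i \<and> snd y $ i < 1" for i using s[of i] by linarith
    ultimately show "y \<in> ocyl" by (cases y) (auto simp: mem_box_cart abs_if split: if_splits)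
  qed
  have c: "eval (cutoff seed_point (1 / 4)) y = 0" if "y \<notin> cball seed_point (1 / 4)" for y
    by (rule cutoff_bounds(3)) (use that in auto)
  then show "y \<notin> cball seed_point (1 / 4) \<Longrightarrow> eval (cutoff seed_point (1 / 4)) y = 0"
    "y \<notin> cball seed_point (1 / 4) \<Longrightarrow> eval (seed \<alpha>) y = 0" by (simp_all add: seed_def)
  have "eval (dd a (cutoff seed_point (1 / 4))) y = 0" if "y \<notin> cball seed_point (1 / 4)" for a y
    using eval_dd_zero_outside[OF closed_cball _ that] c by blast
  then show "y \<notin> cball seed_point (1 / 4) \<Longrightarrow> seed_weight y = 0"
    unfolding seed_weight_def using eval_dd_zero_outside[OF closed_cball] by blast
qed

lemma continuous_seed_weight: "continuous_on S seed_weight"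
  unfolding seed_weight_def by (intro continuous_on_eval continuous_on_id)

lemma seed_weight_mean: "(LINT s|lborel. seed_weight (t, join3 (s, y))) = 0"
proof -
  let ?e = "dd (0, axis 3 1) (cutoff seed_point (1 / 4))"
  have j: "join3 (s + d, y) = join3 (s, y) + d *\<^sub>R axis 3 1" for s d
    by (simp add: vec_eq_iff forall_3 join3_nth axis_def)
  have der: "((\<lambda>s. eval ?e (t, join3 (s, y))) has_derivative (\<lambda>d. d * seed_weight (t, join3 (s, y)))) (at s)" for s
  proof -
    have "((\<lambda>s. (t, join3 (0, y) + s *\<^sub>R axis 3 1)) has_derivative (\<lambda>d. (0, d *\<^sub>R axis 3 1))) (at s)"
      by (auto intro!: derivative_eq_intros)
    from has_derivative_compose[OF this has_derivative_eval, of ?e]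
    have "((\<lambda>s. eval ?e (t, join3 (0 + s, y))) has_derivative (\<lambda>d. eval (dd (d *\<^sub>R (0, axis 3 1)) ?e) (t, join3 (0 + s, y)))) (at s)"
      unfolding j by simp
    then show ?thesis unfolding eval_dd_scaleR by (simp add: seed_weight_def)
  qed
  have "(LINT s|lborel. 1 * seed_weight (t, join3 (s, y))) = 0"
  proof (rule integral_dir_deriv_zero[OF der, where d = 1 and K = "{0..1}"])
    have "continuous_on UNIV (\<lambda>s. join3 (s, y))"
      by (rule continuous_on_compose2[OF linear_continuous_on[OF bounded_linear_join3]]) (auto intro!: continuous_intros)
    then show "continuous_on UNIV (\<lambda>s. 1 * seed_weight (t, join3 (s, y)))"
      by (intro continuous_intros continuous_on_compose2[OF continuous_seed_weight[of UNIV]]) auto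
    show "eval ?e (t, join3 (s, y)) = 0" if "s \<notin> {0..1}" for s
    proof -
      have "join3 (s, y) \<notin> box 0 1" using that by (auto simp: mem_box_cart forall_3 join3_nth)
      then have "(t, join3 (s, y)) \<notin> cball seed_point (1 / 4)" using seed_support(1) by blast
      from eval_dd_zero_outside[OF closed_cball _ this] show ?thesis using seed_support(3) by blast
    qed
  qed simp
  then show ?thesis by simp
qed

text \<open>The shape of the first component of the seed wave frozen at time 1, so that its pairing
  with the seed at that time is a multiple of the integral of a square.\<close>

definition probe :: "real^3 \<Rightarrow> real^3" where "probe x = seed_weight (1, x) *\<^sub>R axis 1 1"

lemma continuous_probe: "continuous_on S probe"
  unfolding probe_def by (intro continuous_intros continuous_slice continuous_seed_weight)

lemma ei_x3_field_orthogonal: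
  assumes f: "f \<in> borel_measurable borel" "f \<in> L2" and ei: "ei_x3_field f"
  shows "L2_inner f probe = 0"
proof -
  have "(LINT x|LQ. f x $ 1 * seed_weight (1, x)) = 0"
  proof (rule ei_x3_orthogonal)
    show "(\<lambda>x. f x $ 1) \<in> borel_measurable borel"
      by (rule measurable_compose[OF f(1)]) (intro borel_measurable_continuous_onI continuous_intros)
    have "integrable LQ (\<lambda>x. f x \<bullet> axis 1 1)"
      by (intro L2_inner_integrable f continuous_in_L2 continuous_on_const)
    then show "integrable LQ (\<lambda>x. f x $ 1)" by (simp add: inner_axis)
    show "ei_x3 (\<lambda>x. f x $ 1)" using ei by (simp add: ei_x3_field_def)
    show "continuous_on UNIV (\<lambda>x. seed_weight (1, x))" by (intro continuous_slice continuous_seed_weight)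
    show "seed_weight (1, x) = 0" if "x \<notin> box 0 1" for x
      using seed_support(1,4) that by blast
    show "(LINT s|lborel. seed_weight (1, join3 (s, y))) = 0" for y by (rule seed_weight_mean)
  qed
  then show ?thesis by (simp add: L2_inner_def probe_def inner_axis mult.commute)
qed

definition seed_overlap :: "real \<Rightarrow> real" where
  "seed_overlap t = (LINT x|LQ. seed_weight (t, x) * seed_weight (1, x))"

text \<open>At time 1 the overlap is the integral of a continuous square that is nonzero at the
  centre. Continuity in time spreads positivity to an open set of times, as needed because
  \<open>ei_x3_evolution\<close> ignores null sets of times.\<close>

lemma seed_overlap: "continuous_on UNIV seed_overlap" "seed_overlap 1 > 0"
proof -
  have c: "continuous_on UNIV (\<lambda>y :: real \<times> (real^3). seed_weight y * seed_weight (1, snd y))"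
    by (intro continuous_intros continuous_on_compose2[OF continuous_seed_weight[of UNIV]]) auto
  show "continuous_on UNIV seed_overlap"
    unfolding seed_overlap_def [abs_def]
    using continuous_on_integral_LQ[of UNIV "\<lambda>y. seed_weight y * seed_weight (1, snd y)"] continuous_on_subset[OF c]
    by simp
  let ?g = "\<lambda>x. (seed_weight (1, x))\<^sup>2"
  have cg: "continuous_on S ?g" for S by (intro continuous_intros continuous_slice continuous_seed_weight)
  let ?c = "(\<chi> i. 1 / 2) :: real^3"
  have "seed_weight (1, ?c) \<noteq> 0"
    using cutoff_second_derivative_centre[of "1 / 4" "(0, axis 3 1)" seed_point]
    by (simp add: seed_weight_def seed_point_def)
  moreover have "?c \<in> Q3" by (simp add: mem_box_cart)
  moreover have "seed_overlap 1 = integral Q3 ?g"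
    unfolding seed_overlap_def power2_eq_square[symmetric]
    by (intro lebesgue_integral_eq_integral integrable_LQ_continuous cg) auto
  moreover have "integral Q3 ?g \<ge> 0" by (intro integral_nonneg integrable_continuous cg) auto
  moreover have "integral Q3 ?g \<noteq> 0"
  proof
    assume "integral Q3 ?g = 0"
    then have "(?g has_integral 0) (cbox 0 1)"
      using integrable_continuous[OF cg] by (metis integrable_integral)
    moreover have "?c \<in> box 0 1" by (simp add: mem_box_cart)
    moreover note \<open>?c \<in> Q3\<close>
    ultimately have "?g ?c = 0"
      using has_integral_0_cbox_imp_0[of 0 1 ?g ?c, OF cg] by (metis empty_iff zero_le_power2)
    then show False using \<open>seed_weight (1, ?c) \<noteq> 0\<close> by simp
  qed
  ultimately show "seed_overlap 1 > 0" by linarith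
qed

lemma eq_ae_L2_inner: "eq_ae f g \<Longrightarrow> f \<in> L2 \<Longrightarrow> g \<in> L2 \<Longrightarrow> h \<in> L2 \<Longrightarrow> L2_inner f h = L2_inner g h"
  unfolding L2_inner_def eq_ae_def
  by (intro integral_cong_AE) (auto dest: L2_inner_integrable elim!: eventually_mono)

text \<open>\<open>U\<close> is orthogonal to the probe, so the first subsolution pairs with it to
  \<open>\<alpha> * seed_overlap t\<close>, and the iteration moves this by at most an eighth of the
  value at time 1. Near time 1 the pairing stays positive, whereas it vanishes for fields
  independent of \<open>x\<^sub>3\<close>.\<close>

lemma seeded_solution:
  assumes U: "smooth_periodic_divfree U" and eiU: "ei_x3_field U" and \<alpha>: "\<alpha> > 0"
  shows "\<exists>u. Euler_weak_solution U u \<and> eq_ae (u 0) U \<and> \<not> ei_x3_evolution u \<and> u 1 \<in> L2 \<and>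
    \<bar>L2_inner (u 1) probe - \<alpha> * seed_overlap 1\<bar> \<le> \<alpha> * seed_overlap 1 / 8"
proof -
  let ?w = "axis 1 1 :: real^3" and ?\<xi> = "axis 3 1 :: real^3"
  define p where "p = pw (seed \<alpha>) ?w ?\<xi>"
  have inc: "inc p (Pw (seed \<alpha>) ?w ?\<xi> 0)"
    unfolding p_def by (rule wave_inc[OF seed_support(1,2)])
  obtain \<rho> where sub: "subsol \<rho> U (\<lambda>y. U (snd y) + p y) (Pw (seed \<alpha>) ?w ?\<xi> 0)"
    using steady_plus_increment_subsol[OF U inc] .
  define h1 where "h1 = seed_overlap 1"
  have h1: "h1 > 0" using seed_overlap(2) by (simp add: h1_def)
  \<comment> \<open>An eighth is below the half that the overlap keeps near time 1, and it is small
    enough that amplitudes differing by a factor 4 give disjoint ranges for the pairing.\<close>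
  have \<epsilon>: "\<alpha> * h1 / 8 > 0" using \<alpha> h1 by simp
  obtain u where u: "Euler_weak_solution U u" "eq_ae (u 0) U"
    "\<And>t. t \<ge> 0 \<Longrightarrow> u t \<in> borel_measurable borel" "\<And>t. t \<ge> 0 \<Longrightarrow> u t \<in> L2"
    "\<And>t. t \<ge> 0 \<Longrightarrow> \<bar>L2_inner (u t) (\<lambda>x. probe (snd (t, x))) -
      L2_inner (\<lambda>x. U (snd (t, x)) + p (t, x)) (\<lambda>x. probe (snd (t, x)))\<bar> \<le> \<alpha> * h1 / 8"
    by (rule subsolution_to_solution[OF sub adm_snd[OF continuous_probe] \<epsilon>]) blast
  have cU: "continuous_on S U" for S by (rule spd_continuous[OF U])
  have UL: "U \<in> L2" by (rule continuous_in_L2[OF cU])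
  have U0: "L2_inner U probe = 0"
    by (rule ei_x3_field_orthogonal[OF borel_measurable_continuous_onI[OF cU] UL eiU])
  have cp: "continuous_on UNIV p" using incD(1)[OF inc] .
  have ov: "L2_inner (\<lambda>x. U x + p (t, x)) probe = \<alpha> * seed_overlap t" for t
  proof -
    have pL: "(\<lambda>x. p (t, x)) \<in> L2" by (intro continuous_in_L2 continuous_slice cp)
    have "L2_inner (\<lambda>x. U x + p (t, x)) probe = L2_inner (\<lambda>x. p (t, x)) probe"
      using L2_inner_algebra(1)[OF UL pL continuous_in_L2[OF continuous_probe]] U0 by simp
    also have "\<dots> = (LINT x|LQ. \<alpha> * (seed_weight (t, x) * seed_weight (1, x)))"
      unfolding L2_inner_def
      by (intro Bochner_Integration.integral_cong refl)
        (simp add: p_def pw_def seed_def probe_def seed_weight_def inner_diff_left inner_axis_axis)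
    finally show ?thesis by (simp add: seed_overlap_def)
  qed
  have close: "\<bar>L2_inner (u t) probe - \<alpha> * seed_overlap t\<bar> \<le> \<alpha> * h1 / 8" if "t \<ge> 0" for t
    using u(5)[OF that] unfolding snd_conv ov .
  have "open (seed_overlap -` {h1 / 2<..})"
    by (intro open_vimage seed_overlap open_greaterThan)
  then have "open (seed_overlap -` {h1 / 2<..} \<inter> {0<..})" (is "open ?I") by (intro open_Int) auto
  have "1 \<in> ?I" using h1 by (simp add: h1_def)
  have "\<not> ei_x3_evolution u"
  proof
    assume "ei_x3_evolution u"
    then have "AE t in lebesgue. t \<in> {0..} \<longrightarrow> ei_x3_field (u t)"
      unfolding ei_x3_evolution_def by (subst (asm) AE_restrict_space_iff) auto
    then have "AE t in lebesgue. t \<notin> ?I"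
    proof eventually_elim
      case (elim t)
      show ?case
      proof
        assume t: "t \<in> ?I"
        then have "t \<ge> 0" by simp
        then have "L2_inner (u t) probe = 0" using elim u(3,4) by (intro ei_x3_field_orthogonal) auto
        then have "\<alpha> * seed_overlap t \<le> \<alpha> * h1 / 8" using close[OF \<open>t \<ge> 0\<close>] by simp
        moreover have "\<alpha> * (h1 / 2) < \<alpha> * seed_overlap t" using t \<alpha> by (intro mult_strict_left_mono) auto
        ultimately show False using \<epsilon> by simp
      qed
    qed
    then have "?I \<in> null_sets lebesgue"
      using \<open>open ?I\<close> by (subst AE_iff_null_sets) auto
    then have "negligible ?I" by (simp add: negligible_iff_null_sets)
    then show False using open_not_negligible[OF \<open>open ?I\<close>] \<open>1 \<in> ?I\<close> by blast
  qed
  then show ?thesis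
    using u(1,2) u(4)[of 1] close[of 1] by (auto simp: h1_def)
qed

theorem theorem4p1:
  fixes u0 :: "real^2 \<Rightarrow> real^2"
  assumes "smooth_on UNIV u0" and "periodic u0" and "\<forall>x. divergence u0 x = 0"
  shows "(\<exists>u. Euler_weak_solution (planar_lift u0) u \<and>
              eq_ae (u 0) (planar_lift u0) \<and> \<not> ei_x3_evolution u) \<and>
         (\<exists>S. infinite S \<and>
              pairwise (\<lambda>u v. \<exists>t\<ge>0. \<not> eq_ae (u t) (v t)) S \<and>
              (\<forall>u\<in>S. Euler_weak_solution (planar_lift u0) u \<and>
                     eq_ae (u 0) (planar_lift u0) \<and> \<not> ei_x3_evolution u))"
proof -
  let ?U = "planar_lift u0"
  have U: "smooth_periodic_divfree ?U"
    by (rule planar_lift_smooth_periodic_divfree[OF assms])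
  have "ei_x3_field ?U"
    by (simp add: ei_x3_field_def ei_x3_def planar_lift_def)
  then have "\<forall>n. \<exists>u. Euler_weak_solution ?U u \<and> eq_ae (u 0) ?U \<and> \<not> ei_x3_evolution u \<and> u 1 \<in> L2 \<and>
      \<bar>L2_inner (u 1) probe - (1 / 4) ^ n * seed_overlap 1\<bar> \<le> (1 / 4) ^ n * seed_overlap 1 / 8"
    using seeded_solution[OF U] by simp
  from choice[OF this] obtain u where "\<forall>n. Euler_weak_solution ?U (u n) \<and> eq_ae (u n 0) ?U \<and>
      \<not> ei_x3_evolution (u n) \<and> u n 1 \<in> L2 \<and>
      \<bar>L2_inner (u n 1) probe - (1 / 4) ^ n * seed_overlap 1\<bar> \<le> (1 / 4) ^ n * seed_overlap 1 / 8" ..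
  then have u: "Euler_weak_solution ?U (u n)" "eq_ae (u n 0) ?U" "\<not> ei_x3_evolution (u n)" "u n 1 \<in> L2"
    "\<bar>L2_inner (u n 1) probe - (1 / 4) ^ n * seed_overlap 1\<bar> \<le> (1 / 4) ^ n * seed_overlap 1 / 8" for n
    by blast+
  \<comment> \<open>The pairing of the n-th solution lies between 7/8 and 9/8 of
    \<open>(1 / 4) ^ n * seed_overlap 1\<close>. As 9/8 times 1/4 is below 7/8, these ranges are
    disjoint and decrease with n.\<close>
  have less: "L2_inner (u n 1) probe < L2_inner (u m 1) probe" if "m < n" for m n
  proof -
    have "(1 / 4) ^ n \<le> (1 / 4 :: real) ^ Suc m" using that by (intro power_decreasing) auto
    then have "(1 / 4) ^ n * seed_overlap 1 \<le> (1 / 4) ^ m * seed_overlap 1 / 4"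
      using mult_right_mono[of "(1 / 4) ^ n" "(1 / 4 :: real) ^ Suc m" "seed_overlap 1"] seed_overlap(2) by simp
    moreover have "(1 / 4) ^ m * seed_overlap 1 > 0" using seed_overlap(2) by simp
    ultimately show ?thesis using u(5)[of n] u(5)[of m] by linarith
  qed
  have ne: "\<not> eq_ae (u m 1) (u n 1)" if "m \<noteq> n" for m n
    using eq_ae_L2_inner[OF _ u(4) u(4) continuous_in_L2[OF continuous_probe], of m n] less[of m n] less[of n m] that
    by (auto simp: neq_iff)
  have "eq_ae f f" for f :: "real^3 \<Rightarrow> real^3" by (simp add: eq_ae_def)
  then have "inj u" unfolding inj_def using ne by metis
  then have "infinite (range u)" by (simp add: finite_image_iff)
  moreover have "pairwise (\<lambda>u v. \<exists>t\<ge>0. \<not> eq_ae (u t) (v t)) (range u)"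
  proof (intro pairwiseI)
    fix v w assume "v \<in> range u" "w \<in> range u" "v \<noteq> w"
    then obtain m n where "v = u m" "w = u n" "m \<noteq> n" by blast
    then show "\<exists>t\<ge>0. \<not> eq_ae (v t) (w t)" using ne[of m n] by (intro exI[of _ 1]) simp
  qed
  ultimately have "\<exists>S. infinite S \<and> pairwise (\<lambda>u v. \<exists>t\<ge>0. \<not> eq_ae (u t) (v t)) S \<and>
      (\<forall>u\<in>S. Euler_weak_solution ?U u \<and> eq_ae (u 0) ?U \<and> \<not> ei_x3_evolution u)"
    using u(1-3) by (intro exI[of _ "range u"]) blast
  then show ?thesis
    by (intro conjI exI[of _ "u 0"] u)
qed

end
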